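(* Let $G$ be a regular diffeological Lie group and let $X$ be a Hausdorff, smoothly paracompact diffeological space. Then any weakly D-numerable principal $G$-bundle $\pi\colon E\to X$ admits a diffeological connection. Consequently, for this diffeological connection, any smooth curve into $X$ has a unique horizontal lift to $E$ (through any prescribed initial point of $E$ over a point of the curve).
   Context: Diffeology. A diffeology on a set $X$ is a collection of maps $p\colon U\to X$ ("plots"), $U$ open in some $\mathbb{R}^n$, $n\ge 0$, that contains constant maps, is closed under precomposition with smooth maps between open subsets of Euclidean spaces, and contains every map that is locally a plot. A map is smooth if its composition with every plot is a plot. The D-topology is the finest topology making all plots continuous; topological terms refer to it. Subsets, products, quotients carry the subset, product, quotient diffeologies; $[0,1]\subseteq\mathbb{R}$ has the subset diffeology; spaces $C^\infty(X,Y)$ of smooth maps carry the functional diffeology ($p\colon U\to C^\infty(X,Y)$ is a plot iff $(u,x)\mapsto p(u)(x)$ is smooth). A diffeological group is a group with a diffeology for which multiplication and inversion are smooth. $X$ is smoothly paracompact if its D-topology is paracompact and every open cover admits a subordinate smooth partition of unity. Bundles. For a smooth surjection $\pi\colon E\to X$ and smooth $f\colon Y\to X$, $f^*E=\{(y,e)\in Y\times E\mid f(y)=\pi(e)\}$. $\pi$ is trivial with fibre $F$ if there is a diffeomorphism $E\to X\times F$ over $X$; a local trivialisation is a D-open cover $\{U_\alpha\}$ with trivialisations of $E|_{U_\alpha}$; $\pi$ is a diffeological fibre bundle if $p^*E\to U$ is locally trivial for every plot $p\colon U\to X$. It is a principal $G$-bundle if moreover $G$ acts smoothly on $E$ and for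 every plot $p\colon U\to X$ and $u\in U$ there are an open neighbourhood $V$ of $u$ and a plot $q\colon V\to E$ with $\pi\circ q=p|_V$ such that $V\times G\to(p|_V)^*E$, $(v,g)\mapsto(v,g\cdot q(v))$ is an equivariant diffeomorphism. It is weakly D-numerable if there are a local trivialisation over a cover $\{U_i\}_{i\in\mathbb{N}}$ of $X$ and a pointwise-finite smooth partition of unity $\{\zeta_i\}_{i\in\mathbb{N}}$ with $\zeta_i^{-1}((0,1])\subseteq U_i$. Tangent spaces. For $x\in X$, the internal tangent space $T_xX$ is the colimit in real vector spaces of $T_0U$ over the category of plots $p\colon U\to X$ with $U$ connected, $0\in U$, $p(0)=x$, arrows from $p\colon U\to X$ to $q\colon V\to X$ being smooth $f\colon U\to V$ with $f(0)=0$, $q\circ f=p$. $TX=\bigsqcup_xT_xX$; each plot $p$ induces $Tp=p_*\colon TU\to TX$, and $TX$ has the smallest diffeology such that all $Tp$ are smooth and $TX\to X$ is a vector pseudo-bundle (smooth surjection whose fibres are diffeological vector spaces, with smooth fibrewise addition, scalar multiplication and zero section). $T$ is a functor; $f_*=Tf$; for a smooth curve $c$, $\frac{dc}{dt}=c_*(\frac{d}{dt})$. Regular diffeological Lie groups. A diffeological group $G$ with identity $e$ is a diffeological Lie group if (1) for every nonzero $\xi\in T_eG$ there is a smooth linear functional $\ell\colon T_eG\to\mathbb{R}$ with $\ell(\xi)\neq0$, and (2) the plots of $T_eG$ smoothly factor through a map $\varphi\colon V\to T_eG$ where $V$ is an open subset of a complete Hausdorff locally convex topological vector space. Then $\mathfrak{g}:=T_eG$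 is a Lie algebra under the infinitesimal adjoint action. $G$ is regular if there is a smooth map $\exp\colon C^\infty([0,1],\mathfrak{g})\to C^\infty([0,1],G)$ sending $\xi(t)$ to a curve $g(t)$ that is the unique solution of $g(0)=e$, $(R_{g(t)^{-1}})_*\frac{dg(t)}{dt}=\xi(t)$, where $R_h$ denotes right multiplication by $h$. Diffeological connections. $\operatorname{Paths}_{\mathrm{loc}}(E)$ is the set of smooth maps $\gamma\colon(a,b)\to E$, over all open intervals $(a,b)\subseteq\mathbb{R}$; $p\colon U\to\operatorname{Paths}_{\mathrm{loc}}(E)$ is a plot iff for each $u\in U$ and $v\in\operatorname{dom}(p(u))$ there are open neighbourhoods $U'$ of $u$, $V'$ of $v$ such that $V'\subseteq\operatorname{dom}(p(u'))$ for all $u'\in U'$ and $U'\times V'\to E$, $(u',v')\mapsto p(u')(v')$ is smooth. $\operatorname{tbPaths}_{\mathrm{loc}}(E)=\{(\gamma,t)\in\operatorname{Paths}_{\mathrm{loc}}(E)\times\mathbb{R}\mid t\in\operatorname{dom}(\gamma)\}$ with the subset diffeology. A diffeological connection on a principal $G$-bundle $\pi\colon E\to X$ is a smooth map $\theta\colon\operatorname{tbPaths}_{\mathrm{loc}}(E)\to\operatorname{Paths}_{\mathrm{loc}}(E)$ such that for all $(\gamma,t_0)$: (1) $\operatorname{dom}\theta(\gamma,t_0)=\operatorname{dom}\gamma$; (2) $\pi\circ\theta(\gamma,t_0)=\pi\circ\gamma$; (3) $\theta(\gamma,t_0)(t_0)=\gamma(t_0)$; (4) $\theta(g\cdot\gamma,t_0)=g\cdot\theta(\gamma,t_0)$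 for all $g\in G$; (5) $\theta(\gamma\circ f,s)=\theta(\gamma,f(s))\circ f$ for any smooth $f$ from an open subset of $\mathbb{R}$ into $\operatorname{dom}(\gamma)$; (6) $\theta(\theta(\gamma,t_0),t_0)=\theta(\gamma,t_0)$. A local path $\gamma$ in $E$ is horizontal if $\theta(\gamma,t_0)=\gamma$ for $t_0\in\operatorname{dom}\gamma$; a horizontal lift of a smooth curve $c\colon(a,b)\to X$ through $y\in\pi^{-1}(c(t_0))$ is a horizontal $\gamma\colon(a,b)\to E$ with $\pi\circ\gamma=c$, $\gamma(t_0)=y$. *)

theory Defs
  imports "HOL-Analysis.Analysis" "HOL-Algebra.Group_Action"
begin

section \<open>Smooth maps on open subsets of Euclidean spaces\<close>

text \<open>
  Plots have domains in all the spaces \<open>\<real>\<^sup>n\<close> at once, so \<open>\<real>\<^sup>n\<close> is the library space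
  \<^term>\<open>Euclidean_space n\<close>: the functions \<^typ>\<open>nat \<Rightarrow> real\<close> vanishing at all indices \<open>\<ge> n\<close>.
\<close>

type_synonym vec = "nat \<Rightarrow> real"

abbreviation zero_vec :: vec where
  "zero_vec \<equiv> (\<lambda>_. 0)"

text \<open>
  \<open>C_diff k n U W f\<close>: all partial derivatives of \<open>f\<close> of order up to \<open>k\<close> exist and are continuous
  on the open set \<open>U\<close> of \<open>\<real>\<^sup>n\<close>. The values lie in a topological vector space, which is
  \<^term>\<open>euclideanreal\<close> except in the definition of a diffeological Lie group.
\<close>

primrec C_diff ::
    "nat \<Rightarrow> nat \<Rightarrow> vec set \<Rightarrow> 'w::real_vector topology \<Rightarrow> (vec \<Rightarrow> 'w) \<Rightarrow> bool" where
  "C_diff 0 n U W f \<longleftrightarrow> continuous_map (subtopology (Euclidean_space n) U) W f"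
| "C_diff (Suc k) n U W f \<longleftrightarrow>
     continuous_map (subtopology (Euclidean_space n) U) W f \<and>
     (\<forall>i<n. \<exists>g. (\<forall>x\<in>U. limitin W (\<lambda>h. (f (x(i := x i + h)) - f x) /\<^sub>R h) (g x) (at 0)) \<and>
                C_diff k n U W g)"

definition C_inf :: "nat \<Rightarrow> vec set \<Rightarrow> 'w::real_vector topology \<Rightarrow> (vec \<Rightarrow> 'w) \<Rightarrow> bool" where
  "C_inf n U W f \<longleftrightarrow> (\<forall>k. C_diff k n U W f)"

lemma C_diff_real_Suc:
  "C_diff (Suc k) n U euclideanreal f \<longleftrightarrow>
     continuous_map (subtopology (Euclidean_space n) U) euclideanreal f \<and>
     (\<forall>i<n. \<exists>g. (\<forall>x\<in>U. ((\<lambda>t. f (x(i := t))) has_real_derivative g x) (at (x i))) \<and>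
                C_diff k n U euclideanreal g)"
  by (simp add: DERIV_def divide_inverse_commute)

definition smooth_eucl :: "nat \<Rightarrow> vec set \<Rightarrow> nat \<Rightarrow> vec set \<Rightarrow> (vec \<Rightarrow> vec) \<Rightarrow> bool" where
  "smooth_eucl m V n U f \<longleftrightarrow>
     f \<in> V \<rightarrow> U \<and> (\<forall>j<n. C_inf m V euclideanreal (\<lambda>x. f x j))"

text \<open>The differential at the origin of a smooth map from an open subset of \<open>\<real>\<^sup>m\<close>,
  by its Jacobian matrix.\<close>

definition diff0 :: "nat \<Rightarrow> (vec \<Rightarrow> vec) \<Rightarrow> vec \<Rightarrow> vec" where
  "diff0 m f v = (\<lambda>j. \<Sum>i<m. deriv (\<lambda>t. f (zero_vec(i := t)) j) 0 * v i)"


section \<open>Diffeological spaces\<close>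

text \<open>\<open>plot X n U p\<close>: the restriction of \<open>p\<close> to the open subset \<open>U\<close> of \<open>\<real>\<^sup>n\<close> is a plot.\<close>

record 'a diffeological_space =
  points :: "'a set"
  plot :: "nat \<Rightarrow> vec set \<Rightarrow> (vec \<Rightarrow> 'a) \<Rightarrow> bool"

text \<open>The second clause only says that the values of \<open>p\<close> outside \<open>U\<close> are irrelevant.\<close>

definition diffeology :: "'a diffeological_space \<Rightarrow> bool" where
  "diffeology X \<longleftrightarrow>
     (\<forall>n U p. plot X n U p \<longrightarrow> openin (Euclidean_space n) U \<and> p \<in> U \<rightarrow> points X) \<and>
     (\<forall>n U p q. plot X n U p \<longrightarrow> (\<forall>x\<in>U. q x = p x) \<longrightarrow> plot X n U q) \<and>
     (\<forall>n U x. openin (Euclidean_space n) U \<longrightarrow> x \<in> points X \<longrightarrow> plot X n U (\<lambda>_. x)) \<and>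
     (\<forall>n U p m V f. plot X n U p \<longrightarrow> openin (Euclidean_space m) V \<longrightarrow> smooth_eucl m V n U f
        \<longrightarrow> plot X m V (p \<circ> f)) \<and>
     (\<forall>n U p. openin (Euclidean_space n) U \<longrightarrow>
        (\<forall>u\<in>U. \<exists>V. openin (Euclidean_space n) V \<and> u \<in> V \<and> V \<subseteq> U \<and> plot X n V p)
        \<longrightarrow> plot X n U p)"

definition smooth ::
    "'a diffeological_space \<Rightarrow> 'b diffeological_space \<Rightarrow> ('a \<Rightarrow> 'b) \<Rightarrow> bool" where
  "smooth X Y f \<longleftrightarrow>
     f \<in> points X \<rightarrow> points Y \<and> (\<forall>n U p. plot X n U p \<longrightarrow> plot Y n U (f \<circ> p))"

definition diffeomorphism ::
    "'a diffeological_space \<Rightarrow> 'b diffeological_space \<Rightarrow> ('a \<Rightarrow> 'b) \<Rightarrow> bool" where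
  "diffeomorphism X Y f \<longleftrightarrow>
     smooth X Y f \<and> bij_betw f (points X) (points Y) \<and>
     smooth Y X (inv_into (points X) f)"

definition eucl_diffeology :: "nat \<Rightarrow> vec set \<Rightarrow> vec diffeological_space" where
  "eucl_diffeology n U =
     \<lparr>points = U,
      plot = (\<lambda>m V q. openin (Euclidean_space m) V \<and> smooth_eucl m V n U q)\<rparr>"

definition real_diffeology :: "real diffeological_space" where
  "real_diffeology =
     \<lparr>points = UNIV,
      plot = (\<lambda>m V q. openin (Euclidean_space m) V \<and> C_inf m V euclideanreal q)\<rparr>"

definition subset_diffeology ::
    "'a diffeological_space \<Rightarrow> 'a set \<Rightarrow> 'a diffeological_space" where
  "subset_diffeology X A =
     \<lparr>points = points X \<inter> A,
      plot = (\<lambda>n U p. plot X n U p \<and> p \<in> U \<rightarrow> A)\<rparr>"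

definition prod_diffeology ::
    "'a diffeological_space \<Rightarrow> 'b diffeological_space \<Rightarrow> ('a \<times> 'b) diffeological_space" where
  "prod_diffeology X Y =
     \<lparr>points = points X \<times> points Y,
      plot = (\<lambda>n U p. plot X n U (fst \<circ> p) \<and> plot Y n U (snd \<circ> p))\<rparr>"

definition smooth_maps ::
    "'a diffeological_space \<Rightarrow> 'b diffeological_space \<Rightarrow> ('a \<Rightarrow> 'b) diffeological_space" where
  "smooth_maps X Y =
     \<lparr>points = {f \<in> extensional (points X). smooth X Y f},
      plot = (\<lambda>n U p. openin (Euclidean_space n) U \<and>
        (\<forall>u\<in>U. p u \<in> extensional (points X) \<and> smooth X Y (p u)) \<and>
        smooth (prod_diffeology (eucl_diffeology n U) X) Y (\<lambda>(u, x). p u x))\<rparr>"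

abbreviation interval_diffeology :: "real set \<Rightarrow> real diffeological_space" where
  "interval_diffeology I \<equiv> subset_diffeology real_diffeology I"


section \<open>The D-topology and smooth paracompactness\<close>

definition D_topology :: "'a diffeological_space \<Rightarrow> 'a topology" where
  "D_topology X = topology (\<lambda>A. A \<subseteq> points X \<and>
     (\<forall>n U p. plot X n U p \<longrightarrow> openin (Euclidean_space n) {u \<in> U. p u \<in> A}))"

lemma openin_D_topology:
  assumes "diffeology X"
  shows "openin (D_topology X) A \<longleftrightarrow> A \<subseteq> points X \<and>
     (\<forall>n U p. plot X n U p \<longrightarrow> openin (Euclidean_space n) {u \<in> U. p u \<in> A})"
proof -
  have "istopology (\<lambda>A. A \<subseteq> points X \<and>
     (\<forall>n U p. plot X n U p \<longrightarrow> openin (Euclidean_space n) {u \<in> U. p u \<in> A}))"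
    unfolding istopology_def
  proof (intro conjI allI impI; (elim conjE)?)
    fix S T n U p
    assume "\<forall>n U p. plot X n U p \<longrightarrow> openin (Euclidean_space n) {u \<in> U. p u \<in> S}"
      and "\<forall>n U p. plot X n U p \<longrightarrow> openin (Euclidean_space n) {u \<in> U. p u \<in> T}"
      and "plot X n U p"
    then have "openin (Euclidean_space n) ({u \<in> U. p u \<in> S} \<inter> {u \<in> U. p u \<in> T})"
      by blast
    moreover have "{u \<in> U. p u \<in> S} \<inter> {u \<in> U. p u \<in> T} = {u \<in> U. p u \<in> S \<inter> T}" by blast
    ultimately show "openin (Euclidean_space n) {u \<in> U. p u \<in> S \<inter> T}" by simp
  next
    fix \<K> n U p
    assume "\<forall>K\<in>\<K>. K \<subseteq> points X \<and>
        (\<forall>n U p. plot X n U p \<longrightarrow> openin (Euclidean_space n) {u \<in> U. p u \<in> K})"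
      and "plot X n U p"
    then have "openin (Euclidean_space n) (\<Union>K\<in>\<K>. {u \<in> U. p u \<in> K})" by blast
    moreover have "(\<Union>K\<in>\<K>. {u \<in> U. p u \<in> K}) = {u \<in> U. p u \<in> \<Union>\<K>}" by blast
    ultimately show "openin (Euclidean_space n) {u \<in> U. p u \<in> \<Union>\<K>}" by simp
  qed blast+
  then show ?thesis
    by (simp add: D_topology_def)
qed

lemma topspace_D_topology:
  assumes "diffeology X"
  shows "topspace (D_topology X) = points X"
proof -
  have *: "openin (Euclidean_space n) U \<and> p \<in> U \<rightarrow> points X" if "plot X n U p" for n U p
    using assms that unfolding diffeology_def by (elim conjE) blast
  have "openin (Euclidean_space n) {u \<in> U. p u \<in> points X}" if "plot X n U p" for n U p
  proof -
    have "{u \<in> U. p u \<in> points X} = U" using *[OF that] by blast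
    then show ?thesis using *[OF that] by simp
  qed
  then have "openin (D_topology X) (points X)"
    unfolding openin_D_topology[OF assms] by blast
  moreover have "topspace (D_topology X) \<subseteq> points X"
    using openin_D_topology[OF assms] openin_topspace by blast
  ultimately show ?thesis
    using openin_subset by blast
qed

text \<open>No separation axiom is included here.\<close>

definition paracompact_space :: "'a topology \<Rightarrow> bool" where
  "paracompact_space T \<longleftrightarrow>
     (\<forall>\<U>. (\<forall>U\<in>\<U>. openin T U) \<and> \<Union>\<U> = topspace T \<longrightarrow>
        (\<exists>\<V>. (\<forall>V\<in>\<V>. openin T V) \<and> \<Union>\<V> = topspace T \<and>
             (\<forall>V\<in>\<V>. \<exists>U\<in>\<U>. V \<subseteq> U) \<and> locally_finite_in T \<V>))"

definition subordinate_partition ::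
    "'a diffeological_space \<Rightarrow> 'a set set \<Rightarrow> ('a set \<Rightarrow> 'a \<Rightarrow> real) \<Rightarrow> bool" where
  "subordinate_partition X \<U> \<rho> \<longleftrightarrow>
     (\<forall>U\<in>\<U>. smooth X (interval_diffeology {0..1}) (\<rho> U) \<and>
        Abstract_Topology.closure_of (D_topology X) {x \<in> points X. \<rho> U x \<noteq> 0} \<subseteq> U) \<and>
     (\<forall>x\<in>points X. \<exists>N. openin (D_topology X) N \<and> x \<in> N \<and>
        finite {U \<in> \<U>. \<exists>y\<in>N. \<rho> U y \<noteq> 0}) \<and>
     (\<forall>x\<in>points X. (\<Sum>U\<in>{U \<in> \<U>. \<rho> U x \<noteq> 0}. \<rho> U x) = 1)"

definition smoothly_paracompact :: "'a diffeological_space \<Rightarrow> bool" where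
  "smoothly_paracompact X \<longleftrightarrow>
     paracompact_space (D_topology X) \<and>
     (\<forall>\<U>. (\<forall>U\<in>\<U>. openin (D_topology X) U) \<and> \<Union>\<U> = points X \<longrightarrow>
        (\<exists>\<rho>. subordinate_partition X \<U> \<rho>))"


section \<open>Internal tangent spaces\<close>

text \<open>
  The objects of the category indexing the colimit are triples \<open>(n, U, p)\<close>. Triples that differ
  only in the values of \<open>p\<close> outside \<open>U\<close> are isomorphic through the identity of \<open>U\<close>, so
  they do not change the colimit.
\<close>

type_synonym 'a plot_data = "nat \<times> vec set \<times> (vec \<Rightarrow> 'a)"

definition pointed_plot :: "'a diffeological_space \<Rightarrow> 'a \<Rightarrow> 'a plot_data \<Rightarrow> bool" where
  "pointed_plot X x = (\<lambda>(n, U, p).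
     plot X n U p \<and> connectedin (Euclidean_space n) U \<and> zero_vec \<in> U \<and> p zero_vec = x)"

definition plot_arrow :: "'a plot_data \<Rightarrow> 'a plot_data \<Rightarrow> (vec \<Rightarrow> vec) \<Rightarrow> bool" where
  "plot_arrow = (\<lambda>(n, U, p) (m, V, q) f.
     smooth_eucl n U m V f \<and> f zero_vec = zero_vec \<and> (\<forall>u\<in>U. q (f u) = p u))"

text \<open>
  The colimit is the quotient of the direct sum of the spaces \<open>T\<^sub>0U = \<real>\<^sup>n\<close>, over all pointed plots
  \<open>(n, U, p)\<close>, by the subspace spanned by the differences between a vector and its image under
  an arrow. Elements of the direct sum are finitely supported functions on plot data;
  elements of the quotient are cosets.
\<close>

type_synonym 'a formal_vec = "'a plot_data \<Rightarrow> vec"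

definition single :: "'a plot_data \<Rightarrow> vec \<Rightarrow> 'a formal_vec" where
  "single P v = (\<lambda>Q. if Q = P then v else zero_vec)"

definition formal_vecs :: "'a diffeological_space \<Rightarrow> 'a \<Rightarrow> 'a formal_vec set" where
  "formal_vecs X x =
     {a. finite {P. a P \<noteq> zero_vec} \<and>
         (\<forall>P. a P \<noteq> zero_vec \<longrightarrow>
            pointed_plot X x P \<and> a P \<in> topspace (Euclidean_space (fst P)))}"

inductive_set tangent_relations :: "'a diffeological_space \<Rightarrow> 'a \<Rightarrow> 'a formal_vec set"
  for X x where
  zero: "(\<lambda>P i. 0) \<in> tangent_relations X x"
| add: "a \<in> tangent_relations X x \<Longrightarrow> b \<in> tangent_relations X x \<Longrightarrow>
          (\<lambda>P i. a P i + b P i) \<in> tangent_relations X x"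
| scale: "a \<in> tangent_relations X x \<Longrightarrow> (\<lambda>P i. r * a P i) \<in> tangent_relations X x"
| arrow: "pointed_plot X x P \<Longrightarrow> pointed_plot X x Q \<Longrightarrow> plot_arrow P Q f \<Longrightarrow>
          v \<in> topspace (Euclidean_space (fst P)) \<Longrightarrow>
          (\<lambda>R i. single Q (diff0 (fst P) f v) R i - single P v R i) \<in> tangent_relations X x"

definition tangent_class ::
    "'a diffeological_space \<Rightarrow> 'a \<Rightarrow> 'a formal_vec \<Rightarrow> 'a formal_vec set" where
  "tangent_class X x a =
     {b \<in> formal_vecs X x. (\<lambda>P i. b P i - a P i) \<in> tangent_relations X x}"

type_synonym 'a tangent = "'a \<times> 'a formal_vec set"

definition tangent_space :: "'a diffeological_space \<Rightarrow> 'a \<Rightarrow> 'a tangent set" where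
  "tangent_space X x = (\<lambda>a. (x, tangent_class X x a)) ` formal_vecs X x"

definition tangent_zero :: "'a diffeological_space \<Rightarrow> 'a \<Rightarrow> 'a tangent" where
  "tangent_zero X x = (x, tangent_class X x (\<lambda>P i. 0))"

text \<open>The operations on cosets; all members of each union are the same coset. The sum is
  meaningful only for two tangent vectors at the same point.\<close>

definition tangent_add ::
    "'a diffeological_space \<Rightarrow> 'a tangent \<Rightarrow> 'a tangent \<Rightarrow> 'a tangent" where
  "tangent_add X = (\<lambda>(x, A) (y, B).
     (x, \<Union>a\<in>A. \<Union>b\<in>B. tangent_class X x (\<lambda>P i. a P i + b P i)))"

definition tangent_scale ::
    "'a diffeological_space \<Rightarrow> real \<Rightarrow> 'a tangent \<Rightarrow> 'a tangent" where
  "tangent_scale X r = (\<lambda>(x, A). (x, \<Union>a\<in>A. tangent_class X x (\<lambda>P i. r * a P i)))"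

definition push_formal :: "('a \<Rightarrow> 'b) \<Rightarrow> 'a formal_vec \<Rightarrow> 'b formal_vec" where
  "push_formal f a = (\<lambda>(n, U, q) i.
     \<Sum>P | a P \<noteq> zero_vec \<and> (\<exists>p. P = (n, U, p) \<and> f \<circ> p = q). a P i)"

definition tangent_map ::
    "'b diffeological_space \<Rightarrow> ('a \<Rightarrow> 'b) \<Rightarrow> 'a tangent \<Rightarrow> 'b tangent" where
  "tangent_map Y f = (\<lambda>(x, A). (f x, \<Union>a\<in>A. tangent_class Y (f x) (push_formal f a)))"

text \<open>
  For a plot \<open>p\<close> on \<open>U\<close>, the map \<open>Tp\<close> with \<open>TU\<close> identified with \<open>U \<times> \<real>\<^sup>n\<close>. The vector \<open>v\<close> at
  \<open>u\<close> is represented at the origin by translating \<open>p\<close> by \<open>u\<close> and passing to the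
  component of the origin, as the domains in the colimit are connected.
\<close>

definition plot_tangent ::
    "'a diffeological_space \<Rightarrow> nat \<Rightarrow> vec set \<Rightarrow> (vec \<Rightarrow> 'a) \<Rightarrow> vec \<Rightarrow> vec \<Rightarrow> 'a tangent" where
  "plot_tangent X n U p u v =
     (let V = connected_component_of_set
                (subtopology (Euclidean_space n) {w. (\<lambda>i. u i + w i) \<in> U}) zero_vec;
          P = (n, V, \<lambda>w. p (\<lambda>i. u i + w i))
      in (p u, tangent_class X (p u) (single P v)))"

definition TX_points :: "'a diffeological_space \<Rightarrow> 'a tangent set" where
  "TX_points X = (\<Union>x\<in>points X. tangent_space X x)"

definition tangent_admissible ::
    "'a diffeological_space \<Rightarrow> 'a tangent diffeological_space \<Rightarrow> bool" where
  "tangent_admissible X D \<longleftrightarrow>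
     diffeology D \<and> points D = TX_points X \<and>
     (\<forall>n U p. plot X n U p \<longrightarrow>
        smooth (prod_diffeology (eucl_diffeology n U)
                                (eucl_diffeology n (topspace (Euclidean_space n)))) D
               (\<lambda>(u, v). plot_tangent X n U p u v)) \<and>
     smooth D X fst \<and>
     smooth (subset_diffeology (prod_diffeology D D) {(\<xi>, \<eta>). fst \<xi> = fst \<eta>}) D
            (\<lambda>(\<xi>, \<eta>). tangent_add X \<xi> \<eta>) \<and>
     smooth (prod_diffeology real_diffeology D) D (\<lambda>(r, \<xi>). tangent_scale X r \<xi>) \<and>
     smooth X D (tangent_zero X)"

text \<open>The smallest admissible diffeology is the intersection of all of them.\<close>

definition tangent_bundle :: "'a diffeological_space \<Rightarrow> 'a tangent diffeological_space" where
  "tangent_bundle X =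
     \<lparr>points = TX_points X,
      plot = (\<lambda>n U q. \<forall>D. tangent_admissible X D \<longrightarrow> plot D n U q)\<rparr>"

definition tangent_at :: "'a diffeological_space \<Rightarrow> 'a \<Rightarrow> 'a tangent diffeological_space" where
  "tangent_at X x = subset_diffeology (tangent_bundle X) (tangent_space X x)"

text \<open>The velocity \<open>c\<^sub>*(d/dt)\<close> at \<open>t\<close> of a curve \<open>c\<close> on the open interval \<open>I\<close>.\<close>

definition velocity ::
    "'a diffeological_space \<Rightarrow> real set \<Rightarrow> (real \<Rightarrow> 'a) \<Rightarrow> real \<Rightarrow> 'a tangent" where
  "velocity X I c t =
     plot_tangent X 1 {w \<in> topspace (Euclidean_space 1). w 0 \<in> I} (\<lambda>w. c (w 0))
       (zero_vec(0 := t)) (zero_vec(0 := 1))"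


section \<open>Regular diffeological Lie groups\<close>

definition diffeological_group :: "'g monoid \<Rightarrow> 'g diffeological_space \<Rightarrow> bool" where
  "diffeological_group G D \<longleftrightarrow>
     group G \<and> diffeology D \<and> points D = carrier G \<and>
     smooth (prod_diffeology D D) D (\<lambda>(x, y). x \<otimes>\<^bsub>G\<^esub> y) \<and>
     smooth D D (\<lambda>x. inv\<^bsub>G\<^esub> x)"

definition complete_Hausdorff_lctvs :: "'w::real_vector topology \<Rightarrow> bool" where
  "complete_Hausdorff_lctvs W \<longleftrightarrow>
     topspace W = UNIV \<and> Hausdorff_space W \<and>
     continuous_map (prod_topology W W) W (\<lambda>(x, y). x + y) \<and>
     continuous_map (prod_topology euclideanreal W) W (\<lambda>(r, x). r *\<^sub>R x) \<and>
     (\<forall>N. openin W N \<and> 0 \<in> N \<longrightarrow> (\<exists>C. openin W C \<and> convex C \<and> 0 \<in> C \<and> C \<subseteq> N)) \<and>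
     (\<forall>F. F \<noteq> bot \<and>
          (\<forall>N. openin W N \<and> 0 \<in> N \<longrightarrow>
             (\<exists>A. eventually (\<lambda>x. x \<in> A) F \<and> (\<forall>x\<in>A. \<forall>y\<in>A. x - y \<in> N)))
        \<longrightarrow> (\<exists>l. limitin W (\<lambda>x. x) l F))"

definition tangent_linear ::
    "'a diffeological_space \<Rightarrow> 'a \<Rightarrow> ('a tangent \<Rightarrow> real) \<Rightarrow> bool" where
  "tangent_linear X x l \<longleftrightarrow>
     (\<forall>\<xi>\<in>tangent_space X x. \<forall>\<eta>\<in>tangent_space X x. l (tangent_add X \<xi> \<eta>) = l \<xi> + l \<eta>) \<and>
     (\<forall>r. \<forall>\<xi>\<in>tangent_space X x. l (tangent_scale X r \<xi>) = r * l \<xi>)"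

text \<open>
  The locally convex space \<open>W\<close> through which the plots of the tangent space factor is a
  parameter, as a formula cannot quantify existentially over its type. A theorem that assumes
  the property for an arbitrary \<open>W\<close> assumes exactly the existence of some such space.
\<close>

definition diffeological_Lie_group ::
    "'g monoid \<Rightarrow> 'g diffeological_space \<Rightarrow> 'w::real_vector topology \<Rightarrow> bool" where
  "diffeological_Lie_group G D W \<longleftrightarrow>
     diffeological_group G D \<and>
     (\<forall>\<xi>\<in>tangent_space D \<one>\<^bsub>G\<^esub>. \<xi> \<noteq> tangent_zero D \<one>\<^bsub>G\<^esub> \<longrightarrow>
        (\<exists>l. tangent_linear D \<one>\<^bsub>G\<^esub> l \<and> smooth (tangent_at D \<one>\<^bsub>G\<^esub>) real_diffeology l \<and> l \<xi> \<noteq> 0)) \<and>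
     complete_Hausdorff_lctvs W \<and>
     (\<exists>V \<phi>. openin W V \<and> \<phi> \<in> V \<rightarrow> tangent_space D \<one>\<^bsub>G\<^esub> \<and>
        (\<forall>n U p. plot (tangent_at D \<one>\<^bsub>G\<^esub>) n U p \<longrightarrow>
           (\<exists>q. q \<in> U \<rightarrow> V \<and> C_inf n U W q \<and> (\<forall>u\<in>U. p u = \<phi> (q u)))))"

text \<open>
  The equation is imposed on the open interval only: the internal tangent spaces of \<open>[0,1]\<close> at
  its endpoints are zero, so there is no vector \<open>d/dt\<close> there.
\<close>

definition log_derivative_solution ::
    "'g monoid \<Rightarrow> 'g diffeological_space \<Rightarrow> (real \<Rightarrow> 'g tangent) \<Rightarrow> (real \<Rightarrow> 'g) \<Rightarrow> bool" where
  "log_derivative_solution G D \<xi> g \<longleftrightarrow>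
     g 0 = \<one>\<^bsub>G\<^esub> \<and>
     (\<forall>t\<in>{0<..<1}.
        tangent_map D (\<lambda>x. x \<otimes>\<^bsub>G\<^esub> inv\<^bsub>G\<^esub> (g t)) (velocity D {0<..<1} g t) = \<xi> t)"

definition regular_diffeological_Lie_group ::
    "'g monoid \<Rightarrow> 'g diffeological_space \<Rightarrow> 'w::real_vector topology \<Rightarrow> bool" where
  "regular_diffeological_Lie_group G D W \<longleftrightarrow>
     diffeological_Lie_group G D W \<and>
     (let I = interval_diffeology {0..1}; \<gg> = tangent_at D \<one>\<^bsub>G\<^esub> in
      \<exists>Exp. smooth (smooth_maps I \<gg>) (smooth_maps I D) Exp \<and>
        (\<forall>\<xi>\<in>points (smooth_maps I \<gg>). \<forall>g\<in>points (smooth_maps I D).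
           log_derivative_solution G D \<xi> g \<longleftrightarrow> g = Exp \<xi>))"


section \<open>Bundles\<close>

definition restrict_total ::
    "'e diffeological_space \<Rightarrow> ('e \<Rightarrow> 'x) \<Rightarrow> 'x set \<Rightarrow> 'e diffeological_space" where
  "restrict_total E \<pi> U = subset_diffeology E {e. \<pi> e \<in> U}"

definition pullback ::
    "'y diffeological_space \<Rightarrow> ('y \<Rightarrow> 'x) \<Rightarrow> 'e diffeological_space \<Rightarrow> ('e \<Rightarrow> 'x)
       \<Rightarrow> ('y \<times> 'e) diffeological_space" where
  "pullback Y f E \<pi> = subset_diffeology (prod_diffeology Y E) {(y, e). f y = \<pi> e}"

text \<open>The fibre may be sought in the type of the total space: over a nonempty base it is
  diffeomorphic to any fibre of the map, and over an empty base it is irrelevant.\<close>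

definition trivial_bundle ::
    "'e diffeological_space \<Rightarrow> 'x diffeological_space \<Rightarrow> ('e \<Rightarrow> 'x) \<Rightarrow> bool" where
  "trivial_bundle E X \<pi> \<longleftrightarrow>
     (\<exists>(F :: 'e diffeological_space) \<Phi>. diffeology F \<and>
        diffeomorphism E (prod_diffeology X F) \<Phi> \<and> (\<forall>e\<in>points E. fst (\<Phi> e) = \<pi> e))"

definition trivial_over ::
    "'e diffeological_space \<Rightarrow> 'x diffeological_space \<Rightarrow> ('e \<Rightarrow> 'x) \<Rightarrow> 'x set \<Rightarrow> bool" where
  "trivial_over E X \<pi> U \<longleftrightarrow> trivial_bundle (restrict_total E \<pi> U) (subset_diffeology X U) \<pi>"

definition locally_trivial ::
    "'e diffeological_space \<Rightarrow> 'x diffeological_space \<Rightarrow> ('e \<Rightarrow> 'x) \<Rightarrow> bool" where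
  "locally_trivial E X \<pi> \<longleftrightarrow>
     (\<exists>\<U>. \<Union>\<U> = points X \<and>
          (\<forall>U\<in>\<U>. openin (D_topology X) U \<and> trivial_over E X \<pi> U))"

definition diffeological_fibre_bundle ::
    "'e diffeological_space \<Rightarrow> 'x diffeological_space \<Rightarrow> ('e \<Rightarrow> 'x) \<Rightarrow> bool" where
  "diffeological_fibre_bundle E X \<pi> \<longleftrightarrow>
     diffeology E \<and> diffeology X \<and> smooth E X \<pi> \<and> \<pi> ` points E = points X \<and>
     (\<forall>n U p. plot X n U p \<longrightarrow>
        locally_trivial (pullback (eucl_diffeology n U) p E \<pi>) (eucl_diffeology n U) fst)"

definition smooth_action ::
    "'g monoid \<Rightarrow> 'g diffeological_space \<Rightarrow> 'e diffeological_space \<Rightarrow> ('g \<Rightarrow> 'e \<Rightarrow> 'e) \<Rightarrow> bool" where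
  "smooth_action G D E act \<longleftrightarrow>
     group_action G (points E) act \<and> smooth (prod_diffeology D E) E (\<lambda>(g, e). act g e)"

text \<open>In the last clause the group acts on \<open>V \<times> G\<close> by left multiplication on the second factor,
  and on the pullback through its action on \<open>E\<close>.\<close>

definition principal_bundle ::
    "'g monoid \<Rightarrow> 'g diffeological_space \<Rightarrow> ('g \<Rightarrow> 'e \<Rightarrow> 'e) \<Rightarrow>
     'e diffeological_space \<Rightarrow> 'x diffeological_space \<Rightarrow> ('e \<Rightarrow> 'x) \<Rightarrow> bool" where
  "principal_bundle G D act E X \<pi> \<longleftrightarrow>
     diffeological_fibre_bundle E X \<pi> \<and> diffeological_group G D \<and> smooth_action G D E act \<and>
     (\<forall>n U p. plot X n U p \<longrightarrow> (\<forall>u\<in>U. \<exists>V q.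
        openin (Euclidean_space n) V \<and> u \<in> V \<and> V \<subseteq> U \<and>
        plot E n V q \<and> (\<forall>v\<in>V. \<pi> (q v) = p v) \<and>
        (let \<Psi> = (\<lambda>(v, g). (v, act g (q v))) in
          diffeomorphism (prod_diffeology (eucl_diffeology n V) D)
                         (pullback (eucl_diffeology n V) p E \<pi>) \<Psi> \<and>
          (\<forall>v\<in>V. \<forall>g\<in>carrier G. \<forall>h\<in>carrier G.
             \<Psi> (v, h \<otimes>\<^bsub>G\<^esub> g) = (fst (\<Psi> (v, g)), act h (snd (\<Psi> (v, g))))))))"

definition weakly_D_numerable ::
    "'e diffeological_space \<Rightarrow> 'x diffeological_space \<Rightarrow> ('e \<Rightarrow> 'x) \<Rightarrow> bool" where
  "weakly_D_numerable E X \<pi> \<longleftrightarrow>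
     (\<exists>(U :: nat \<Rightarrow> 'x set) (\<zeta> :: nat \<Rightarrow> 'x \<Rightarrow> real).
        (\<Union>i. U i) = points X \<and>
        (\<forall>i. openin (D_topology X) (U i) \<and> trivial_over E X \<pi> (U i)) \<and>
        (\<forall>i. smooth X (interval_diffeology {0..1}) (\<zeta> i) \<and>
             {x \<in> points X. \<zeta> i x \<in> {0<..1}} \<subseteq> U i) \<and>
        (\<forall>x\<in>points X. finite {i. \<zeta> i x \<noteq> 0} \<and> (\<Sum>i | \<zeta> i x \<noteq> 0. \<zeta> i x) = 1))"


section \<open>Diffeological connections\<close>

text \<open>A local path is the pair of its domain and a function that is \<^term>\<open>undefined\<close> off the
  domain. Open intervals are nonempty and may be unbounded.\<close>

type_synonym 'a local_path = "real set \<times> (real \<Rightarrow> 'a)"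

definition open_interval :: "real set \<Rightarrow> bool" where
  "open_interval I \<longleftrightarrow> open I \<and> is_interval I \<and> I \<noteq> {}"

definition Paths_loc :: "'a diffeological_space \<Rightarrow> 'a local_path diffeological_space" where
  "Paths_loc E =
     (let Paths = {(I, \<gamma>). open_interval I \<and> \<gamma> \<in> extensional I \<and>
                           smooth (interval_diffeology I) E \<gamma>} in
      \<lparr>points = Paths,
       plot = (\<lambda>n U p. openin (Euclidean_space n) U \<and> p \<in> U \<rightarrow> Paths \<and>
         (\<forall>u\<in>U. \<forall>v\<in>fst (p u). \<exists>U' V'.
            openin (Euclidean_space n) U' \<and> u \<in> U' \<and> U' \<subseteq> U \<and> open V' \<and> v \<in> V' \<and>
            (\<forall>u'\<in>U'. V' \<subseteq> fst (p u')) \<and>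
            smooth (prod_diffeology (eucl_diffeology n U') (interval_diffeology V')) E
                   (\<lambda>(u', v'). snd (p u') v')))\<rparr>)"

definition tbPaths_loc :: "'a diffeological_space \<Rightarrow> ('a local_path \<times> real) diffeological_space" where
  "tbPaths_loc E =
     subset_diffeology (prod_diffeology (Paths_loc E) real_diffeology) {(\<gamma>, t). t \<in> fst \<gamma>}"

definition act_path :: "('g \<Rightarrow> 'e \<Rightarrow> 'e) \<Rightarrow> 'g \<Rightarrow> 'e local_path \<Rightarrow> 'e local_path" where
  "act_path act g = (\<lambda>(I, \<gamma>). (I, \<lambda>t\<in>I. act g (\<gamma> t)))"

text \<open>\<open>reparam \<gamma> J f\<close> is \<open>\<gamma> \<circ> f\<close> with \<open>f\<close> defined on \<open>J\<close>.\<close>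

definition reparam :: "'e local_path \<Rightarrow> real set \<Rightarrow> (real \<Rightarrow> real) \<Rightarrow> 'e local_path" where
  "reparam \<gamma> J f = (J, \<lambda>s\<in>J. snd \<gamma> (f s))"

text \<open>Reparametrisations are restricted to interval domains, since \<open>\<gamma> \<circ> f\<close> must be a local path.\<close>

definition diffeological_connection ::
    "'g monoid \<Rightarrow> ('g \<Rightarrow> 'e \<Rightarrow> 'e) \<Rightarrow> 'e diffeological_space \<Rightarrow> ('e \<Rightarrow> 'x) \<Rightarrow>
     ('e local_path \<times> real \<Rightarrow> 'e local_path) \<Rightarrow> bool" where
  "diffeological_connection G act E \<pi> \<theta> \<longleftrightarrow>
     smooth (tbPaths_loc E) (Paths_loc E) \<theta> \<and>
     (\<forall>\<gamma> t\<^sub>0. (\<gamma>, t\<^sub>0) \<in> points (tbPaths_loc E) \<longrightarrow>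
        fst (\<theta> (\<gamma>, t\<^sub>0)) = fst \<gamma> \<and>
        (\<forall>t\<in>fst \<gamma>. \<pi> (snd (\<theta> (\<gamma>, t\<^sub>0)) t) = \<pi> (snd \<gamma> t)) \<and>
        snd (\<theta> (\<gamma>, t\<^sub>0)) t\<^sub>0 = snd \<gamma> t\<^sub>0 \<and>
        (\<forall>g\<in>carrier G. \<theta> (act_path act g \<gamma>, t\<^sub>0) = act_path act g (\<theta> (\<gamma>, t\<^sub>0))) \<and>
        \<theta> (\<theta> (\<gamma>, t\<^sub>0), t\<^sub>0) = \<theta> (\<gamma>, t\<^sub>0)) \<and>
     (\<forall>\<gamma>\<in>points (Paths_loc E). \<forall>J f s.
        open_interval J \<longrightarrow> smooth (interval_diffeology J) (interval_diffeology (fst \<gamma>)) f \<longrightarrow> s \<in> J \<longrightarrow>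
        \<theta> (reparam \<gamma> J f, s) = reparam (\<theta> (\<gamma>, f s)) J f)"

definition horizontal ::
    "'e diffeological_space \<Rightarrow> ('e local_path \<times> real \<Rightarrow> 'e local_path) \<Rightarrow> 'e local_path \<Rightarrow> bool" where
  "horizontal E \<theta> \<gamma> \<longleftrightarrow>
     \<gamma> \<in> points (Paths_loc E) \<and> (\<forall>t\<^sub>0\<in>fst \<gamma>. \<theta> (\<gamma>, t\<^sub>0) = \<gamma>)"

definition horizontal_lift ::
    "'e diffeological_space \<Rightarrow> ('e \<Rightarrow> 'x) \<Rightarrow> ('e local_path \<times> real \<Rightarrow> 'e local_path) \<Rightarrow>
     'x local_path \<Rightarrow> real \<Rightarrow> 'e \<Rightarrow> 'e local_path \<Rightarrow> bool" where
  "horizontal_lift E \<pi> \<theta> c t\<^sub>0 y \<gamma> \<longleftrightarrow>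
     horizontal E \<theta> \<gamma> \<and> fst \<gamma> = fst c \<and>
     (\<forall>t\<in>fst c. \<pi> (snd \<gamma> t) = snd c t) \<and> snd \<gamma> t\<^sub>0 = y"

end

theory Submission
  imports Defs
begin

text \<open>
  A trivialisation over an open set gives a smooth section, hence a flat connection there: a path \<open>\<gamma>\<close>
  becomes a curve \<open>g\<close> in \<open>G\<close>, and its connection form is the right logarithmic derivative \<open>g' g\<^sup>-\<^sup>1\<close>. The
  pointwise finite partition of unity of a weak D-numeration need not glue these forms smoothly, but
  smooth paracompactness yields one subordinate to the same cover that is locally finite with closed
  supports; let \<open>\<Xi>\<close> be the resulting average. Since \<open>(hg)'(hg)\<^sup>-\<^sup>1 = h' h\<^sup>-\<^sup>1 + Ad\<^sub>h (g' g\<^sup>-\<^sup>1)\<close>, replacing \<open>\<gamma>\<close> by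
  \<open>h \<gamma>\<close> turns \<open>\<Xi>\<close> into \<open>h' h\<^sup>-\<^sup>1 + Ad\<^sub>h \<Xi>\<close>. By regularity there is \<open>k\<close> with \<open>k' k\<^sup>-\<^sup>1 = \<Xi>\<close> and \<open>k(t\<^sub>0) = e\<close>; the connection
  sends \<open>(\<gamma>, t\<^sub>0)\<close> to \<open>k\<^sup>-\<^sup>1 \<gamma>\<close>, whose form vanishes, and all its axioms follow from uniqueness of \<open>k\<close>.

  Horizontal paths are those with \<open>\<Xi> = 0\<close>. Two of them over the same curve differ by a curve \<open>h\<close> with
  \<open>h' h\<^sup>-\<^sup>1 = 0\<close>, so they agree once they meet; local lifts exist by the sections, and a connectedness
  argument extends them to the whole interval.
\<close>

section \<open>Calculus on open subsets of Euclidean spaces\<close>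

text \<open>There is no calculus of forms to draw on, since tangent vectors are cosets in a colimit.
  Computations are made with representatives, formal vectors compared modulo the relations of the
  colimit, and the identities between logarithmic derivatives rest on two facts about velocities:
  the chain rule, and additivity along the diagonal of a two-parameter family. The action is on the
  left, so with the right logarithmic derivative the inhomogeneous term is the same in every
  trivialisation and survives an average whose weights add up to 1. Two obstacles shape the rest.
  Regularity solves equations on the unit interval only and says nothing at its endpoints, while
  local paths live on arbitrary open intervals and start anywhere; hence the rescaling to segments
  and the comparison of solutions with different starting times. And the connection corrects a path
  that already lies in E, so it produces lifts of a curve in X only where some lift is known
  beforehand.\<close>

abbreviation Rn :: "nat \<Rightarrow> vec set" where "Rn n \<equiv> topspace (Euclidean_space n)"
abbreviation opn :: "nat \<Rightarrow> vec set \<Rightarrow> bool" where "opn n \<equiv> openin (Euclidean_space n)"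
abbreviation Ck :: "nat \<Rightarrow> nat \<Rightarrow> vec set \<Rightarrow> (vec \<Rightarrow> real) \<Rightarrow> bool" where
  "Ck k n U f \<equiv> C_diff k n U euclideanreal f"
abbreviation Cs :: "nat \<Rightarrow> vec set \<Rightarrow> (vec \<Rightarrow> real) \<Rightarrow> bool" where
  "Cs n U f \<equiv> C_inf n U euclideanreal f"

section \<open>Coordinate boxes as neighbourhoods\<close>

lemma Rn_iff: "x \<in> Rn n \<longleftrightarrow> (\<forall>i\<ge>n. x i = 0)"
  by (simp add: topspace_Euclidean_space)

lemma Euclidean_space_top_of_set: "Euclidean_space n = top_of_set {x. \<forall>i\<ge>n. x i = 0}"
  by (simp add: Euclidean_space_def euclidean_product_topology)

lemma opn_openin: "opn n U \<longleftrightarrow> openin (top_of_set (Rn n)) U"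
  by (simp add: Euclidean_space_top_of_set)

lemma opn_subset: "opn n U \<Longrightarrow> U \<subseteq> Rn n"
  by (rule openin_subset)

lemma continuous_map_real_iff:
  "U \<subseteq> Rn n \<Longrightarrow>
     continuous_map (subtopology (Euclidean_space n) U) euclideanreal f \<longleftrightarrow> continuous_on U f"
  by (simp add: Euclidean_space_top_of_set subtopology_subtopology inf.absorb2)

text \<open>The topology is a subspace of an infinite product, but on \<open>Rn n\<close> the
  coordinates from \<open>n\<close> on are pinned to 0. Only finitely many coordinates can leave a
  basic neighbourhood, so one radius serves them all.\<close>

lemma opn_box:
  "opn n U \<longleftrightarrow> U \<subseteq> Rn n \<and> (\<forall>x\<in>U. \<exists>e>0. \<forall>y\<in>Rn n. (\<forall>i<n. \<bar>y i - x i\<bar> < e) \<longrightarrow> y \<in> U)"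
proof
  assume U: "opn n U"
  then obtain T where T: "open T" "U = Rn n \<inter> T"
    by (auto simp: opn_openin openin_open)
  have "\<exists>e>0. \<forall>y\<in>Rn n. (\<forall>i<n. \<bar>y i - x i\<bar> < e) \<longrightarrow> y \<in> U" if "x \<in> U" for x
  proof -
    have "openin (powertop_real UNIV) T"
      using T(1) unfolding euclidean_product_topology by simp
    moreover have "x \<in> T" using that T(2) by blast
    ultimately have "\<exists>B. finite {i \<in> UNIV. B i \<noteq> topspace euclideanreal} \<and>
        (\<forall>i\<in>UNIV. openin euclideanreal (B i)) \<and> x \<in> Pi\<^sub>E UNIV B \<and> Pi\<^sub>E UNIV B \<subseteq> T"
      unfolding openin_product_topology_alt by blast
    then obtain B where B: "\<And>i. open (B i)" "x \<in> Pi\<^sub>E UNIV B" "Pi\<^sub>E UNIV B \<subseteq> T"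
      by auto
    have "\<exists>e>0. \<forall>t. \<bar>t - x i\<bar> < e \<longrightarrow> t \<in> B i" for i
    proof -
      have "x i \<in> B i" using B(2) by blast
      then show ?thesis using B(1)[of i] unfolding open_dist dist_real_def by blast
    qed
    then obtain e where e: "\<And>i. e i > 0" "\<And>i t. \<bar>t - x i\<bar> < e i \<Longrightarrow> t \<in> B i" by metis
    \<comment> \<open>The extra element 1 keeps the minimum meaningful when
      \<open>n = 0\<close>.\<close>
    define d where "d = Min (insert 1 (e ` {..<n}))"
    have d: "d > 0" "\<And>i. i < n \<Longrightarrow> d \<le> e i" by (auto simp: d_def e)
    have "y \<in> U" if y: "y \<in> Rn n" "\<forall>i<n. \<bar>y i - x i\<bar> < d" for y
    proof -
      have "y i \<in> B i" for i
      proof (cases "i < n")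
        case True then show ?thesis using y d e by (meson order_less_le_trans)
      next
        case False
        then have "y i = x i" using y(1) \<open>x \<in> U\<close> T(2) by (auto simp: Rn_iff)
        then show ?thesis using B(2) by auto
      qed
      then show ?thesis using B(3) T(2) y(1) by auto
    qed
    then show ?thesis using d by blast
  qed
  then show "U \<subseteq> Rn n \<and> (\<forall>x\<in>U. \<exists>e>0. \<forall>y\<in>Rn n. (\<forall>i<n. \<bar>y i - x i\<bar> < e) \<longrightarrow> y \<in> U)"
    using opn_subset[OF U] by blast
next
  assume *: "U \<subseteq> Rn n \<and> (\<forall>x\<in>U. \<exists>e>0. \<forall>y\<in>Rn n. (\<forall>i<n. \<bar>y i - x i\<bar> < e) \<longrightarrow> y \<in> U)"
  show "opn n U"
  proof (subst openin_subopen, intro ballI)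
    fix x assume x: "x \<in> U"
    then obtain e where e: "e > 0" "\<And>y. y \<in> Rn n \<Longrightarrow> (\<forall>i<n. \<bar>y i - x i\<bar> < e) \<Longrightarrow> y \<in> U"
      using * by blast
    have "open (\<Inter>i\<in>{..<n}. {y::vec. \<bar>y i - x i\<bar> < e})"
      by (intro open_INT ballI open_Collect_less continuous_intros) auto
    then have "opn n (Rn n \<inter> (\<Inter>i\<in>{..<n}. {y. \<bar>y i - x i\<bar> < e}))"
      by (simp add: opn_openin openin_open_Int)
    then show "\<exists>T. opn n T \<and> x \<in> T \<and> T \<subseteq> U"
      using e x * by (intro exI[of _ "Rn n \<inter> (\<Inter>i\<in>{..<n}. {y. \<bar>y i - x i\<bar> < e})"] conjI) auto
  qed
qed

lemma opn_nhd:
  assumes "opn n U" "x \<in> U"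
  shows "\<exists>e>0. \<forall>y\<in>Rn n. (\<forall>i<n. \<bar>y i - x i\<bar> < e) \<longrightarrow> y \<in> U"
  using assms unfolding opn_box by blast

lemma opn_upd_eventually:
  assumes "opn n U" "x \<in> U" "i < n"
  shows "eventually (\<lambda>t. x(i := t) \<in> U) (nhds (x i))"
proof -
  obtain e where e: "e > 0" "\<forall>y\<in>Rn n. (\<forall>i<n. \<bar>y i - x i\<bar> < e) \<longrightarrow> y \<in> U"
    using opn_nhd[OF assms(1,2)] by blast
  have x: "x \<in> Rn n" using assms opn_subset by blast
  have "x(i := t) \<in> U" if "dist t (x i) < e" for t
    using that e(1) assms(3) x by (intro e(2)[rule_format]) (auto simp: Rn_iff dist_real_def)
  then show ?thesis unfolding eventually_nhds_metric using e(1) by blast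
qed

lemma continuous_on_opn:
  assumes "opn n U" "continuous_on U f" "x \<in> U" "(e::real) > 0"
  shows "\<exists>d>0. \<forall>y\<in>Rn n. (\<forall>i<n. \<bar>y i - x i\<bar> < d) \<longrightarrow> y \<in> U \<and> \<bar>f y - f x\<bar> < e"
proof -
  have 1: "openin (top_of_set U) (U \<inter> f -` ball (f x) e)"
    using assms(2) continuous_openin_preimage_gen open_ball by blast
  have "opn n (U \<inter> f -` ball (f x) e)"
    using openin_trans[OF 1] assms(1) unfolding opn_openin by blast
  moreover have "x \<in> U \<inter> f -` ball (f x) e" using assms by simp
  ultimately obtain d where d: "d > 0"
    "\<forall>y\<in>Rn n. (\<forall>i<n. \<bar>y i - x i\<bar> < d) \<longrightarrow> y \<in> U \<inter> f -` ball (f x) e"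
    using opn_nhd by blast
  then have "\<forall>y\<in>Rn n. (\<forall>i<n. \<bar>y i - x i\<bar> < d) \<longrightarrow> y \<in> U \<and> \<bar>f y - f x\<bar> < e"
    by (auto simp: dist_real_def abs_minus_commute)
  then show ?thesis using d(1) by blast
qed

section \<open>Finitely often differentiable functions\<close>

lemma Ck_cong:
  assumes "opn n U" "\<And>x. x \<in> U \<Longrightarrow> f x = g x" "Ck k n U f"
  shows "Ck k n U g"
proof -
  have c: "continuous_on U g" if "Ck k n U f" for k
    using that assms(2) by (cases k) (auto simp: continuous_map_real_iff[OF opn_subset[OF assms(1)]]
        cong: continuous_on_cong)
  show ?thesis
  proof (cases k)
    case 0
    then show ?thesis using c[OF assms(3)] continuous_map_real_iff[OF opn_subset[OF assms(1)]] by simp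
  next
    case (Suc k')
    have "\<exists>h. (\<forall>x\<in>U. ((\<lambda>t. g (x(i := t))) has_real_derivative h x) (at (x i))) \<and> Ck k' n U h"
      if i: "i < n" for i
    proof -
      obtain h where h: "\<And>x. x \<in> U \<Longrightarrow> ((\<lambda>t. f (x(i := t))) has_real_derivative h x) (at (x i))"
        "Ck k' n U h"
        using assms(3) i unfolding Suc C_diff_real_Suc by blast
      have "((\<lambda>t. g (x(i := t))) has_real_derivative h x) (at (x i))" if "x \<in> U" for x
      proof -
        have "\<forall>\<^sub>F t in nhds (x i). f (x(i := t)) = g (x(i := t))"
          using opn_upd_eventually[OF assms(1) that i] by (rule eventually_mono) (rule assms(2))
        then show ?thesis using h(1)[OF that] by (simp add: DERIV_cong_ev[OF refl _ refl])
      qed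
      then show ?thesis using h(2) by blast
    qed
    then show ?thesis
      unfolding Suc C_diff_real_Suc using c[OF assms(3)]
        continuous_map_real_iff[OF opn_subset[OF assms(1)]] by blast
  qed
qed

text \<open>A fixed choice of the derivatives that \<open>C_diff\<close> only asserts to exist, so
  that they can be named in inductions on the order.\<close>

definition partial_deriv :: "nat \<Rightarrow> (vec \<Rightarrow> real) \<Rightarrow> vec \<Rightarrow> real" where
  "partial_deriv i f x = deriv (\<lambda>t. f (x(i := t))) (x i)"

text \<open>Any witness for the existential agrees with \<open>partial_deriv\<close> on
  \<open>U\<close> by uniqueness of derivatives, and \<open>Ck_cong\<close> carries the regularity
  over.\<close>

lemma Ck_Suc_partial_deriv:
  assumes "opn n U"
  shows "Ck (Suc k) n U f \<longleftrightarrow> continuous_on U f \<and>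
    (\<forall>i<n. (\<forall>x\<in>U. ((\<lambda>t. f (x(i := t))) has_real_derivative partial_deriv i f x) (at (x i))) \<and> Ck k n U (partial_deriv i f))"
proof -
  have *: "(\<exists>h. (\<forall>x\<in>U. ((\<lambda>t. f (x(i := t))) has_real_derivative h x) (at (x i))) \<and> Ck k n U h) \<longleftrightarrow>
    (\<forall>x\<in>U. ((\<lambda>t. f (x(i := t))) has_real_derivative partial_deriv i f x) (at (x i))) \<and> Ck k n U (partial_deriv i f)"
    (is "?l \<longleftrightarrow> ?r") for i
  proof
    assume ?l
    then obtain h where h: "\<And>x. x \<in> U \<Longrightarrow> ((\<lambda>t. f (x(i := t))) has_real_derivative h x) (at (x i))"
      "Ck k n U h" by blast
    have "h x = partial_deriv i f x" if "x \<in> U" for x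
      using h(1)[OF that] by (simp add: partial_deriv_def DERIV_imp_deriv)
    then show ?r using h Ck_cong[OF assms] by metis
  qed blast
  show ?thesis
    unfolding C_diff_real_Suc * continuous_map_real_iff[OF opn_subset[OF assms]] by blast
qed

lemma Ck_0: "opn n U \<Longrightarrow> Ck 0 n U f \<longleftrightarrow> continuous_on U f"
  by (simp add: continuous_map_real_iff[OF opn_subset])

lemma Ck_cont: "opn n U \<Longrightarrow> Ck k n U f \<Longrightarrow> continuous_on U f"
  by (cases k) (auto simp: continuous_map_real_iff[OF opn_subset])

lemma Ck_pred: "opn n U \<Longrightarrow> Ck (Suc k) n U f \<Longrightarrow> Ck k n U f"
proof (induction k arbitrary: f)
  case 0 then show ?case by (simp add: Ck_0 Ck_cont del: C_diff.simps)
next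
  case (Suc k)
  show ?case using Suc.IH[OF Suc.prems(1)] Suc.prems(2) by (simp add: Ck_Suc_partial_deriv[OF Suc.prems(1)] del: C_diff.simps)
qed

lemma Ck_I:
  assumes "opn n U" "continuous_on U f"
    "\<And>i x. i < n \<Longrightarrow> x \<in> U \<Longrightarrow> ((\<lambda>t. f (x(i := t))) has_real_derivative g i x) (at (x i))"
    "\<And>i. i < n \<Longrightarrow> Ck k n U (g i)"
  shows "Ck (Suc k) n U f"
  unfolding C_diff_real_Suc continuous_map_real_iff[OF opn_subset[OF assms(1)]]
  using assms by blast

lemma Ck_const: "opn n U \<Longrightarrow> Ck k n U (\<lambda>_. c)"
proof (induction k arbitrary: c)
  case 0 then show ?case by (simp add: Ck_0 del: C_diff.simps)
next
  case (Suc k) show ?case by (rule Ck_I[where g = "\<lambda>_ _. 0"]) (use Suc in auto)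
qed

lemma Ck_coord:
  assumes U: "opn n U"
  shows "Ck k n U (\<lambda>x. x j)"
proof -
  have c: "continuous_on U (\<lambda>x::vec. x j)"
    by (rule continuous_on_subset[OF continuous_on_product_coordinates subset_UNIV])
  show ?thesis
  proof (cases k)
    case (Suc k')
    have "((\<lambda>t. (x(i := t)) j) has_real_derivative (if i = j then 1 else 0)) (at (x i))" for x :: vec and i
      by auto
    then show ?thesis unfolding Suc
      using Ck_const[OF U] by (intro Ck_I[where g = "\<lambda>i _. if i = j then 1 else 0", OF U c]) auto
  qed (use c Ck_0[OF U] in blast)
qed

lemma Ck_add: "opn n U \<Longrightarrow> Ck k n U f \<Longrightarrow> Ck k n U g \<Longrightarrow> Ck k n U (\<lambda>x. f x + g x)"
proof (induction k arbitrary: f g)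
  case 0 then show ?case by (simp add: Ck_0 continuous_on_add del: C_diff.simps)
next
  case (Suc k)
  note U = Suc.prems(1)
  show ?case
  proof (rule Ck_I[where g = "\<lambda>i x. partial_deriv i f x + partial_deriv i g x"])
    show "continuous_on U (\<lambda>x. f x + g x)"
      using Suc.prems Ck_cont by (blast intro: continuous_on_add)
    show "((\<lambda>t. f (x(i := t)) + g (x(i := t))) has_real_derivative partial_deriv i f x + partial_deriv i g x) (at (x i))"
      if "i < n" "x \<in> U" for i x
      using DERIV_add[of "\<lambda>t. f (x(i := t))" "partial_deriv i f x" "x i" UNIV "\<lambda>t. g (x(i := t))" "partial_deriv i g x"] Suc.prems that
      by (simp add: Ck_Suc_partial_deriv[OF U] del: C_diff.simps)
    show "Ck k n U (\<lambda>x. partial_deriv i f x + partial_deriv i g x)" if "i < n" for i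
      using Suc.prems that Suc.IH[OF U] by (simp add: Ck_Suc_partial_deriv[OF U] del: C_diff.simps)
  qed (rule U)
qed

lemma Ck_mult: "opn n U \<Longrightarrow> Ck k n U f \<Longrightarrow> Ck k n U g \<Longrightarrow> Ck k n U (\<lambda>x. f x * g x)"
proof (induction k arbitrary: f g)
  case 0 then show ?case by (simp add: Ck_0 continuous_on_mult del: C_diff.simps)
next
  case (Suc k)
  note U = Suc.prems(1)
  have *: "Ck k n U f" "Ck k n U g" using Suc.prems Ck_pred by blast+
  show ?case
  proof (rule Ck_I[where g = "\<lambda>i x. partial_deriv i f x * g x + partial_deriv i g x * f x"])
    show "continuous_on U (\<lambda>x. f x * g x)"
      using Suc.prems Ck_cont by (blast intro: continuous_on_mult)
    show "((\<lambda>t. f (x(i := t)) * g (x(i := t))) has_real_derivative partial_deriv i f x * g x + partial_deriv i g x * f x) (at (x i))"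
      if "i < n" "x \<in> U" for i x
      using DERIV_mult[of "\<lambda>t. f (x(i := t))" "partial_deriv i f x" "x i" UNIV "\<lambda>t. g (x(i := t))" "partial_deriv i g x"] Suc.prems that
      by (simp add: Ck_Suc_partial_deriv[OF U] del: C_diff.simps)
    show "Ck k n U (\<lambda>x. partial_deriv i f x * g x + partial_deriv i g x * f x)" if "i < n" for i
      using * Suc.prems that Suc.IH[OF U] Ck_add[OF U] by (simp add: Ck_Suc_partial_deriv[OF U] del: C_diff.simps)
  qed (rule U)
qed

lemma Ck_sum: "opn n U \<Longrightarrow> (\<And>j. j \<in> A \<Longrightarrow> Ck k n U (f j)) \<Longrightarrow> Ck k n U (\<lambda>x. \<Sum>j\<in>A. f j x)"
  by (induction A rule: infinite_finite_induct) (auto intro: Ck_const Ck_add simp del: C_diff.simps)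

lemma Ck_subset:
  "opn n U \<Longrightarrow> opn n V \<Longrightarrow> V \<subseteq> U \<Longrightarrow> Ck k n U f \<Longrightarrow> Ck k n V f"
proof (induction k arbitrary: f)
  case 0 then show ?case by (auto simp: Ck_0 intro: continuous_on_subset simp del: C_diff.simps)
next
  case (Suc k) then show ?case by (auto simp: Ck_Suc_partial_deriv simp del: C_diff.simps intro: continuous_on_subset)
qed

lemma Ck_local:
  "opn n U \<Longrightarrow> (\<And>u. u \<in> U \<Longrightarrow> \<exists>V. opn n V \<and> u \<in> V \<and> V \<subseteq> U \<and> Ck k n V f) \<Longrightarrow> Ck k n U f"
proof (induction k arbitrary: f)
  case 0
  have "continuous (at u within U) f" if u: "u \<in> U" for u
  proof -
    obtain V where V: "opn n V" "u \<in> V" "V \<subseteq> U" "Ck 0 n V f" using 0(2)[OF u] by blast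
    then obtain T where T: "open T" "V = Rn n \<inter> T" by (auto simp: opn_openin openin_open)
    have "at u within U = at u within V"
      using at_within_nhd[of u T U V] V T opn_subset[OF 0(1)] by blast
    then show ?thesis using V Ck_0[OF V(1)] continuous_on_eq_continuous_within by metis
  qed
  then show ?case unfolding Ck_0[OF 0(1)] continuous_on_eq_continuous_within by blast
next
  case (Suc k)
  have 1: "Ck 0 n U f" if IH: "\<And>f. (\<And>u. u \<in> U \<Longrightarrow> \<exists>V. opn n V \<and> u \<in> V \<and> V \<subseteq> U \<and> Ck k n V f) \<Longrightarrow> Ck k n U f"
    using IH[of f] Suc.prems by (metis Ck_0 Ck_cont Ck_pred)
  have "continuous_on U f" using 1 Suc.IH[OF Suc.prems(1)] Ck_0[OF Suc.prems(1)] by blast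
  moreover have "((\<lambda>t. f (x(i := t))) has_real_derivative partial_deriv i f x) (at (x i))" if "i < n" "x \<in> U" for i x
    using Suc.prems(2)[OF that(2)] that(1) Ck_Suc_partial_deriv by blast
  moreover have "Ck k n U (partial_deriv i f)" if "i < n" for i
    using Suc.IH[OF Suc.prems(1)] Suc.prems(2) that Ck_Suc_partial_deriv by meson
  ultimately show ?case by (simp add: Ck_Suc_partial_deriv[OF Suc.prems(1)] del: C_diff.simps)
qed

text \<open>The chain rule from continuous partial derivatives alone. The increment of
  \<open>f\<close> is telescoped along a staircase that moves one coordinate at a time; the mean
  value theorem turns each stair into a partial derivative at an intermediate point, and these
  points tend to \<open>c t0\<close>.\<close>

lemma has_real_derivative_curve:
  assumes U: "opn n U"
    and D: "\<And>i x. i < n \<Longrightarrow> x \<in> U \<Longrightarrow> ((\<lambda>t. f (x(i := t))) has_real_derivative g i x) (at (x i))"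
    and g: "\<And>i. i < n \<Longrightarrow> continuous_on U (g i)"
    and c0: "c t0 \<in> U" and cR: "eventually (\<lambda>t. c t \<in> Rn n) (at t0)"
    and c: "\<And>i. i < n \<Longrightarrow> ((\<lambda>t. c t i) has_real_derivative c' i) (at t0)"
  shows "((\<lambda>t. f (c t)) has_real_derivative (\<Sum>i<n. g i (c t0) * c' i)) (at t0)"
proof -
  \<comment> \<open>The corner of the staircase after the first \<open>j\<close> coordinates have
    moved.\<close>
  define mid where "mid j t = (\<lambda>i. if i < j then c t i else c t0 i)" for j t
  obtain e where e: "e > 0" "\<forall>y\<in>Rn n. (\<forall>i<n. \<bar>y i - c t0 i\<bar> < e) \<longrightarrow> y \<in> U"
    using opn_nhd[OF U c0] by blast
  have c0R: "c t0 \<in> Rn n" using c0 U opn_subset by blast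
  have near: "eventually (\<lambda>t. c t \<in> Rn n \<and> (\<forall>i<n. \<bar>c t i - c t0 i\<bar> < d)) (at t0)" if "d > 0" for d
  proof -
    have "eventually (\<lambda>t. \<forall>i\<in>{..<n}. \<bar>c t i - c t0 i\<bar> < d) (at t0)"
    proof (rule eventually_ball_finite)
      show "\<forall>i\<in>{..<n}. \<forall>\<^sub>F t in at t0. \<bar>c t i - c t0 i\<bar> < d"
      proof
        fix i assume "i \<in> {..<n}"
        then have "((\<lambda>t. c t i) \<longlongrightarrow> c t0 i) (at t0)" using c DERIV_isCont isCont_def by blast
        then show "\<forall>\<^sub>F t in at t0. \<bar>c t i - c t0 i\<bar> < d"
          using that unfolding tendsto_iff dist_real_def by blast
      qed
    qed simp
    with cR show ?thesis by eventually_elim auto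
  qed
  have mvt: "\<exists>z. z \<in> Rn n \<and> (\<forall>i<n. \<bar>z i - c t0 i\<bar> \<le> \<bar>c t i - c t0 i\<bar>) \<and>
      f (mid (Suc j) t) - f (mid j t) = g j z * (c t j - c t0 j)"
    if t: "c t \<in> Rn n" "\<forall>i<n. \<bar>c t i - c t0 i\<bar> < e" and j: "j < n" for t j
  proof -
    let ?p = "\<lambda>r. (mid j t)(j := c t0 j + r * (c t j - c t0 j))"
    have inU: "?p r \<in> Rn n \<and> (\<forall>i<n. \<bar>?p r i - c t0 i\<bar> \<le> \<bar>c t i - c t0 i\<bar>) \<and> ?p r \<in> U" if "0 \<le> r" "r \<le> 1" for r
    proof -
      have 1: "?p r \<in> Rn n" using t(1) c0R j by (auto simp: Rn_iff mid_def)
      have "\<bar>r * (c t j - c t0 j)\<bar> \<le> \<bar>c t j - c t0 j\<bar>"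
        using that by (simp add: abs_mult mult_left_le_one_le)
      then have 2: "\<forall>i<n. \<bar>?p r i - c t0 i\<bar> \<le> \<bar>c t i - c t0 i\<bar>" by (auto simp: mid_def)
      then have "?p r \<in> U" using e(2) 1 t(2) by (meson order_le_less_trans)
      then show ?thesis using 1 2 by blast
    qed
    have der: "((\<lambda>r. f (?p r)) has_real_derivative g j (?p r) * (c t j - c t0 j)) (at r)" if "0 \<le> r" "r \<le> 1" for r
    proof -
      let ?h = "\<lambda>r. c t0 j + r * (c t j - c t0 j)"
      have 1: "((\<lambda>s. f ((?p r)(j := s))) has_real_derivative g j (?p r)) (at (?h r))"
        using D[OF j, of "?p r"] inU[OF that] by simp
      have 2: "(?h has_real_derivative (c t j - c t0 j)) (at r)"
        by (auto intro!: derivative_eq_intros)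
      show ?thesis using DERIV_chain2[OF 1 2] by simp
    qed
    obtain r where r: "0 < r" "r < 1" "f (?p 1) - f (?p 0) = (1 - 0) * (g j (?p r) * (c t j - c t0 j))"
      using MVT2[of 0 1 "\<lambda>r. f (?p r)" "\<lambda>r. g j (?p r) * (c t j - c t0 j)"] der by auto
    have "?p 1 = mid (Suc j) t" "?p 0 = mid j t" by (auto simp: mid_def fun_eq_iff less_Suc_eq)
    with r(3) inU[of r] r(1,2) show ?thesis by (intro exI[of _ "?p r"]) simp
  qed
  \<comment> \<open>Choosing the intermediate points as functions of \<open>t\<close> makes them
    available for a limit; far from \<open>t0\<close> their values are arbitrary.\<close>
  define z where "z j t = (SOME z. z \<in> Rn n \<and> (\<forall>i<n. \<bar>z i - c t0 i\<bar> \<le> \<bar>c t i - c t0 i\<bar>) \<and>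
      f (mid (Suc j) t) - f (mid j t) = g j z * (c t j - c t0 j))" for j t
  have z: "z j t \<in> Rn n \<and> (\<forall>i<n. \<bar>z j t i - c t0 i\<bar> \<le> \<bar>c t i - c t0 i\<bar>) \<and>
      f (mid (Suc j) t) - f (mid j t) = g j (z j t) * (c t j - c t0 j)"
    if "c t \<in> Rn n" "\<forall>i<n. \<bar>c t i - c t0 i\<bar> < e" "j < n" for t j
    using someI_ex[OF mvt[OF that]] unfolding z_def .
  have lim: "((\<lambda>t. g j (z j t)) \<longlongrightarrow> g j (c t0)) (at t0)" if j: "j < n" for j
  proof (rule tendstoI)
    fix r :: real assume "r > 0"
    then obtain d where d: "d > 0"
      "\<forall>y\<in>Rn n. (\<forall>i<n. \<bar>y i - c t0 i\<bar> < d) \<longrightarrow> y \<in> U \<and> \<bar>g j y - g j (c t0)\<bar> < r"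
      using continuous_on_opn[OF U g[OF j] c0] by blast
    from near[OF d(1)] near[OF e(1)] show "\<forall>\<^sub>F t in at t0. dist (g j (z j t)) (g j (c t0)) < r"
    proof eventually_elim
      case (elim t)
      with z[of t j] j have "z j t \<in> Rn n" "\<forall>i<n. \<bar>z j t i - c t0 i\<bar> < d" by (auto intro: order_le_less_trans)
      then show ?case using d(2) by (simp add: dist_real_def)
    qed
  qed
  have "((\<lambda>t. \<Sum>j<n. g j (z j t) * ((c t j - c t0 j) / (t - t0))) \<longlongrightarrow> (\<Sum>j<n. g j (c t0) * c' j)) (at t0)"
    by (intro tendsto_sum tendsto_mult lim) (use c in \<open>auto simp: has_field_derivative_iff\<close>)
  moreover have "eventually (\<lambda>t. (\<Sum>j<n. g j (z j t) * ((c t j - c t0 j) / (t - t0))) = (f (c t) - f (c t0)) / (t - t0)) (at t0)"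
    using near[OF e(1)]
  proof eventually_elim
    case (elim t)
    have "mid n t = c t" using elim c0R by (auto simp: mid_def fun_eq_iff Rn_iff)
    moreover have "mid 0 t = c t0" by (simp add: mid_def)
    ultimately have "f (c t) - f (c t0) = (\<Sum>j<n. f (mid (Suc j) t) - f (mid j t))"
      using sum_lessThan_telescope[of "\<lambda>j. f (mid j t)" n] by simp
    also have "\<dots> = (\<Sum>j<n. g j (z j t) * (c t j - c t0 j))"
      using z elim by (intro sum.cong) auto
    finally show ?case by (simp add: sum_divide_distrib)
  qed
  ultimately show ?thesis
    unfolding has_field_derivative_iff by (simp add: tendsto_cong)
qed

lemma continuous_on_into_Rn:
  assumes "\<And>x. x \<in> V \<Longrightarrow> G x \<in> Rn n" "\<And>j. j < n \<Longrightarrow> continuous_on V (\<lambda>x. G x j)"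
  shows "continuous_on V G"
proof (rule continuous_on_coordinatewise_then_product)
  fix j
  show "continuous_on V (\<lambda>x. G x j)"
  proof (cases "j < n")
    case False
    then have "\<And>x. x \<in> V \<Longrightarrow> G x j = 0" using assms(1) by (auto simp: Rn_iff)
    then show ?thesis by (simp cong: continuous_on_cong)
  qed (rule assms(2))
qed

text \<open>Each partial derivative of the composite is a sum of products of a partial derivative of
  \<open>f\<close> composed with \<open>G\<close> and one of \<open>G\<close>. The first factor
  falls under the induction hypothesis, for which \<open>f\<close> has to be arbitrary.\<close>

lemma Ck_compose:
  assumes "opn n U" "opn m V" "G \<in> V \<rightarrow> U"
  shows "Ck k n U f \<Longrightarrow> (\<And>j. j < n \<Longrightarrow> Ck k m V (\<lambda>x. G x j)) \<Longrightarrow> Ck k m V (\<lambda>x. f (G x))"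
proof (induction k arbitrary: f)
  case (0 f)
  have "continuous_on V G"
    using 0 assms opn_subset Ck_cont by (intro continuous_on_into_Rn[of _ _ n]) blast+
  then have "continuous_on V (\<lambda>x. f (G x))"
    using continuous_on_compose2[of U f V G] 0 assms Ck_cont by blast
  then show ?case using Ck_0 assms by blast
next
  case (Suc k)
  note U = assms(1) and V = assms(2)
  have f: "continuous_on U f"
    "\<And>i x. i < n \<Longrightarrow> x \<in> U \<Longrightarrow> ((\<lambda>t. f (x(i := t))) has_real_derivative partial_deriv i f x) (at (x i))"
    "\<And>i. i < n \<Longrightarrow> Ck k n U (partial_deriv i f)"
    using Suc.prems(1) unfolding Ck_Suc_partial_deriv[OF U] by blast+
  have G: "\<And>i x. j < n \<Longrightarrow> i < m \<Longrightarrow> x \<in> V \<Longrightarrow>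
      ((\<lambda>t. G (x(i := t)) j) has_real_derivative partial_deriv i (\<lambda>x. G x j) x) (at (x i))"
    "\<And>i. j < n \<Longrightarrow> i < m \<Longrightarrow> Ck k m V (partial_deriv i (\<lambda>x. G x j))"
    "j < n \<Longrightarrow> continuous_on V (\<lambda>x. G x j)" for j
    using Suc.prems(2)[of j] unfolding Ck_Suc_partial_deriv[OF V] by blast+
  have cG: "continuous_on V G"
    using G(3) assms opn_subset by (intro continuous_on_into_Rn[of _ _ n]) blast+
  show ?case
  proof (rule Ck_I[where g = "\<lambda>i x. \<Sum>j<n. partial_deriv j f (G x) * partial_deriv i (\<lambda>x. G x j) x"])
    show "continuous_on V (\<lambda>x. f (G x))"
      using continuous_on_compose2[of U f V G] f(1) cG assms by blast
    show "((\<lambda>t. f (G (x(i := t)))) has_real_derivative (\<Sum>j<n. partial_deriv j f (G x) * partial_deriv i (\<lambda>x. G x j) x)) (at (x i))"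
      if i: "i < m" and x: "x \<in> V" for i x
    proof -
      have "eventually (\<lambda>t. x(i := t) \<in> V) (at (x i))"
        using opn_upd_eventually[OF V x i] eventually_nhds_conv_at by blast
      then have near: "eventually (\<lambda>t. G (x(i := t)) \<in> Rn n) (at (x i))"
        by (rule eventually_mono) (use assms opn_subset in blast)
      have GU: "G (x(i := x i)) \<in> U" using assms x by auto
      show ?thesis
        using has_real_derivative_curve[OF U f(2) Ck_cont[OF U f(3)] GU near G(1)[OF _ i x]]
        by simp
    qed
    show "Ck k m V (\<lambda>x. \<Sum>j<n. partial_deriv j f (G x) * partial_deriv i (\<lambda>x. G x j) x)" if "i < m" for i
    proof (intro Ck_sum[OF V] Ck_mult[OF V])
      fix j assume "j \<in> {..<n}"
      then have j: "j < n" by simp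
      show "Ck k m V (\<lambda>x. partial_deriv j f (G x))"
        using Suc.IH[OF f(3)[OF j]] Suc.prems(2) Ck_pred[OF V] by blast
      show "Ck k m V (partial_deriv i (\<lambda>x. G x j))" using G(2)[OF j that] .
    qed
  qed (rule V)
qed

section \<open>Smooth functions on open sets\<close>

lemma Cs_iff: "Cs n U f \<longleftrightarrow> (\<forall>k. Ck k n U f)" by (simp add: C_inf_def)

lemma Cs_cong: "opn n U \<Longrightarrow> (\<And>x. x \<in> U \<Longrightarrow> f x = g x) \<Longrightarrow> Cs n U f \<Longrightarrow> Cs n U g"
  unfolding Cs_iff using Ck_cong by blast

lemma Cs_const: "opn n U \<Longrightarrow> Cs n U (\<lambda>_. c)"
  unfolding Cs_iff using Ck_const by blast

lemma Cs_coord: "opn n U \<Longrightarrow> Cs n U (\<lambda>x. x j)"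
  unfolding Cs_iff using Ck_coord by blast

lemma Cs_add: "opn n U \<Longrightarrow> Cs n U f \<Longrightarrow> Cs n U g \<Longrightarrow> Cs n U (\<lambda>x. f x + g x)"
  unfolding Cs_iff using Ck_add by blast

lemma Cs_mult: "opn n U \<Longrightarrow> Cs n U f \<Longrightarrow> Cs n U g \<Longrightarrow> Cs n U (\<lambda>x. f x * g x)"
  unfolding Cs_iff using Ck_mult by blast

lemma Cs_local:
  "opn n U \<Longrightarrow> (\<And>u. u \<in> U \<Longrightarrow> \<exists>V. opn n V \<and> u \<in> V \<and> V \<subseteq> U \<and> Cs n V f) \<Longrightarrow> Cs n U f"
  unfolding Cs_iff using Ck_local by meson

lemma Cs_subset: "opn n U \<Longrightarrow> opn n V \<Longrightarrow> V \<subseteq> U \<Longrightarrow> Cs n U f \<Longrightarrow> Cs n V f"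
  unfolding Cs_iff using Ck_subset by blast

lemma Cs_compose:
  "opn n U \<Longrightarrow> opn m V \<Longrightarrow> smooth_eucl m V n U G \<Longrightarrow> Cs n U f \<Longrightarrow> Cs m V (\<lambda>x. f (G x))"
  unfolding Cs_iff smooth_eucl_def using Ck_compose by blast

lemma Cs_continuous_on: "opn n U \<Longrightarrow> Cs n U f \<Longrightarrow> continuous_on U f"
  unfolding Cs_iff using Ck_cont by blast

lemma smooth_eucl_continuous_on:
  assumes "opn m V" "opn n U" "smooth_eucl m V n U f"
  shows "continuous_on V f"
  using assms opn_subset Cs_continuous_on unfolding smooth_eucl_def
  by (intro continuous_on_into_Rn[of _ _ n]) blast+

lemma smooth_eucl_preimage_opn:
  assumes "opn m V" "opn n U" "smooth_eucl m V n U f" "opn n A"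
  shows "opn m {v \<in> V. f v \<in> A}"
proof -
  have "opn n (U \<inter> A)" using assms by blast
  then obtain T where T: "open T" "U \<inter> A = Rn n \<inter> T" by (auto simp: opn_openin openin_open)
  have "{v \<in> V. f v \<in> A} = V \<inter> f -` T"
    using T(2) assms(3) opn_subset[OF assms(2)] by (auto simp: smooth_eucl_def)
  moreover have "openin (top_of_set V) (V \<inter> f -` T)"
    using smooth_eucl_continuous_on[OF assms(1-3)] T(1) continuous_openin_preimage_gen by blast
  ultimately show ?thesis using assms(1) openin_trans unfolding opn_openin by metis
qed

section \<open>Diffeological spaces\<close>

lemma plot_openD: "diffeology X \<Longrightarrow> plot X n U p \<Longrightarrow> opn n U"
  unfolding diffeology_def by (drule conjunct1) blast

lemma plot_intoD: "diffeology X \<Longrightarrow> plot X n U p \<Longrightarrow> p \<in> U \<rightarrow> points X"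
  unfolding diffeology_def by (drule conjunct1) blast

lemma plot_cong:
  assumes "diffeology X" "plot X n U p" "\<And>x. x \<in> U \<Longrightarrow> q x = p x"
  shows "plot X n U q"
  using assms(1)[unfolded diffeology_def, THEN conjunct2, THEN conjunct1, rule_format, OF assms(2,3)] .

lemma plot_const:
  assumes "diffeology X" "opn n U" "x \<in> points X"
  shows "plot X n U (\<lambda>_. x)"
  using assms(1)[unfolded diffeology_def, THEN conjunct2, THEN conjunct2, THEN conjunct1, rule_format,
      OF assms(2,3)] .

lemma plot_comp:
  assumes "diffeology X" "plot X n U p" "opn m V" "smooth_eucl m V n U f"
  shows "plot X m V (\<lambda>x. p (f x))"
  using assms(1)[unfolded diffeology_def, THEN conjunct2, THEN conjunct2, THEN conjunct2, THEN conjunct1,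
      rule_format, OF assms(2-4)]
  by (simp add: comp_def)

lemma plot_local:
  assumes "diffeology X" "opn n U"
    "\<And>u. u \<in> U \<Longrightarrow> \<exists>V. opn n V \<and> u \<in> V \<and> V \<subseteq> U \<and> plot X n V p"
  shows "plot X n U p"
  using assms(1)[unfolded diffeology_def, THEN conjunct2, THEN conjunct2, THEN conjunct2, THEN conjunct2,
      rule_format, OF assms(2,3)] .

lemma smooth_eucl_comp:
  assumes "opn m V" "opn n U" "smooth_eucl m V n U f" "smooth_eucl n U k T g"
  shows "smooth_eucl m V k T (\<lambda>x. g (f x))"
  using assms Cs_compose[OF assms(2,1,3), of "\<lambda>x. g x j" for j] unfolding smooth_eucl_def by auto

lemma smooth_eucl_incl: "opn n V \<Longrightarrow> V \<subseteq> U \<Longrightarrow> smooth_eucl n V n U (\<lambda>x. x)"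
  using Cs_coord by (auto simp: smooth_eucl_def)

lemma plot_restrict:
  "diffeology X \<Longrightarrow> plot X n U p \<Longrightarrow> opn n V \<Longrightarrow> V \<subseteq> U \<Longrightarrow> plot X n V p"
  using plot_comp[of X n U p n V "\<lambda>x. x"] smooth_eucl_incl by simp

lemma diffeologyI:
  assumes "\<And>n U p. plot X n U p \<Longrightarrow> opn n U \<and> p \<in> U \<rightarrow> points X"
    "\<And>n U p q. plot X n U p \<Longrightarrow> (\<And>x. x \<in> U \<Longrightarrow> q x = p x) \<Longrightarrow> plot X n U q"
    "\<And>n U x. opn n U \<Longrightarrow> x \<in> points X \<Longrightarrow> plot X n U (\<lambda>_. x)"
    "\<And>n U p m V f. plot X n U p \<Longrightarrow> opn m V \<Longrightarrow> smooth_eucl m V n U f \<Longrightarrow> plot X m V (p \<circ> f)"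
    "\<And>n U p. opn n U \<Longrightarrow>
        (\<And>u. u \<in> U \<Longrightarrow> \<exists>V. opn n V \<and> u \<in> V \<and> V \<subseteq> U \<and> plot X n V p) \<Longrightarrow> plot X n U p"
  shows "diffeology X"
  unfolding diffeology_def
  apply (intro conjI)
  subgoal using assms(1) by blast
  subgoal by (intro allI impI; rule assms(2)) auto
  subgoal using assms(3) by blast
  subgoal by (intro allI impI; rule assms(4))
  subgoal by (intro allI impI; rule assms(5)) auto
  done

lemma diffeology_real: "diffeology real_diffeology"
proof (rule diffeologyI)
  show "plot real_diffeology n U p"
    if U: "opn n U" and *: "\<And>u. u \<in> U \<Longrightarrow> \<exists>V. opn n V \<and> u \<in> V \<and> V \<subseteq> U \<and> plot real_diffeology n V p" for n U p
  proof -
    have "Cs n U p"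
      by (rule Cs_local[OF U]) (use * in \<open>fastforce simp: real_diffeology_def\<close>)
    then show ?thesis using U by (simp add: real_diffeology_def)
  qed
next
  show "plot real_diffeology m V (p \<circ> f)"
    if "plot real_diffeology n U p" "opn m V" "smooth_eucl m V n U f" for n U p m V f
    using that Cs_compose[of n U m V f p] by (auto simp: real_diffeology_def comp_def)
next
  show "plot real_diffeology n U q"
    if "plot real_diffeology n U p" "\<And>x. x \<in> U \<Longrightarrow> q x = p x" for n U p q
    using that Cs_cong[of n U p q] by (simp add: real_diffeology_def)
qed (auto simp: real_diffeology_def Cs_const)

lemma diffeology_eucl:
  assumes U: "opn n U"
  shows "diffeology (eucl_diffeology n U)"
proof (rule diffeologyI)
  show "plot (eucl_diffeology n U) m V q"
    if "plot (eucl_diffeology n U) m V p" "\<And>x. x \<in> V \<Longrightarrow> q x = p x" for m V p q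
  proof -
    have "Cs m V (\<lambda>x. q x j)" if "j < n" for j
      by (rule Cs_cong[of m V "\<lambda>x. p x j"]) (use that \<open>plot (eucl_diffeology n U) m V p\<close> \<open>\<And>x. x \<in> V \<Longrightarrow> q x = p x\<close>
          in \<open>auto simp: eucl_diffeology_def smooth_eucl_def\<close>)
    then show ?thesis using that by (auto simp: eucl_diffeology_def smooth_eucl_def)
  qed
  show "plot (eucl_diffeology n U) m V p"
    if V: "opn m V" and *: "\<And>u. u \<in> V \<Longrightarrow> \<exists>V'. opn m V' \<and> u \<in> V' \<and> V' \<subseteq> V \<and> plot (eucl_diffeology n U) m V' p"
    for m V p
  proof -
    have "Cs m V (\<lambda>x. p x j)" if "j < n" for j
      by (rule Cs_local[OF V]) (use * that in \<open>fastforce simp: eucl_diffeology_def smooth_eucl_def\<close>)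
    moreover have "p \<in> V \<rightarrow> U" using * unfolding eucl_diffeology_def smooth_eucl_def by fastforce
    ultimately show ?thesis using V by (simp add: eucl_diffeology_def smooth_eucl_def)
  qed
  show "plot (eucl_diffeology n U) m V (p \<circ> f)"
    if "plot (eucl_diffeology n U) k T p" "opn m V" "smooth_eucl m V k T f" for k T p m V f
    using that smooth_eucl_comp[of m V k T f n U p] by (simp add: eucl_diffeology_def comp_def)
qed (auto simp: eucl_diffeology_def smooth_eucl_def Cs_const)

lemma diffeology_subset:
  assumes X: "diffeology X"
  shows "diffeology (subset_diffeology X A)"
proof (rule diffeologyI)
  show "plot (subset_diffeology X A) n U q"
    if "plot (subset_diffeology X A) n U p" "\<And>x. x \<in> U \<Longrightarrow> q x = p x" for n U p q
    using that plot_cong[OF X] by (fastforce simp: subset_diffeology_def)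
  show "plot (subset_diffeology X A) n U p"
    if "opn n U" "\<And>u. u \<in> U \<Longrightarrow> \<exists>V. opn n V \<and> u \<in> V \<and> V \<subseteq> U \<and> plot (subset_diffeology X A) n V p" for n U p
    using that plot_local[OF X] unfolding subset_diffeology_def by fastforce
  show "plot (subset_diffeology X A) m V (p \<circ> f)"
    if "plot (subset_diffeology X A) n U p" "opn m V" "smooth_eucl m V n U f" for n U p m V f
    using that plot_comp[OF X, of n U p m V f] by (fastforce simp: subset_diffeology_def comp_def smooth_eucl_def)
  show "opn n U \<and> p \<in> U \<rightarrow> points (subset_diffeology X A)"
    if "plot (subset_diffeology X A) n U p" for n U p
    using that plot_openD[OF X, of n U p] plot_intoD[OF X, of n U p] by (auto simp: subset_diffeology_def)
qed (use plot_const[OF X] in \<open>auto simp: subset_diffeology_def\<close>)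

lemma diffeology_prod:
  assumes X: "diffeology X" and Y: "diffeology Y"
  shows "diffeology (prod_diffeology X Y)"
proof (rule diffeologyI)
  show "opn n U \<and> p \<in> U \<rightarrow> points (prod_diffeology X Y)"
    if "plot (prod_diffeology X Y) n U p" for n U p
  proof -
    have p: "plot X n U (fst \<circ> p)" "plot Y n U (snd \<circ> p)" using that by (auto simp: prod_diffeology_def)
    then show ?thesis
      using plot_openD[OF X] plot_intoD[OF X p(1)] plot_intoD[OF Y p(2)]
      by (force simp: prod_diffeology_def Pi_iff mem_Times_iff)
  qed
  show "plot (prod_diffeology X Y) n U q"
    if "plot (prod_diffeology X Y) n U p" "\<And>x. x \<in> U \<Longrightarrow> q x = p x" for n U p q
    using that plot_cong[OF X, of n U "fst \<circ> p" "fst \<circ> q"] plot_cong[OF Y, of n U "snd \<circ> p" "snd \<circ> q"]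
    by (simp add: prod_diffeology_def)
  show "plot (prod_diffeology X Y) n U p"
    if U: "opn n U" and *: "\<And>u. u \<in> U \<Longrightarrow> \<exists>V. opn n V \<and> u \<in> V \<and> V \<subseteq> U \<and> plot (prod_diffeology X Y) n V p" for n U p
  proof -
    have "plot X n U (fst \<circ> p)" by (rule plot_local[OF X U]) (use * in \<open>fastforce simp: prod_diffeology_def\<close>)
    moreover have "plot Y n U (snd \<circ> p)" by (rule plot_local[OF Y U]) (use * in \<open>fastforce simp: prod_diffeology_def\<close>)
    ultimately show ?thesis by (simp add: prod_diffeology_def)
  qed
  show "plot (prod_diffeology X Y) m V (p \<circ> f)"
    if "plot (prod_diffeology X Y) n U p" "opn m V" "smooth_eucl m V n U f" for n U p m V f
    using that plot_comp[OF X, of n U "fst \<circ> p" m V f] plot_comp[OF Y, of n U "snd \<circ> p" m V f]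
    by (simp add: prod_diffeology_def comp_def)
qed (use plot_const[OF X] plot_const[OF Y] in \<open>auto simp: prod_diffeology_def comp_def\<close>)

section \<open>Smooth maps between diffeological spaces\<close>

lemma points_simps [simp]:
  "points (prod_diffeology X Y) = points X \<times> points Y"
  "points (subset_diffeology X A) = points X \<inter> A"
  "points (eucl_diffeology n U) = U"
  "points real_diffeology = UNIV"
  by (simp_all add: prod_diffeology_def subset_diffeology_def eucl_diffeology_def real_diffeology_def)

lemma plot_real: "plot real_diffeology n U p \<longleftrightarrow> opn n U \<and> Cs n U p"
  by (simp add: real_diffeology_def)

lemma plot_eucl: "plot (eucl_diffeology m V) n U p \<longleftrightarrow> opn n U \<and> smooth_eucl n U m V p"
  by (simp add: eucl_diffeology_def)

lemma plot_subset: "plot (subset_diffeology X A) n U p \<longleftrightarrow> plot X n U p \<and> p \<in> U \<rightarrow> A"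
  by (simp add: subset_diffeology_def)

lemma plot_prod: "plot (prod_diffeology X Y) n U p \<longleftrightarrow> plot X n U (\<lambda>x. fst (p x)) \<and> plot Y n U (\<lambda>x. snd (p x))"
  by (simp add: prod_diffeology_def comp_def)

lemma smooth_intoD: "smooth X Y f \<Longrightarrow> x \<in> points X \<Longrightarrow> f x \<in> points Y"
  by (auto simp: smooth_def)

lemma smooth_plotD: "smooth X Y f \<Longrightarrow> plot X n U p \<Longrightarrow> plot Y n U (\<lambda>x. f (p x))"
  by (auto simp: smooth_def comp_def)

lemma smoothI:
  "(\<And>x. x \<in> points X \<Longrightarrow> f x \<in> points Y) \<Longrightarrow>
   (\<And>n U p. plot X n U p \<Longrightarrow> plot Y n U (\<lambda>x. f (p x))) \<Longrightarrow> smooth X Y f"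
  by (auto simp: smooth_def comp_def)

lemma smooth_id: "smooth X X (\<lambda>x. x)"
  by (rule smoothI)

lemma smooth_compose: "smooth Y Z g \<Longrightarrow> smooth X Y f \<Longrightarrow> smooth X Z (\<lambda>x. g (f x))"
  by (auto simp: smooth_def comp_def)

lemma smooth_const: "diffeology X \<Longrightarrow> diffeology Y \<Longrightarrow> y \<in> points Y \<Longrightarrow> smooth X Y (\<lambda>_. y)"
  by (auto intro!: smoothI plot_const dest: plot_openD)

lemma smooth_cong:
  assumes "diffeology X" "diffeology Y" "smooth X Y f" "\<And>x. x \<in> points X \<Longrightarrow> g x = f x"
  shows "smooth X Y g"
proof (rule smoothI)
  show "plot Y n U (\<lambda>x. g (p x))" if "plot X n U p" for n U p
    by (rule plot_cong[OF assms(2) smooth_plotD[OF assms(3) that]]) (use plot_intoD[OF assms(1) that] assms(4) in auto)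
qed (use assms smooth_intoD in fastforce)

lemma smooth_fst: "smooth (prod_diffeology X Y) X fst"
  and smooth_snd: "smooth (prod_diffeology X Y) Y snd"
  by (auto intro!: smoothI simp: plot_prod)

lemma smooth_Pair: "smooth X Y f \<Longrightarrow> smooth X Z g \<Longrightarrow> smooth X (prod_diffeology Y Z) (\<lambda>x. (f x, g x))"
  by (auto intro!: smoothI simp: plot_prod smooth_intoD smooth_plotD)

lemma smooth_compose2:
  "smooth (prod_diffeology Y Z) T (\<lambda>(y, z). h y z) \<Longrightarrow> smooth X Y f \<Longrightarrow> smooth X Z g \<Longrightarrow>
   smooth X T (\<lambda>x. h (f x) (g x))"
  using smooth_compose[OF _ smooth_Pair, of Y Z T "\<lambda>(y, z). h y z" X f g] by simp

lemma smooth_into_subset: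
  assumes "diffeology X" "smooth X Y f" "\<And>x. x \<in> points X \<Longrightarrow> f x \<in> A"
  shows "smooth X (subset_diffeology Y A) f"
proof (rule smoothI)
  show "plot (subset_diffeology Y A) n U (\<lambda>x. f (p x))" if p: "plot X n U p" for n U p
    using smooth_plotD[OF assms(2) p] plot_intoD[OF assms(1) p] assms(3) by (auto simp: plot_subset)
qed (use assms smooth_intoD in auto)

lemma smooth_from_subset: "smooth X Y f \<Longrightarrow> smooth (subset_diffeology X A) Y f"
  by (rule smoothI) (auto simp: plot_subset intro: smooth_intoD smooth_plotD)

lemma smooth_subset_D: "smooth X (subset_diffeology Y A) f \<Longrightarrow> smooth X Y f"
  by (rule smoothI) (auto dest: smooth_intoD smooth_plotD simp: plot_subset)

lemma smooth_subset_mono: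
  assumes f: "smooth (subset_diffeology X A) Y f" and "B \<subseteq> A"
  shows "smooth (subset_diffeology X B) Y f"
proof (rule smoothI)
  show "f x \<in> points Y" if "x \<in> points (subset_diffeology X B)" for x
    using smooth_intoD[OF f, of x] that assms(2) by auto
  show "plot Y n U (\<lambda>x. f (p x))" if "plot (subset_diffeology X B) n U p" for n U p
    using smooth_plotD[OF f, of n U p] that assms(2) by (auto simp: plot_subset)
qed

text \<open>With plots seen as smooth maps on their domains, the closure rules for smooth maps
  (pairs, composites, sums) apply to plots as well.\<close>

lemma plot_iff_smooth:
  assumes "diffeology X"
  shows "plot X n U p \<longleftrightarrow> opn n U \<and> smooth (eucl_diffeology n U) X p"
proof
  assume *: "opn n U \<and> smooth (eucl_diffeology n U) X p"
  then have "plot (eucl_diffeology n U) n U (\<lambda>x. x)" using smooth_eucl_incl[of n U U] by (simp add: plot_eucl)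
  then show "plot X n U p" using * smooth_plotD by blast
next
  assume p: "plot X n U p"
  have "smooth (eucl_diffeology n U) X p"
  proof (rule smoothI)
    show "plot X m V (\<lambda>x. p (q x))" if "plot (eucl_diffeology n U) m V q" for m V q
      using plot_comp[OF assms p, of m V q] that by (simp add: plot_eucl)
  qed (use plot_intoD[OF assms p] in auto)
  then show "opn n U \<and> smooth (eucl_diffeology n U) X p" using plot_openD[OF assms p] by blast
qed

lemma smooth_into_eucl:
  assumes "diffeology X" "\<And>x. x \<in> points X \<Longrightarrow> f x \<in> U"
    "\<And>j. j < n \<Longrightarrow> smooth X real_diffeology (\<lambda>x. f x j)"
  shows "smooth X (eucl_diffeology n U) f"
proof (rule smoothI)
  fix m V p assume p: "plot X m V p"
  show "plot (eucl_diffeology n U) m V (\<lambda>x. f (p x))"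
    using plot_openD[OF assms(1) p] plot_intoD[OF assms(1) p] assms(2) smooth_plotD[OF assms(3) p]
    by (auto simp: plot_eucl plot_real smooth_eucl_def)
qed (simp add: assms)

lemma smooth_coord:
  assumes "opn n U" shows "smooth (eucl_diffeology n U) real_diffeology (\<lambda>x. x j)"
  using plot_iff_smooth[OF diffeology_real] Cs_coord[OF assms] assms by (auto simp: plot_real)

lemma smooth_add:
  assumes "smooth X real_diffeology f" "smooth X real_diffeology g"
  shows "smooth X real_diffeology (\<lambda>x. f x + g x)"
  by (rule smoothI) (use Cs_add smooth_plotD[OF assms(1)] smooth_plotD[OF assms(2)] in \<open>auto simp: plot_real\<close>)

lemma smooth_mult:
  assumes "smooth X real_diffeology f" "smooth X real_diffeology g"
  shows "smooth X real_diffeology (\<lambda>x. f x * g x)"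
  by (rule smoothI) (use Cs_mult smooth_plotD[OF assms(1)] smooth_plotD[OF assms(2)] in \<open>auto simp: plot_real\<close>)

lemma smooth_real_const: "diffeology X \<Longrightarrow> smooth X real_diffeology (\<lambda>_. c)"
  by (intro smooth_const diffeology_real) auto

lemma smooth_diff:
  assumes "diffeology X" "smooth X real_diffeology f" "smooth X real_diffeology g"
  shows "smooth X real_diffeology (\<lambda>x. f x - g x)"
  using smooth_add[OF assms(2) smooth_mult[OF smooth_real_const[OF assms(1), of "-1"] assms(3)]] by simp

lemma smooth_incl: "smooth (subset_diffeology X A) X (\<lambda>x. x)"
  by (rule smooth_from_subset[OF smooth_id])

subsection \<open>The D-topology\<close>

lemma openin_D_preimage:
  assumes "diffeology X" "diffeology Y" "smooth X Y f" "openin (D_topology Y) B"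
  shows "openin (D_topology X) {x \<in> points X. f x \<in> B}"
proof -
  have "opn n {u \<in> U. p u \<in> {x \<in> points X. f x \<in> B}}" if p: "plot X n U p" for n U p
  proof -
    have "{u \<in> U. p u \<in> {x \<in> points X. f x \<in> B}} = {u \<in> U. f (p u) \<in> B}"
      using plot_intoD[OF assms(1) p] by auto
    then show ?thesis
      using assms(4) smooth_plotD[OF assms(3) p] by (auto simp: openin_D_topology[OF assms(2)])
  qed
  then show ?thesis by (auto simp: openin_D_topology[OF assms(1)])
qed

lemma openin_D_plot: "diffeology X \<Longrightarrow> openin (D_topology X) A \<Longrightarrow> plot X n U p \<Longrightarrow> opn n {u \<in> U. p u \<in> A}"
  by (simp add: openin_D_topology)

lemma openin_D_real: "open S \<Longrightarrow> openin (D_topology real_diffeology) S"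
proof (subst openin_D_topology[OF diffeology_real], intro conjI allI impI)
  fix n U p assume S: "open S" and "plot real_diffeology n U p"
  then have p: "opn n U" "continuous_on U p" using Cs_continuous_on by (auto simp: plot_real)
  have "openin (top_of_set U) (U \<inter> p -` S)"
    using p(2) S continuous_openin_preimage_gen by blast
  moreover have "U \<inter> p -` S = {u \<in> U. p u \<in> S}" by blast
  ultimately show "opn n {u \<in> U. p u \<in> S}" using p(1) openin_trans unfolding opn_openin by metis
qed auto

lemma openin_D_subset:
  assumes "diffeology X" "openin (D_topology X) A"
  shows "openin (D_topology (subset_diffeology X B)) (A \<inter> B)"
proof -
  have "{x \<in> points (subset_diffeology X B). x \<in> A} = A \<inter> B"
    using openin_subset[OF assms(2)] topspace_D_topology[OF assms(1)] by auto
  then show ?thesis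
    using openin_D_preimage[OF diffeology_subset assms(1) smooth_incl assms(2)] assms(1) by metis
qed

text \<open>The preimage of a D-open set under a plot is open, so smoothness near every point
  reduces to the locality axiom for the plots of \<open>Y\<close>.\<close>

lemma smooth_local:
  assumes X: "diffeology X" and Y: "diffeology Y"
    and *: "\<And>x. x \<in> points X \<Longrightarrow>
      \<exists>N. openin (D_topology X) N \<and> x \<in> N \<and> smooth (subset_diffeology X N) Y f"
  shows "smooth X Y f"
proof (rule smoothI)
  show "f x \<in> points Y" if "x \<in> points X" for x
    using *[OF that] that smooth_intoD by fastforce
  show "plot Y n U (\<lambda>x. f (p x))" if p: "plot X n U p" for n U p
  proof (rule plot_local[OF Y plot_openD[OF X p]])
    fix u assume u: "u \<in> U"
    then obtain N where N: "openin (D_topology X) N" "p u \<in> N" "smooth (subset_diffeology X N) Y f"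
      using * plot_intoD[OF X p] by blast
    let ?V = "{u \<in> U. p u \<in> N}"
    have V: "opn n ?V" by (rule openin_D_plot[OF X N(1) p])
    have "plot X n ?V p" by (rule plot_restrict[OF X p V]) auto
    then have "plot (subset_diffeology X N) n ?V p" by (auto simp: plot_subset)
    then have "plot Y n ?V (\<lambda>x. f (p x))" by (rule smooth_plotD[OF N(3)])
    then show "\<exists>V. opn n V \<and> u \<in> V \<and> V \<subseteq> U \<and> plot Y n V (\<lambda>x. f (p x))"
      using V u N(2) by blast
  qed
qed

subsection \<open>Curves\<close>

text \<open>Curves take real arguments whereas one-dimensional plots take vectors;
  \<open>line_set\<close> and \<open>coord_vec\<close> translate between the two.\<close>

definition line_set :: "real set \<Rightarrow> vec set" where "line_set S = {w \<in> Rn 1. w 0 \<in> S}"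
definition coord_vec :: "real \<Rightarrow> vec" where "coord_vec r = zero_vec(0 := r)"

lemma coord_vec_0 [simp]: "coord_vec r 0 = r" by (simp add: coord_vec_def)

lemma coord_vec_Rn: "coord_vec r \<in> Rn 1" by (auto simp: coord_vec_def Rn_iff)

lemma coord_vec_line_set [simp]: "coord_vec r \<in> line_set S \<longleftrightarrow> r \<in> S" by (auto simp: line_set_def coord_vec_def Rn_iff)

lemma coord_vec_zero [simp]: "coord_vec 0 = zero_vec" by (auto simp: coord_vec_def)

lemma opn_Rn: "opn n (Rn n)" by simp

lemma opn_coord_preimage:
  assumes "opn n U" "open S" "Cs n U f"
  shows "opn n {w \<in> U. f w \<in> S}"
proof -
  have "plot real_diffeology n U f" using assms by (auto simp: plot_real)
  then show ?thesis using openin_D_plot[OF diffeology_real openin_D_real[OF assms(2)]] by blast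
qed

lemma opn_line_set: "open S \<Longrightarrow> opn 1 (line_set S)"
  unfolding line_set_def by (rule opn_coord_preimage[OF opn_Rn _ Cs_coord[OF opn_Rn]])

lemma diffeology_interval: "diffeology (interval_diffeology S)"
  by (rule diffeology_subset[OF diffeology_real])

lemma plot_interval: "plot (interval_diffeology S) n U p \<longleftrightarrow> opn n U \<and> Cs n U p \<and> p \<in> U \<rightarrow> S"
  by (auto simp: plot_subset plot_real)

text \<open>The coordinate \<open>w 0\<close> identifies \<open>line_set S\<close> with
  \<open>S\<close>; openness of \<open>S\<close> makes \<open>line_set S\<close> a plot
  domain.\<close>

lemma smooth_curve_iff:
  assumes X: "diffeology X" and S: "open S"
  shows "smooth (interval_diffeology S) X c \<longleftrightarrow> plot X 1 (line_set S) (\<lambda>w. c (w 0))"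
proof
  assume c: "smooth (interval_diffeology S) X c"
  have "plot (interval_diffeology S) 1 (line_set S) (\<lambda>w. w 0)"
    using opn_line_set[OF S] Cs_coord by (auto simp: plot_interval line_set_def)
  then show "plot X 1 (line_set S) (\<lambda>w. c (w 0))" by (rule smooth_plotD[OF c])
next
  assume c: "plot X 1 (line_set S) (\<lambda>w. c (w 0))"
  show "smooth (interval_diffeology S) X c"
  proof (rule smoothI)
    show "c x \<in> points X" if "x \<in> points (interval_diffeology S)" for x
      using plot_intoD[OF X c] that coord_vec_line_set[of x S] coord_vec_0[of x] by (metis IntD2 PiE points_simps(2))
    show "plot X n U (\<lambda>x. c (p x))" if p: "plot (interval_diffeology S) n U p" for n U p
    proof -
      have "smooth_eucl n U 1 (line_set S) (\<lambda>x. coord_vec (p x))"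
        using p by (auto simp: plot_interval smooth_eucl_def)
      from plot_comp[OF X c _ this] p show ?thesis by (simp add: plot_interval)
    qed
  qed
qed

lemma open_curve_preimage:
  assumes X: "diffeology X" and I: "open I" and c: "smooth (interval_diffeology I) X c"
    and A: "openin (D_topology X) A"
  shows "open {t \<in> I. c t \<in> A}"
proof -
  have "plot X 1 (line_set I) (\<lambda>w. c (w 0))" using c smooth_curve_iff[OF X I] by blast
  from openin_D_plot[OF X A this] obtain T where T: "open T" "{w \<in> line_set I. c (w 0) \<in> A} = Rn 1 \<inter> T"
    by (auto simp: opn_openin openin_open)
  have "t \<in> I \<and> c t \<in> A \<longleftrightarrow> coord_vec t \<in> T" for t
  proof -
    have "coord_vec t \<in> {w \<in> line_set I. c (w 0) \<in> A} \<longleftrightarrow> coord_vec t \<in> Rn 1 \<inter> T" using T(2) by simp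
    then show ?thesis using coord_vec_Rn[of t] by simp
  qed
  then have "{t \<in> I. c t \<in> A} = coord_vec -` T" by auto
  moreover have "continuous_on UNIV coord_vec"
  proof (rule continuous_on_coordinatewise_then_product)
    show "continuous_on UNIV (\<lambda>x. coord_vec x i)" for i
      by (cases "i = 0") (auto simp: coord_vec_def intro: continuous_intros)
  qed
  ultimately show ?thesis using T(1) by (simp add: open_vimage)
qed

lemma smooth_real_curve:
  assumes S: "open S" and f: "smooth (interval_diffeology S) real_diffeology f" and t: "t \<in> S"
  shows "(f has_real_derivative deriv f t) (at t)"
proof -
  have "plot real_diffeology 1 (line_set S) (\<lambda>w. f (w 0))"
    using f smooth_curve_iff[OF diffeology_real S] by blast
  then have "Cs 1 (line_set S) (\<lambda>w. f (w 0))" by (simp add: plot_real)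
  then have "Ck (Suc 0) 1 (line_set S) (\<lambda>w. f (w 0))" unfolding Cs_iff by blast
  then obtain g where "\<forall>x\<in>line_set S. ((\<lambda>s. f ((x(0 := s)) 0)) has_real_derivative g x) (at (x 0))"
    unfolding C_diff_real_Suc by blast
  then have "(f has_real_derivative g (coord_vec t)) (at t)" using t by (force dest: bspec[of _ _ "coord_vec t"])
  then show ?thesis using DERIV_imp_deriv by metis
qed

lemma smooth_affine: "smooth (interval_diffeology S) real_diffeology (\<lambda>s. a + s * b)"
  by (intro smooth_add smooth_mult smooth_real_const diffeology_interval smooth_incl)

lemma smooth_curve_local:
  assumes X: "diffeology X" and S: "open S"
    and *: "\<And>t. t \<in> S \<Longrightarrow> \<exists>T. open T \<and> t \<in> T \<and> smooth (interval_diffeology T) X c"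
  shows "smooth (interval_diffeology S) X c"
proof (rule smooth_local[OF diffeology_interval X])
  fix t assume "t \<in> points (interval_diffeology S)"
  then obtain T where T: "open T" "t \<in> T" "t \<in> S" "smooth (interval_diffeology T) X c" using * by auto
  have "openin (D_topology (interval_diffeology S)) (T \<inter> S)"
    by (rule openin_D_subset[OF diffeology_real openin_D_real[OF T(1)]])
  moreover have "smooth (subset_diffeology (interval_diffeology S) (T \<inter> S)) X c"
  proof -
    have "subset_diffeology (interval_diffeology S) (T \<inter> S) = interval_diffeology (T \<inter> S)"
      by (auto simp: subset_diffeology_def fun_eq_iff)
    then show ?thesis using smooth_subset_mono[OF T(4)] by simp
  qed
  ultimately show "\<exists>N. openin (D_topology (interval_diffeology S)) N \<and> t \<in> N \<and>
      smooth (subset_diffeology (interval_diffeology S) N) X c" using T by blast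
qed

section \<open>Internal tangent vectors\<close>

text \<open>Equality in the colimit, stated for representatives. Calculations in tangent spaces are
  carried out on formal vectors modulo this relation, and \<open>tvec_cong\<close> and
  \<open>tvec_eq_iff\<close> translate to and from cosets.\<close>

definition tangent_eq :: "'a diffeological_space \<Rightarrow> 'a \<Rightarrow> 'a formal_vec \<Rightarrow> 'a formal_vec \<Rightarrow> bool" where
  "tangent_eq X x a b \<longleftrightarrow> (\<lambda>P i. a P i - b P i) \<in> tangent_relations X x"

lemma tangent_eq_refl: "tangent_eq X x a a"
  using tangent_relations.zero by (simp add: tangent_eq_def)

lemma tangent_eq_sym: "tangent_eq X x a b \<Longrightarrow> tangent_eq X x b a"
  unfolding tangent_eq_def by (drule tangent_relations.scale[where r = "-1"]) (simp add: algebra_simps)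

lemma tangent_eq_trans [trans]: "tangent_eq X x a b \<Longrightarrow> tangent_eq X x b c \<Longrightarrow> tangent_eq X x a c"
  unfolding tangent_eq_def by (drule (1) tangent_relations.add) (simp add: algebra_simps)

lemma tangent_eq_add:
  "tangent_eq X x a a' \<Longrightarrow> tangent_eq X x b b' \<Longrightarrow> tangent_eq X x (\<lambda>P i. a P i + b P i) (\<lambda>P i. a' P i + b' P i)"
  unfolding tangent_eq_def by (drule (1) tangent_relations.add) (simp add: algebra_simps)

lemma tangent_eq_scale: "tangent_eq X x a b \<Longrightarrow> tangent_eq X x (\<lambda>P i. r * a P i) (\<lambda>P i. r * b P i)"
  unfolding tangent_eq_def by (drule tangent_relations.scale[where r = r]) (simp add: algebra_simps)

lemma tangent_eq_sum:
  "(\<And>j. j \<in> A \<Longrightarrow> tangent_eq X x (a j) (b j)) \<Longrightarrow>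
   tangent_eq X x (\<lambda>P i. \<Sum>j\<in>A. r j * a j P i) (\<lambda>P i. \<Sum>j\<in>A. r j * b j P i)"
proof (induction A rule: infinite_finite_induct)
  case (insert j A)
  then have "tangent_eq X x (\<lambda>P i. r j * a j P i + (\<Sum>j\<in>A. r j * a j P i)) (\<lambda>P i. r j * b j P i + (\<Sum>j\<in>A. r j * b j P i))"
    by (intro tangent_eq_add tangent_eq_scale) auto
  then show ?case using insert(1,2) by simp
qed (simp_all add: tangent_eq_refl)

lemma formal_vecs_zero: "(\<lambda>P i. 0) \<in> formal_vecs X x"
  by (simp add: formal_vecs_def)

lemma formal_vecs_finite: "a \<in> formal_vecs X x \<Longrightarrow> finite {P. a P \<noteq> zero_vec}"
  by (simp add: formal_vecs_def)

lemma formal_vecs_pointed: "a \<in> formal_vecs X x \<Longrightarrow> a P \<noteq> zero_vec \<Longrightarrow> pointed_plot X x P"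
  unfolding formal_vecs_def mem_Collect_eq by blast

lemma formal_vecs_Rn:
  assumes "a \<in> formal_vecs X x"
  shows "a P \<in> Rn (fst P)"
proof (cases "a P = zero_vec")
  case False
  then show ?thesis using assms unfolding formal_vecs_def mem_Collect_eq by blast
qed (simp add: Rn_iff)

lemma formal_vecsI:
  assumes "finite {P. a P \<noteq> zero_vec}" "\<And>P. a P \<noteq> zero_vec \<Longrightarrow> pointed_plot X x P"
    "\<And>P. a P \<in> Rn (fst P)"
  shows "a \<in> formal_vecs X x"
  unfolding formal_vecs_def mem_Collect_eq using assms(1)
  by (intro conjI allI impI assms(2,3))

lemma formal_vecs_add:
  assumes "a \<in> formal_vecs X x" "b \<in> formal_vecs X x"
  shows "(\<lambda>P i. a P i + b P i) \<in> formal_vecs X x"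
proof (rule formal_vecsI)
  have *: "a P \<noteq> zero_vec \<or> b P \<noteq> zero_vec" if "(\<lambda>i. a P i + b P i) \<noteq> zero_vec" for P
    using that by (auto simp: fun_eq_iff)
  then have "{P. (\<lambda>i. a P i + b P i) \<noteq> zero_vec} \<subseteq> {P. a P \<noteq> zero_vec} \<union> {P. b P \<noteq> zero_vec}" by blast
  then show "finite {P. (\<lambda>i. a P i + b P i) \<noteq> zero_vec}"
    using formal_vecs_finite[OF assms(1)] formal_vecs_finite[OF assms(2)] finite_subset by blast
  show "pointed_plot X x P" if "(\<lambda>i. a P i + b P i) \<noteq> zero_vec" for P
    using *[OF that] formal_vecs_pointed[OF assms(1)] formal_vecs_pointed[OF assms(2)] by metis
  show "(\<lambda>i. a P i + b P i) \<in> Rn (fst P)" for P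
    using formal_vecs_Rn[OF assms(1), of P] formal_vecs_Rn[OF assms(2), of P] by (simp add: Rn_iff)
qed

lemma formal_vecs_scale:
  assumes "a \<in> formal_vecs X x"
  shows "(\<lambda>P i. r * a P i) \<in> formal_vecs X x"
proof (rule formal_vecsI)
  have *: "a P \<noteq> zero_vec" if "(\<lambda>i. r * a P i) \<noteq> zero_vec" for P
    using that by (auto simp: fun_eq_iff)
  then have "{P. (\<lambda>i. r * a P i) \<noteq> zero_vec} \<subseteq> {P. a P \<noteq> zero_vec}" by blast
  then show "finite {P. (\<lambda>i. r * a P i) \<noteq> zero_vec}"
    using formal_vecs_finite[OF assms] finite_subset by blast
  show "pointed_plot X x P" if "(\<lambda>i. r * a P i) \<noteq> zero_vec" for P
    by (rule formal_vecs_pointed[OF assms *[OF that]])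
  show "(\<lambda>i. r * a P i) \<in> Rn (fst P)" for P
    using formal_vecs_Rn[OF assms(1), of P] by (simp add: Rn_iff)
qed

lemma formal_vecs_diff:
  assumes "a \<in> formal_vecs X x" "b \<in> formal_vecs X x"
  shows "(\<lambda>P i. a P i - b P i) \<in> formal_vecs X x"
  using formal_vecs_add[OF assms(1) formal_vecs_scale[OF assms(2), of "-1"]] by simp

lemma formal_vecs_sum:
  "(\<And>j. j \<in> A \<Longrightarrow> a j \<in> formal_vecs X x) \<Longrightarrow> (\<lambda>P i. \<Sum>j\<in>A. r j * a j P i) \<in> formal_vecs X x"
proof (induction A rule: infinite_finite_induct)
  case (insert j A)
  then have "(\<lambda>P i. r j * a j P i + (\<Sum>j\<in>A. r j * a j P i)) \<in> formal_vecs X x"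
    by (intro formal_vecs_add formal_vecs_scale) auto
  then show ?case using insert(1,2) by simp
qed (simp_all add: formal_vecs_zero)

lemma formal_vecs_single:
  assumes "pointed_plot X x P" "v \<in> Rn (fst P)"
  shows "single P v \<in> formal_vecs X x"
proof (rule formal_vecsI)
  have "{Q. single P v Q \<noteq> zero_vec} \<subseteq> {P}" by (auto simp: single_def)
  then show "finite {Q. single P v Q \<noteq> zero_vec}" using finite_subset by blast
qed (use assms in \<open>auto simp: single_def Rn_iff split: if_splits\<close>)

lemma single_add: "single P (\<lambda>i. v i + w i) = (\<lambda>Q i. single P v Q i + single P w Q i)"
  by (auto simp: single_def fun_eq_iff)

lemma single_scale: "single P (\<lambda>i. r * v i) = (\<lambda>Q i. r * single P v Q i)"
  by (auto simp: single_def fun_eq_iff)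

lemma opn_zero_nhd_deriv:
  assumes "opn n U" "zero_vec \<in> U" "i < n"
  shows "eventually (\<lambda>t. zero_vec(i := t) \<in> U) (nhds 0)"
  using opn_upd_eventually[OF assms] by simp

text \<open>From index \<open>m\<close> on the components of \<open>f\<close> vanish near the
  origin, so the Jacobian has zero rows there.\<close>

lemma diff0_Rn:
  assumes "opn n U" "zero_vec \<in> U" "V \<subseteq> Rn m" "f \<in> U \<rightarrow> V"
  shows "diff0 n f v \<in> Rn m"
  unfolding Rn_iff diff0_def
proof (intro allI impI sum.neutral ballI)
  fix j i assume j: "m \<le> j" and i: "i \<in> {..<n}"
  have "eventually (\<lambda>t. f (zero_vec(i := t)) j = 0) (nhds 0)"
    using opn_zero_nhd_deriv[OF assms(1,2), of i] i
    by (auto elim!: eventually_mono) (use assms(3,4) j in \<open>auto simp: Rn_iff\<close>)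
  then have "deriv (\<lambda>t. f (zero_vec(i := t)) j) 0 = deriv (\<lambda>t. 0) 0"
    by (rule deriv_cong_ev) simp
  then show "deriv (\<lambda>t. f (zero_vec(i := t)) j) 0 * v i = 0" by simp
qed

lemma pointed_plotD:
  assumes "diffeology X" "pointed_plot X x (n, U, p)"
  shows "plot X n U p" "opn n U" "zero_vec \<in> U" "p zero_vec = x"
  using assms plot_openD[OF assms(1)] by (auto simp: pointed_plot_def)

lemma relations_formal_vecs:
  assumes X: "diffeology X" and "a \<in> tangent_relations X x"
  shows "a \<in> formal_vecs X x"
  using assms(2)
proof induction
  case (arrow P Q f v)
  obtain n U p where P: "P = (n, U, p)" by (cases P)
  obtain m V q where Q: "Q = (m, V, q)" by (cases Q)
  have "diff0 n f v \<in> Rn m"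
    using arrow(3) pointed_plotD[OF X arrow(1)[unfolded P]]
      opn_subset[OF pointed_plotD(2)[OF X arrow(2)[unfolded Q]]]
    by (intro diff0_Rn[of n U V]) (auto simp: plot_arrow_def P Q smooth_eucl_def)
  then show ?case using arrow P Q by (intro formal_vecs_diff formal_vecs_single) auto
qed (auto intro: formal_vecs_zero formal_vecs_add formal_vecs_scale)

lemma class_memD: "b \<in> tangent_class X x a \<Longrightarrow> b \<in> formal_vecs X x \<and> tangent_eq X x b a"
  by (simp add: tangent_class_def tangent_eq_def)

lemma class_self: "a \<in> formal_vecs X x \<Longrightarrow> a \<in> tangent_class X x a"
  using tangent_eq_refl[of X x a] by (simp add: tangent_class_def tangent_eq_def)

lemma class_cong: "tangent_eq X x a b \<Longrightarrow> tangent_class X x a = tangent_class X x b"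
  unfolding tangent_class_def tangent_eq_def[symmetric] by (intro Collect_cong conj_cong refl) (meson tangent_eq_trans tangent_eq_sym)

lemma class_eq_iff:
  "a \<in> formal_vecs X x \<Longrightarrow> tangent_class X x a = tangent_class X x b \<longleftrightarrow> tangent_eq X x a b"
  using class_cong class_self class_memD by metis

definition tvec :: "'a diffeological_space \<Rightarrow> 'a \<Rightarrow> 'a formal_vec \<Rightarrow> 'a tangent" where
  "tvec X x a = (x, tangent_class X x a)"

lemma tvec_cong: "tangent_eq X x a b \<Longrightarrow> tvec X x a = tvec X x b"
  by (simp add: tvec_def class_cong)

lemma tvec_eq_iff: "a \<in> formal_vecs X x \<Longrightarrow> tvec X x a = tvec X x b \<longleftrightarrow> tangent_eq X x a b"
  by (simp add: tvec_def class_eq_iff)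

lemma tvec_tangent_space: "a \<in> formal_vecs X x \<Longrightarrow> tvec X x a \<in> tangent_space X x"
  by (auto simp: tvec_def tangent_space_def)

text \<open>The coset operations are unions over representatives. The coset is nonempty and all its
  members contribute the same set, so the union collapses.\<close>

lemma UN_class:
  assumes "a \<in> formal_vecs X x" "\<And>b. b \<in> tangent_class X x a \<Longrightarrow> F b = C"
  shows "(\<Union>b\<in>tangent_class X x a. F b) = C"
  using class_self[OF assms(1)] assms(2) by blast

lemma tangent_add_tvec:
  assumes "a \<in> formal_vecs X x" "b \<in> formal_vecs X x"
  shows "tangent_add X (tvec X x a) (tvec X x b) = tvec X x (\<lambda>P i. a P i + b P i)"
  unfolding tangent_add_def tvec_def using assms
  by (auto intro!: UN_class[OF assms(1)] UN_class[OF assms(2)] class_cong tangent_eq_add dest: class_memD)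

lemma tangent_scale_tvec:
  assumes "a \<in> formal_vecs X x"
  shows "tangent_scale X r (tvec X x a) = tvec X x (\<lambda>P i. r * a P i)"
  unfolding tangent_scale_def tvec_def
  by (auto intro!: UN_class[OF assms] class_cong tangent_eq_scale dest: class_memD)

subsection \<open>Push-forward\<close>

definition push_plot :: "('a \<Rightarrow> 'b) \<Rightarrow> 'a plot_data \<Rightarrow> 'b plot_data" where
  "push_plot f = (\<lambda>(n, U, p). (n, U, f \<circ> p))"

text \<open>\<open>push_formal\<close> sums over the support of \<open>a\<close>, which changes
  under addition. A finite superset of the supports gives a common index set for several formal
  vectors.\<close>

lemma push_formal_alt:
  assumes "finite S" "{P. a P \<noteq> zero_vec} \<subseteq> S"
  shows "push_formal f a Q i = (\<Sum>P\<in>S. if push_plot f P = Q then a P i else 0)"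
proof -
  obtain n U q where Q: "Q = (n, U, q)" by (cases Q)
  have "push_formal f a Q i = (\<Sum>P | a P \<noteq> zero_vec \<and> push_plot f P = Q. a P i)"
    unfolding push_formal_def Q by (auto intro!: sum.cong simp: push_plot_def split: prod.splits)
  also have "\<dots> = (\<Sum>P\<in>{P\<in>S. push_plot f P = Q}. a P i)"
    by (rule sum.mono_neutral_left) (use assms in auto)
  also have "\<dots> = (\<Sum>P\<in>S. if push_plot f P = Q then a P i else 0)"
    using assms(1) by (simp add: sum.inter_filter)
  finally show ?thesis .
qed

lemma push_add:
  assumes "a \<in> formal_vecs X x" "b \<in> formal_vecs X x"
  shows "push_formal f (\<lambda>P i. a P i + b P i) = (\<lambda>P i. push_formal f a P i + push_formal f b P i)"
proof (intro ext)
  fix Q i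
  let ?S = "{P. a P \<noteq> zero_vec} \<union> {P. b P \<noteq> zero_vec}"
  have S: "finite ?S" using formal_vecs_finite[OF assms(1)] formal_vecs_finite[OF assms(2)] by simp
  have "{P. (\<lambda>i. a P i + b P i) \<noteq> zero_vec} \<subseteq> ?S" by (auto simp: fun_eq_iff)
  then show "push_formal f (\<lambda>P i. a P i + b P i) Q i = push_formal f a Q i + push_formal f b Q i"
    by (subst (1 2 3) push_formal_alt[OF S]) (auto simp: sum.distrib[symmetric] intro!: sum.cong)
qed

lemma push_scale:
  assumes "a \<in> formal_vecs X x"
  shows "push_formal f (\<lambda>P i. r * a P i) = (\<lambda>P i. r * push_formal f a P i)"
proof (intro ext)
  fix Q i
  let ?S = "{P. a P \<noteq> zero_vec}"
  have S: "finite ?S" by (rule formal_vecs_finite[OF assms])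
  have "{P. (\<lambda>i. r * a P i) \<noteq> zero_vec} \<subseteq> ?S" by (auto simp: fun_eq_iff)
  then show "push_formal f (\<lambda>P i. r * a P i) Q i = r * push_formal f a Q i"
    by (subst (1 2) push_formal_alt[OF S]) (auto simp: sum_distrib_left intro!: sum.cong)
qed

lemma push_zero: "push_formal f (\<lambda>P i. 0) = (\<lambda>P i. 0)"
  by (auto simp: push_formal_def fun_eq_iff)

lemma push_sum:
  "(\<And>j. j \<in> A \<Longrightarrow> a j \<in> formal_vecs X x) \<Longrightarrow>
   push_formal f (\<lambda>P i. \<Sum>j\<in>A. r j * a j P i) = (\<lambda>P i. \<Sum>j\<in>A. r j * push_formal f (a j) P i)"
proof (induction A rule: infinite_finite_induct)
  case (insert j A)
  then have *: "(\<lambda>P i. r j * a j P i) \<in> formal_vecs X x" "(\<lambda>P i. \<Sum>j\<in>A. r j * a j P i) \<in> formal_vecs X x"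
    by (auto intro: formal_vecs_scale formal_vecs_sum)
  show ?case using insert(1-4) push_add[OF *, of f] push_scale[of "a j" X x f "r j"] by simp
qed (simp_all add: push_zero)

lemma push_single: "push_formal f (single P v) = single (push_plot f P) v"
proof (intro ext)
  fix Q i
  have "{Q. single P v Q \<noteq> zero_vec} \<subseteq> {P}" by (auto simp: single_def)
  then show "push_formal f (single P v) Q i = single (push_plot f P) v Q i"
    by (subst push_formal_alt[of "{P}"]) (auto simp: single_def)
qed

lemma fst_push_plot [simp]: "fst (push_plot f P) = fst P"
  by (simp add: push_plot_def split: prod.splits)

lemma pointed_push: "smooth X Y f \<Longrightarrow> pointed_plot X x P \<Longrightarrow> pointed_plot Y (f x) (push_plot f P)"
  by (auto simp: pointed_plot_def push_plot_def smooth_def)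

text \<open>An arrow between two plots is, with the same underlying map, an arrow between their
  composites with \<open>f\<close>. So generating relations go to generating relations, and
  linearity of \<open>push_formal\<close> does the rest.\<close>

lemma push_relations:
  assumes X: "diffeology X" and f: "smooth X Y f" and "a \<in> tangent_relations X x"
  shows "push_formal f a \<in> tangent_relations Y (f x)"
  using assms(3)
proof induction
  case zero
  then show ?case using tangent_relations.zero by (simp add: push_zero)
next
  case (add a b)
  then show ?case
    using push_add[of a X x b f] relations_formal_vecs[OF X] tangent_relations.add by fastforce
next
  case (scale a r)
  then show ?case
    using push_scale[of a X x f r] relations_formal_vecs[OF X] tangent_relations.scale by fastforce
next
  case (arrow P Q h v)
  have 1: "single P v \<in> formal_vecs X x" using arrow by (intro formal_vecs_single)
  have "(\<lambda>R i. single Q (diff0 (fst P) h v) R i - single P v R i) \<in> formal_vecs X x"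
    by (rule relations_formal_vecs[OF X tangent_relations.arrow[OF arrow]])
  from formal_vecs_add[OF this 1] have 2: "single Q (diff0 (fst P) h v) \<in> formal_vecs X x" by simp
  have "push_formal f (\<lambda>R i. single Q (diff0 (fst P) h v) R i - single P v R i) =
    (\<lambda>R i. single (push_plot f Q) (diff0 (fst (push_plot f P)) h v) R i - single (push_plot f P) v R i)"
    using push_add[OF 2 formal_vecs_scale[OF 1, of "-1"], of f] push_scale[OF 1, of f "-1"]
    by (simp add: push_single)
  moreover have "plot_arrow (push_plot f P) (push_plot f Q) h"
    using arrow(3) by (auto simp: plot_arrow_def push_plot_def split: prod.splits)
  ultimately show ?case
    using tangent_relations.arrow[OF pointed_push[OF f arrow(1)] pointed_push[OF f arrow(2)], of h v] arrow(4)
    by simp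
qed

lemma push_tangent_eq:
  assumes X: "diffeology X" and f: "smooth X Y f" and "a \<in> formal_vecs X x" "b \<in> formal_vecs X x" "tangent_eq X x a b"
  shows "tangent_eq Y (f x) (push_formal f a) (push_formal f b)"
  using push_relations[OF X f assms(5)[unfolded tangent_eq_def]]
    push_add[OF assms(3) formal_vecs_scale[OF assms(4), of "-1"], of f] push_scale[OF assms(4), of f "-1"]
  by (simp add: tangent_eq_def)

lemma tangent_map_tvec:
  assumes "diffeology X" "smooth X Y f" "a \<in> formal_vecs X x"
  shows "tangent_map Y f (tvec X x a) = tvec Y (f x) (push_formal f a)"
  unfolding tangent_map_def tvec_def using assms
  by (auto intro!: UN_class[OF assms(3)] class_cong push_tangent_eq dest: class_memD)

subsection \<open>Germs of plots\<close>

definition component0 :: "nat \<Rightarrow> vec set \<Rightarrow> vec set" where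
  "component0 n U = connected_component_of_set (subtopology (Euclidean_space n) U) zero_vec"

text \<open>Euclidean space is locally connected, so the component of the origin is open and again a
  plot domain.\<close>

lemma component0_props:
  assumes U: "opn n U" "zero_vec \<in> U"
  shows "opn n (component0 n U)" "connectedin (Euclidean_space n) (component0 n U)" "zero_vec \<in> component0 n U" "component0 n U \<subseteq> U"
proof -
  let ?T = "subtopology (Euclidean_space n) U"
  have "locally_connected_space ?T"
    using locally_connected_space_open_subset[OF locally_connected_Euclidean_space U(1)] .
  then have "openin ?T (component0 n U)"
    unfolding component0_def by (simp add: openin_connected_component_of_locally_connected_space)
  then show "opn n (component0 n U)" using U(1) openin_trans_full by blast
  have "connectedin ?T (component0 n U)" unfolding component0_def by (rule connectedin_connected_component_of)
  then show "connectedin (Euclidean_space n) (component0 n U)" "component0 n U \<subseteq> U"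
    by (auto simp: connectedin_subtopology)
  show "zero_vec \<in> component0 n U"
    unfolding component0_def using U opn_subset[OF U(1)] by (auto simp: connected_component_of_refl)
qed

lemma component0_image:
  assumes U: "opn n U" "zero_vec \<in> U" and V: "opn m V"
    and f: "smooth_eucl n U m V f" "f zero_vec = zero_vec"
  shows "f ` component0 n U \<subseteq> component0 m V"
proof -
  have c: "continuous_map (subtopology (Euclidean_space n) U) (Euclidean_space m) f"
    unfolding cm_Euclidean_space_iff_continuous_on
    using smooth_eucl_continuous_on[OF U(1) V f(1)] opn_subset[OF U(1)] opn_subset[OF V] f(1)
    by (auto simp: smooth_eucl_def inf.absorb2)
  have "connectedin (subtopology (Euclidean_space n) U) (component0 n U)"
    unfolding component0_def by (rule connectedin_connected_component_of)
  then have "connectedin (Euclidean_space m) (f ` component0 n U)"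
    using connectedin_continuous_map_image[OF c] by blast
  moreover have "f ` component0 n U \<subseteq> V" using f(1) component0_props(4)[OF U] by (auto simp: smooth_eucl_def)
  ultimately have "connectedin (subtopology (Euclidean_space m) V) (f ` component0 n U)"
    by (simp add: connectedin_subtopology)
  moreover have "zero_vec \<in> f ` component0 n U" using component0_props(3)[OF U] f(2) by force
  ultimately show ?thesis unfolding component0_def by (rule connected_component_of_maximal)
qed

text \<open>Only plots with connected domain represent tangent vectors.\<close>

definition germ :: "nat \<Rightarrow> vec set \<Rightarrow> (vec \<Rightarrow> 'a) \<Rightarrow> vec \<Rightarrow> 'a formal_vec" where
  "germ n U p v = single (n, component0 n U, p) v"

lemma pointed_component0:
  assumes X: "diffeology X" and p: "plot X n U p" "zero_vec \<in> U" "p zero_vec = x"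
  shows "pointed_plot X x (n, component0 n U, p)"
  using component0_props[OF plot_openD[OF X p(1)] p(2)] plot_restrict[OF X p(1)] p(3)
  by (auto simp: pointed_plot_def)

lemma germ_formal_vecs:
  assumes "diffeology X" "plot X n U p" "zero_vec \<in> U" "p zero_vec = x" "v \<in> Rn n"
  shows "germ n U p v \<in> formal_vecs X x"
  unfolding germ_def using pointed_component0[OF assms(1-4)] assms(5) by (intro formal_vecs_single) auto

text \<open>The image of the component of the origin is connected and contains the origin, hence
  lies in the component of the target. So a smooth map between disconnected domains restricts to an
  arrow of the indexing category.\<close>

lemma germ_arrow:
  assumes X: "diffeology X" and p: "plot X n U p" "zero_vec \<in> U" "p zero_vec = x"
    and q: "plot X m V q" "zero_vec \<in> V"
    and f: "smooth_eucl n U m V f" "f zero_vec = zero_vec" "\<And>u. u \<in> U \<Longrightarrow> q (f u) = p u"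
    and v: "v \<in> Rn n"
  shows "tangent_eq X x (germ n U p v) (germ m V q (diff0 n f v))"
proof (rule tangent_eq_sym)
  have U: "opn n U" and V: "opn m V" using plot_openD[OF X] p(1) q(1) by blast+
  have 1: "pointed_plot X x (n, component0 n U, p)" by (rule pointed_component0[OF X p])
  have "q zero_vec = x" using f(2) f(3)[OF p(2)] p(3) by simp
  then have 2: "pointed_plot X x (m, component0 m V, q)" using pointed_component0[OF X q] by blast
  have "smooth_eucl n (component0 n U) m (component0 m V) f"
    using f(1) component0_image[OF U p(2) V f(1,2)] Cs_subset[OF U component0_props(1,4)[OF U p(2)]]
    by (auto simp: smooth_eucl_def)
  then have "plot_arrow (n, component0 n U, p) (m, component0 m V, q) f"
    using f component0_props(4)[OF U p(2)] by (auto simp: plot_arrow_def)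
  from tangent_relations.arrow[OF 1 2 this] v
  show "tangent_eq X x (germ m V q (diff0 n f v)) (germ n U p v)" by (simp add: tangent_eq_def germ_def)
qed

lemma push_germ: "push_formal f (germ n U p v) = germ n U (\<lambda>w. f (p w)) v"
  by (simp add: germ_def push_single push_plot_def comp_def)

lemma germ_add: "germ n U p (\<lambda>i. v i + w i) = (\<lambda>Q i. germ n U p v Q i + germ n U p w Q i)"
  by (simp add: germ_def single_add)

lemma germ_scale: "germ n U p (\<lambda>i. r * v i) = (\<lambda>Q i. r * germ n U p v Q i)"
  by (simp add: germ_def single_scale)

lemma plot_tangent_tvec:
  "plot_tangent X n U p u v = tvec X (p u) (germ n {w. (\<lambda>i. u i + w i) \<in> U} (\<lambda>w. p (\<lambda>i. u i + w i)) v)"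
  by (simp add: plot_tangent_def tvec_def germ_def component0_def Let_def)

lemma velocity_tvec:
  "velocity X S c t = tvec X (c t) (germ 1 (line_set {s. t + s \<in> S}) (\<lambda>w. c (t + w 0)) (coord_vec 1))"
proof -
  have "{w. (\<lambda>i. coord_vec t i + w i) \<in> line_set S} = line_set {s. t + s \<in> S}"
    by (auto simp: line_set_def Rn_iff coord_vec_def)
  then show ?thesis
    unfolding velocity_def plot_tangent_tvec line_set_def[symmetric] coord_vec_def[symmetric] by simp
qed

lemma open_shift: "open S \<Longrightarrow> open {s::real. t + s \<in> S}"
  using open_vimage[of S "\<lambda>s. t + s"] by (simp add: vimage_def continuous_intros)

section \<open>Velocities and logarithmic derivatives\<close>

text \<open>A representative of the velocity at parameter 0; velocities at other times arise by
  translating the curve.\<close>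

definition curve_germ :: "real set \<Rightarrow> (real \<Rightarrow> 'a) \<Rightarrow> 'a formal_vec" where
  "curve_germ S c = germ 1 (line_set S) (\<lambda>w. c (w 0)) (coord_vec 1)"

lemma velocity_curve_germ: "velocity X S c t = tvec X (c t) (curve_germ {s. t + s \<in> S} (\<lambda>s. c (t + s)))"
  by (simp add: velocity_tvec curve_germ_def)

lemma push_curve_germ: "push_formal f (curve_germ S c) = curve_germ S (\<lambda>s. f (c s))"
  by (simp add: curve_germ_def push_germ)

lemma curve_germ_formal_vecs:
  assumes "diffeology X" "open S" "0 \<in> S" "smooth (interval_diffeology S) X c" "c 0 = x"
  shows "curve_germ S c \<in> formal_vecs X x"
  unfolding curve_germ_def using assms coord_vec_Rn smooth_curve_iff[OF assms(1,2)]
  by (intro germ_formal_vecs) (auto simp flip: coord_vec_zero)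

lemma smooth_eucl_line_set:
  assumes "open S" "\<And>j. j < n \<Longrightarrow> smooth (interval_diffeology S) real_diffeology (\<lambda>s. f s j)"
    "\<And>s. s \<in> S \<Longrightarrow> f s \<in> U"
  shows "smooth_eucl 1 (line_set S) n U (\<lambda>w. f (w 0))"
  using assms(2,3) smooth_curve_iff[OF diffeology_real assms(1)]
  by (auto simp: smooth_eucl_def plot_real line_set_def)

lemma diff0_curve: "diff0 1 (\<lambda>w. f (w 0)) (coord_vec 1) = (\<lambda>j. deriv (\<lambda>s. f s j) 0)"
  by (simp add: diff0_def)

text \<open>Differentiating a factorisation through the plot \<open>q\<close>: the factor is itself
  an arrow from the curve to \<open>q\<close>, and its Jacobian is a column. The later computations
  of velocities all come from this.\<close>

lemma curve_germ_arrow: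
  assumes X: "diffeology X" and S: "open S" "0 \<in> S" "smooth (interval_diffeology S) X c"
    and q: "plot X n U q" "zero_vec \<in> U"
    and f: "\<And>j. j < n \<Longrightarrow> smooth (interval_diffeology S) real_diffeology (\<lambda>s. f s j)"
      "\<And>s. s \<in> S \<Longrightarrow> f s \<in> U" "f 0 = zero_vec"
    and qf: "\<And>s. s \<in> S \<Longrightarrow> q (f s) = c s" and x: "c 0 = x"
    and D: "(\<lambda>j. deriv (\<lambda>s. f s j) 0) = v"
  shows "tangent_eq X x (curve_germ S c) (germ n U q v)"
proof -
  have "tangent_eq X x (germ 1 (line_set S) (\<lambda>w. c (w 0)) (coord_vec 1)) (germ n U q (diff0 1 (\<lambda>w. f (w 0)) (coord_vec 1)))"
    by (rule germ_arrow[OF X _ _ _ q smooth_eucl_line_set[OF S(1) f(1,2)]])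
      (use S f(3) qf x smooth_curve_iff[OF X S(1)] coord_vec_Rn in \<open>auto simp: line_set_def Rn_iff\<close>)
  then show ?thesis by (simp only: curve_germ_def diff0_curve D)
qed

text \<open>The chain rule: the plot is the curve \<open>d\<close> itself, and the derivative of the
  factor is the scalar \<open>deriv f 0\<close>. With \<open>f\<close> the identity this also lets
  the domain of a curve shrink, and with \<open>f\<close> zero it kills constant curves.\<close>

lemma curve_germ_reparam:
  assumes X: "diffeology X" and S: "open S" "0 \<in> S" and T: "open T" "smooth (interval_diffeology T) X d"
    and f: "smooth (interval_diffeology S) (interval_diffeology T) f" "f 0 = 0"
    and df: "\<And>s. s \<in> S \<Longrightarrow> d (f s) = c s" and x: "c 0 = x"
  shows "tangent_eq X x (curve_germ S c) (\<lambda>P i. deriv f 0 * curve_germ T d P i)"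
proof -
  have T0: "0 \<in> T" using smooth_intoD[OF f(1), of 0] S(2) f(2) by simp
  have c: "smooth (interval_diffeology S) X c"
    by (rule smooth_cong[OF diffeology_interval X smooth_compose[OF T(2) f(1)]]) (use df in auto)
  have "tangent_eq X x (curve_germ S c) (germ 1 (line_set T) (\<lambda>w. d (w 0)) (\<lambda>i. deriv f 0 * coord_vec 1 i))"
  proof (rule curve_germ_arrow[OF X S c, where f = "\<lambda>s. coord_vec (f s)"])
    show "plot X 1 (line_set T) (\<lambda>w. d (w 0))" using T smooth_curve_iff[OF X T(1)] by blast
    show "(\<lambda>j. deriv (\<lambda>s. coord_vec (f s) j) 0) = (\<lambda>i. deriv f 0 * coord_vec 1 i)"
      by (auto simp: coord_vec_def fun_eq_iff)
    show "smooth (interval_diffeology S) real_diffeology (\<lambda>s. coord_vec (f s) j)" if "j < 1" for j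
      using that smooth_subset_D[OF f(1)] by simp
    show "coord_vec (f s) \<in> line_set T" if "s \<in> S" for s using smooth_intoD[OF f(1), of s] that by simp
    show "zero_vec \<in> line_set T" using T0 coord_vec_line_set[of 0 T] by simp
  qed (use f(2) df x in auto)
  then show ?thesis by (simp add: curve_germ_def germ_scale)
qed

lemma smooth_interval_id: "S \<subseteq> T \<Longrightarrow> smooth (interval_diffeology S) (interval_diffeology T) (\<lambda>s. s)"
  by (rule smooth_into_subset[OF diffeology_interval smooth_incl]) auto

lemma curve_germ_cong:
  assumes X: "diffeology X" and S: "open S" "0 \<in> S" and T: "open T" "smooth (interval_diffeology T) X d"
    and "S \<subseteq> T" "\<And>s. s \<in> S \<Longrightarrow> d s = c s" "c 0 = x"
  shows "tangent_eq X x (curve_germ S c) (curve_germ T d)"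
  using curve_germ_reparam[OF X S T smooth_interval_id[OF assms(6)] refl, of c x] assms(7,8) by simp

lemma curve_germ_const:
  assumes X: "diffeology X" and S: "open S" "0 \<in> S" and x: "x \<in> points X"
    and c: "\<And>s. s \<in> S \<Longrightarrow> c s = x"
  shows "tangent_eq X x (curve_germ S c) (\<lambda>P i. 0)"
proof -
  have "smooth (interval_diffeology S) X (\<lambda>_. x)" by (rule smooth_const[OF diffeology_interval X x])
  from curve_germ_reparam[OF X S S(1) this, of "\<lambda>_. 0" c x] show ?thesis
    using S c smooth_const[OF diffeology_interval diffeology_interval, of 0 S S] by simp
qed

text \<open>The diagonal and the two axes have as velocities the images of the vectors (1,1), (1,0)
  and (0,1) under one plot in two variables, and \<open>germ\<close> is additive in the vector. This
  is the source of the product rule.\<close>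

lemma curve_germ_diagonal:
  assumes X: "diffeology X" and S: "open S" "0 \<in> S"
    and H: "smooth (prod_diffeology (interval_diffeology S) (interval_diffeology S)) X (\<lambda>(a, b). H a b)"
    and x: "H 0 0 = x"
  shows "tangent_eq X x (curve_germ S (\<lambda>s. H s s)) (\<lambda>P i. curve_germ S (\<lambda>s. H s 0) P i + curve_germ S (\<lambda>s. H 0 s) P i)"
proof -
  let ?I = "interval_diffeology S"
  let ?U = "{w \<in> Rn 2. w 0 \<in> S \<and> w 1 \<in> S}"
  let ?q = "\<lambda>w::vec. H (w 0) (w 1)"
  let ?v = "\<lambda>a b::real. (\<lambda>i::nat. if i = 0 then a else if i = 1 then b else 0)"
  have U: "opn 2 ?U"
  proof -
    have "?U = {w \<in> Rn 2. w 0 \<in> S} \<inter> {w \<in> Rn 2. w 1 \<in> S}" by blast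
    then show ?thesis
      using opn_coord_preimage[OF opn_Rn S(1) Cs_coord[OF opn_Rn], of 2 0]
        opn_coord_preimage[OF opn_Rn S(1) Cs_coord[OF opn_Rn], of 2 1] by auto
  qed
  have c: "smooth (eucl_diffeology 2 ?U) ?I (\<lambda>w. w j)" if "j < 2" for j
    by (rule smooth_into_subset[OF diffeology_eucl[OF U] smooth_coord[OF U]])
      (use that in \<open>auto simp: less_2_cases_iff\<close>)
  have q: "plot X 2 ?U ?q"
    unfolding plot_iff_smooth[OF X] using U smooth_compose2[OF H c c, of 0 1] by simp
  have zU: "zero_vec \<in> ?U" using S by (simp add: Rn_iff)
  have I0: "smooth ?I ?I (\<lambda>_. 0)" by (rule smooth_const[OF diffeology_interval diffeology_interval]) (use S in auto)
  \<comment> \<open>The flags \<open>a\<close> and \<open>b\<close> switch each coordinate on or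
    off, so that the diagonal and both axes are treated at once.\<close>
  have real: "smooth ?I real_diffeology (\<lambda>s. ?v (if a then s else 0) (if b then s else 0) j)" for a b j
    using smooth_incl smooth_real_const[OF diffeology_interval]
    by (cases a; cases b; cases "j = 0"; cases "j = 1") auto
  have der: "(\<lambda>j. deriv (\<lambda>s. ?v (if a then s else 0) (if b then s else 0) j) 0) =
      ?v (if a then 1 else 0) (if b then 1 else 0)" for a b
  proof
    show "deriv (\<lambda>s. ?v (if a then s else 0) (if b then s else 0) j) 0 =
      ?v (if a then 1 else 0) (if b then 1 else 0) j" for j
      by (cases a; cases b; cases "j = 0"; cases "j = 1") auto
  qed
  have arrow: "tangent_eq X x (curve_germ S (\<lambda>s. H (if a then s else 0) (if b then s else 0)))
      (germ 2 ?U ?q (?v (if a then 1 else 0) (if b then 1 else 0)))" for a b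
  proof (rule curve_germ_arrow[OF X S _ q zU real[of _ a b] _ _ _ _ der])
    have "smooth ?I ?I (\<lambda>s. if e then s else 0)" for e using smooth_id I0 by (cases e) auto
    then show "smooth ?I X (\<lambda>s. H (if a then s else 0) (if b then s else 0))"
      by (intro smooth_compose2[OF H])
  qed (use S x in \<open>auto simp: Rn_iff\<close>)
  have sum: "germ 2 ?U ?q (?v 1 1) = (\<lambda>Q i. germ 2 ?U ?q (?v 1 0) Q i + germ 2 ?U ?q (?v 0 1) Q i)"
    unfolding germ_add[symmetric] by (rule arg_cong[where f = "germ 2 ?U ?q"]) auto
  show ?thesis
    by (rule tangent_eq_trans[OF arrow[of True True, unfolded if_True if_False sum]
          tangent_eq_sym[OF tangent_eq_add[OF arrow[of True False, unfolded if_True if_False]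
              arrow[of False True, unfolded if_True if_False]]]])
qed

text \<open>The plots of \<open>tangent_bundle\<close> are the common plots of all admissible
  diffeologies, so smoothness can be tested in each of these separately, with its axioms at
  hand.\<close>

lemma smooth_tangent_at:
  assumes Y: "diffeology Y" and X: "diffeology X" and x: "x \<in> points X"
  shows "smooth Y (tangent_at X x) f \<longleftrightarrow>
    (\<forall>y\<in>points Y. f y \<in> tangent_space X x) \<and> (\<forall>A. tangent_admissible X A \<longrightarrow> smooth Y A f)"
proof -
  have pts: "points (tangent_at X x) = tangent_space X x"
    using x by (auto simp: tangent_at_def tangent_bundle_def TX_points_def)
  have A: "points A = TX_points X" if "tangent_admissible X A" for A
    using that by (simp add: tangent_admissible_def)
  have sub: "tangent_space X x \<subseteq> TX_points X" using x by (auto simp: TX_points_def)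
  have pl: "plot (tangent_at X x) n U p \<longleftrightarrow> (\<forall>A. tangent_admissible X A \<longrightarrow> plot A n U p) \<and> p \<in> U \<rightarrow> tangent_space X x" for n U p
    by (simp add: tangent_at_def tangent_bundle_def plot_subset)
  show ?thesis
  proof
    assume f: "smooth Y (tangent_at X x) f"
    then have 1: "f y \<in> tangent_space X x" if "y \<in> points Y" for y
      using smooth_intoD[OF f that] pts by simp
    have "smooth Y A f" if A': "tangent_admissible X A" for A
      by (rule smoothI) (use 1 sub A[OF A'] A' smooth_plotD[OF f] in \<open>auto simp: pl\<close>)
    with 1 show "(\<forall>y\<in>points Y. f y \<in> tangent_space X x) \<and> (\<forall>A. tangent_admissible X A \<longrightarrow> smooth Y A f)" by blast
  next
    assume *: "(\<forall>y\<in>points Y. f y \<in> tangent_space X x) \<and> (\<forall>A. tangent_admissible X A \<longrightarrow> smooth Y A f)"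
    show "smooth Y (tangent_at X x) f"
    proof (rule smoothI)
      show "plot (tangent_at X x) n U (\<lambda>u. f (p u))" if "plot Y n U p" for n U p
        unfolding pl using * plot_intoD[OF Y that] by (blast intro: smooth_plotD[OF _ that])
    qed (use * pts in auto)
  qed
qed

section \<open>Logarithmic derivatives in a diffeological group\<close>

locale dgroup =
  fixes G :: "'g monoid" (structure) and D :: "'g diffeological_space"
  assumes diffeological_group: "diffeological_group G D"
begin

sublocale group G
  using diffeological_group by (simp add: diffeological_group_def)

lemma diffeology_D: "diffeology D" and points_D [simp]: "points D = carrier G"
  using diffeological_group by (auto simp: diffeological_group_def)

lemma smooth_times:
  assumes "smooth Z D f" "smooth Z D g"
  shows "smooth Z D (\<lambda>z. f z \<otimes> g z)"
  by (rule smooth_compose2[OF _ assms]) (use diffeological_group in \<open>simp add: diffeological_group_def\<close>)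

lemma smooth_inverse:
  assumes "smooth Z D f"
  shows "smooth Z D (\<lambda>z. inv (f z))"
  by (rule smooth_compose[OF _ assms]) (use diffeological_group in \<open>simp add: diffeological_group_def\<close>)

lemma smooth_D_const: "diffeology Z \<Longrightarrow> a \<in> carrier G \<Longrightarrow> smooth Z D (\<lambda>_. a)"
  by (rule smooth_const[OF _ diffeology_D]) auto

lemma smooth_right: "a \<in> carrier G \<Longrightarrow> smooth D D (\<lambda>x. x \<otimes> a)"
  by (intro smooth_times smooth_id smooth_D_const diffeology_D)

text \<open>Its push-forward at the identity is the adjoint action Ad.\<close>

definition conj :: "'g \<Rightarrow> 'g \<Rightarrow> 'g" where "conj a x = a \<otimes> x \<otimes> inv a"

lemma smooth_conj: "a \<in> carrier G \<Longrightarrow> smooth D D (conj a)"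
  unfolding conj_def by (intro smooth_times smooth_id smooth_D_const diffeology_D) auto

lemma conj_one [simp]: "a \<in> carrier G \<Longrightarrow> conj a \<one> = \<one>"
  by (simp add: conj_def)

text \<open>A representative of \<open>g' g^-1\<close>. The curve is translated to the identity
  before its velocity is taken, so every value is based at the identity.\<close>

definition log_deriv :: "real set \<Rightarrow> (real \<Rightarrow> 'g) \<Rightarrow> real \<Rightarrow> 'g formal_vec" where
  "log_deriv S g t = curve_germ {s. t + s \<in> S} (\<lambda>s. g (t + s) \<otimes> inv (g t))"

abbreviation leq (infix "\<doteq>" 50) where "a \<doteq> b \<equiv> tangent_eq D \<one> a b"

lemma curve_carrier: "smooth (interval_diffeology S) D g \<Longrightarrow> t \<in> S \<Longrightarrow> g t \<in> carrier G"
  using smooth_intoD[of "interval_diffeology S" D g t] by simp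

lemma smooth_shift: "smooth (interval_diffeology {s. t + s \<in> S}) (interval_diffeology S) (\<lambda>s. t + s)"
  using smooth_affine[of "{s. t + s \<in> S}" t 1]
  by (intro smooth_into_subset[OF diffeology_interval]) auto

lemma shifted_curve:
  "smooth (interval_diffeology S) X c \<Longrightarrow> smooth (interval_diffeology {s. t + s \<in> S}) X (\<lambda>s. c (t + s))"
  by (rule smooth_compose[OF _ smooth_shift])

lemma log_deriv_curve:
  assumes "smooth (interval_diffeology S) D g" "t \<in> S"
  shows "smooth (interval_diffeology {s. t + s \<in> S}) D (\<lambda>s. g (t + s) \<otimes> inv (g t))"
  using assms curve_carrier
  by (intro smooth_times shifted_curve smooth_D_const diffeology_interval) auto

lemma log_deriv_formal_vecs:
  assumes "open S" "smooth (interval_diffeology S) D g" "t \<in> S"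
  shows "log_deriv S g t \<in> formal_vecs D \<one>"
  unfolding log_deriv_def using log_deriv_curve[OF assms(2,3)] assms curve_carrier[OF assms(2,3)]
  by (intro curve_germ_formal_vecs diffeology_D open_shift) auto

text \<open>Push-forward acts on germs by composition. This ties \<open>log_deriv\<close> to the
  expression in \<open>log_derivative_solution\<close>.\<close>

lemma tangent_map_velocity:
  assumes "open S" "smooth (interval_diffeology S) D g" "t \<in> S"
  shows "tangent_map D (\<lambda>x. x \<otimes> inv (g t)) (velocity D S g t) = tvec D \<one> (log_deriv S g t)"
proof -
  have g: "g t \<in> carrier G" by (rule curve_carrier[OF assms(2,3)])
  have 1: "curve_germ {s. t + s \<in> S} (\<lambda>s. g (t + s)) \<in> formal_vecs D (g t)"
    using assms shifted_curve[OF assms(2)] by (intro curve_germ_formal_vecs diffeology_D open_shift) auto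
  show ?thesis
    unfolding velocity_curve_germ
    by (subst tangent_map_tvec[OF diffeology_D smooth_right 1]) (use g in \<open>auto simp: push_curve_germ log_deriv_def\<close>)
qed

text \<open>Once \<open>t\<close> and its image are both moved to 0, the parameter change fixes 0
  and \<open>curve_germ_reparam\<close> applies; the shift leaves the derivative unaltered.\<close>

lemma log_deriv_chain:
  assumes S: "open S" "smooth (interval_diffeology S) D g" and S': "open S'" "t \<in> S'"
    and f: "smooth (interval_diffeology S') (interval_diffeology S) f"
    and h: "\<And>s. s \<in> S' \<Longrightarrow> h s = g (f s)"
  shows "log_deriv S' h t \<doteq> (\<lambda>P i. deriv f t * log_deriv S g (f t) P i)"
proof -
  let ?f = "\<lambda>s. f (t + s) - f t"
  have ft: "f t \<in> S" using smooth_intoD[OF f, of t] S'(2) by simp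
  have fr: "smooth (interval_diffeology S') real_diffeology f" by (rule smooth_subset_D[OF f])
  have "(f has_real_derivative deriv f t) (at t)" by (rule smooth_real_curve[OF S'(1) fr S'(2)])
  then have "(?f has_real_derivative deriv f t) (at 0)"
    using DERIV_shift[of "\<lambda>s. f s - f t" "deriv f t" 0 t] by (auto intro!: derivative_eq_intros simp: add.commute)
  then have d: "deriv ?f 0 = deriv f t" by (rule DERIV_imp_deriv)
  have "smooth (interval_diffeology {s. t + s \<in> S'}) (interval_diffeology {s. f t + s \<in> S}) ?f"
  proof (rule smooth_into_subset[OF diffeology_interval])
    show "smooth (interval_diffeology {s. t + s \<in> S'}) real_diffeology ?f"
      by (intro smooth_diff diffeology_interval shifted_curve[OF fr] smooth_real_const)
    show "?f x \<in> {s. f t + s \<in> S}" if "x \<in> points (interval_diffeology {s. t + s \<in> S'})" for x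
      using smooth_intoD[OF f, of "t + x"] that by simp
  qed
  from curve_germ_reparam[OF diffeology_D open_shift[OF S'(1)] _ open_shift[OF S(1)] log_deriv_curve[OF S(2) ft] this,
      of "\<lambda>s. h (t + s) \<otimes> inv (h t)" \<one>]
  show ?thesis unfolding d log_deriv_def using S'(2) h curve_carrier[OF S(2) ft] by simp
qed

lemma log_deriv_cong:
  assumes "open S" "smooth (interval_diffeology S) D g" "open S'" "t \<in> S'" "S' \<subseteq> S"
    "\<And>s. s \<in> S' \<Longrightarrow> h s = g s"
  shows "log_deriv S' h t \<doteq> log_deriv S g t"
  using log_deriv_chain[OF assms(1-4) smooth_interval_id[OF assms(5)], of h] assms(6) by simp

lemma log_deriv_const:
  assumes "open S" "t \<in> S" "a \<in> carrier G" "\<And>s. s \<in> S \<Longrightarrow> g s = a"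
  shows "log_deriv S g t \<doteq> (\<lambda>P i. 0)"
  unfolding log_deriv_def by (rule curve_germ_const[OF diffeology_D open_shift]) (use assms in auto)

text \<open>In \<open>?H\<close> the factor \<open>h\<close> is corrected to start at the identity.
  The diagonal is the translated product curve, the first axis is the translated curve of
  \<open>g\<close>, and the second is that of \<open>h\<close> conjugated by \<open>g t\<close>.
  Adding the axes gives \<open>(gh)' (gh)^-1 = g' g^-1 + Ad_g (h' h^-1)\<close>.\<close>

lemma log_deriv_mult:
  assumes S: "open S" "t \<in> S" and g: "smooth (interval_diffeology S) D g" and h: "smooth (interval_diffeology S) D h"
    and gh: "\<And>s. s \<in> S \<Longrightarrow> k s = g s \<otimes> h s"
  shows "log_deriv S k t \<doteq> (\<lambda>P i. log_deriv S g t P i + push_formal (conj (g t)) (log_deriv S h t) P i)"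
proof -
  let ?S = "{s. t + s \<in> S}" let ?I = "interval_diffeology ?S"
  have S': "open ?S" "0 \<in> ?S" using S open_shift by auto
  note car = curve_carrier[OF g] curve_carrier[OF h]
  have gt: "g t \<in> carrier G" "h t \<in> carrier G" using car S by auto
  let ?H = "\<lambda>a b. g (t + a) \<otimes> (h (t + b) \<otimes> inv (h t)) \<otimes> inv (g t)"
  have II: "diffeology (prod_diffeology ?I ?I)" by (intro diffeology_prod diffeology_interval)
  have H: "smooth (prod_diffeology ?I ?I) D (\<lambda>(a, b). ?H a b)"
    unfolding case_prod_unfold
    by (intro smooth_times smooth_D_const II smooth_compose[OF shifted_curve[OF g] smooth_fst]
        smooth_compose[OF shifted_curve[OF h] smooth_snd] inv_closed gt)
  have II': "smooth ?I (prod_diffeology ?I ?I) (\<lambda>s. (f s, f' s))" if "smooth ?I ?I f" "smooth ?I ?I f'" for f f'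
    by (rule smooth_Pair[OF that])
  have I0: "smooth ?I ?I (\<lambda>_. 0)" by (rule smooth_const[OF diffeology_interval diffeology_interval]) (use S in auto)
  have H1: "smooth ?I D (\<lambda>s. ?H s s)" "smooth ?I D (\<lambda>s. ?H s 0)" "smooth ?I D (\<lambda>s. ?H 0 s)"
    using smooth_compose2[OF H smooth_id smooth_id] smooth_compose2[OF H smooth_id I0] smooth_compose2[OF H I0 smooth_id] by auto
  have "log_deriv S k t \<doteq> curve_germ ?S (\<lambda>s. ?H s s)"
    unfolding log_deriv_def
  proof (rule curve_germ_cong[OF diffeology_D S' S'(1) H1(1)])
    show "?H s s = k (t + s) \<otimes> inv (k t)" if "s \<in> ?S" for s
      using that gh S gt car by (simp add: inv_mult_group m_assoc)
    show "k (t + 0) \<otimes> inv (k t) = \<one>" using gh[OF S(2)] gt by simp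
  qed simp
  also have "\<dots> \<doteq> (\<lambda>P i. curve_germ ?S (\<lambda>s. ?H s 0) P i + curve_germ ?S (\<lambda>s. ?H 0 s) P i)"
    by (rule curve_germ_diagonal[OF diffeology_D S' H]) (use gt in auto)
  also have "\<dots> \<doteq> (\<lambda>P i. log_deriv S g t P i + push_formal (conj (g t)) (log_deriv S h t) P i)"
  proof (rule tangent_eq_add)
    show "curve_germ ?S (\<lambda>s. ?H s 0) \<doteq> log_deriv S g t" unfolding log_deriv_def
      by (rule curve_germ_cong[OF diffeology_D S' S'(1) log_deriv_curve[OF g S(2)]]) (use gt car in auto)
    show "curve_germ ?S (\<lambda>s. ?H 0 s) \<doteq> push_formal (conj (g t)) (log_deriv S h t)"
      unfolding log_deriv_def push_curve_germ
      by (rule curve_germ_cong[OF diffeology_D S' S'(1) smooth_compose[OF smooth_conj log_deriv_curve[OF h S(2)]]])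
        (use gt in \<open>auto simp: conj_def\<close>)
  qed
  finally show ?thesis .
qed

text \<open>The logarithmic derivative at \<open>t\<close> is the tangent vector in the last coordinate direction of a
  plot with one additional variable, so it depends smoothly on parameters by the first admissibility axiom.\<close>

lemma log_deriv_smooth:
  assumes Z: "diffeology Z" and A: "tangent_admissible D A"
    and B: "openin (D_topology (prod_diffeology Z real_diffeology)) B"
    and g: "smooth (subset_diffeology (prod_diffeology Z real_diffeology) B) D (\<lambda>(z, t). g z t)"
  shows "smooth (subset_diffeology (prod_diffeology Z real_diffeology) B) A
    (\<lambda>(z, t). tvec D \<one> (log_deriv {s. (z, s) \<in> B} (g z) t))"
proof -
  let ?ZR = "prod_diffeology Z real_diffeology"
  let ?Y = "subset_diffeology ?ZR B"
  have ZR: "diffeology ?ZR" by (intro diffeology_prod Z diffeology_real)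
  have Y: "diffeology ?Y" by (rule diffeology_subset[OF ZR])
  have dA: "diffeology A" and pA: "points A = TX_points D"
    and TA: "\<And>n U p. plot D n U p \<Longrightarrow> smooth (prod_diffeology (eucl_diffeology n U) (eucl_diffeology n (Rn n))) A
               (\<lambda>(u, v). plot_tangent D n U p u v)"
    using A by (auto simp: tangent_admissible_def)
  have Osub: "B \<subseteq> points ?ZR" using openin_subset[OF B] topspace_D_topology[OF ZR] by simp
  have slice: "smooth (interval_diffeology {s. (z, s) \<in> B}) ?ZR (\<lambda>s. (z, s))" if "z \<in> points Z" for z
    using that by (intro smooth_Pair smooth_const diffeology_interval Z smooth_incl)
  have slice_open: "open {s. (z, s) \<in> B}" if "z \<in> points Z" for z
  proof -
    have "smooth (interval_diffeology UNIV) ?ZR (\<lambda>s. (z, s))"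
      using that by (intro smooth_Pair smooth_const diffeology_interval Z smooth_incl)
    from open_curve_preimage[OF ZR open_UNIV this B] show ?thesis by simp
  qed
  have gs: "smooth (interval_diffeology {s. (z, s) \<in> B}) D (g z)" if "z \<in> points Z" for z
  proof -
    have "smooth (interval_diffeology {s. (z, s) \<in> B}) ?Y (\<lambda>s. (z, s))"
      by (rule smooth_into_subset[OF diffeology_interval slice[OF that]]) auto
    from smooth_compose[OF g this] show ?thesis by simp
  qed
  show ?thesis
  proof (rule smoothI)
    fix y assume "y \<in> points ?Y"
    then obtain z t where y: "y = (z, t)" "z \<in> points Z" "(z, t) \<in> B" by auto
    have "tvec D \<one> (log_deriv {s. (z, s) \<in> B} (g z) t) \<in> tangent_space D \<one>"
      by (intro tvec_tangent_space log_deriv_formal_vecs slice_open gs) (use y in auto)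
    then show "(case y of (z, t) \<Rightarrow> tvec D \<one> (log_deriv {s. (z, s) \<in> B} (g z) t)) \<in> points A"
      using y(1) by (auto simp: pA TX_points_def)
  next
    fix m Q P assume P: "plot ?Y m Q P"
    define z where "z u = fst (P u)" for u
    define \<tau> where "\<tau> u = snd (P u)" for u
    have Q: "opn m Q" by (rule plot_openD[OF Y P])
    have PO: "z u \<in> points Z" "(z u, \<tau> u) \<in> B" if "u \<in> Q" for u
    proof -
      have "P u \<in> points ?Y" using plot_intoD[OF Y P] that by blast
      then show "z u \<in> points Z" "(z u, \<tau> u) \<in> B" by (cases "P u"; auto simp: z_def \<tau>_def)+
    qed
    have zp: "plot Z m Q z" and \<tau>p: "plot real_diffeology m Q \<tau>"
      using P by (auto simp: plot_subset plot_prod z_def[abs_def] \<tau>_def[abs_def])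
    let ?n = "Suc m"
    \<comment> \<open>The plot in \<open>m\<close> variables gets one more variable, with index
      \<open>m\<close>; \<open>?r\<close> resets it to 0.\<close>
    let ?r = "\<lambda>w::vec. w(m := 0)"
    have rR: "?r w \<in> Rn m" if "w \<in> Rn ?n" for w using that by (auto simp: Rn_iff le_Suc_eq)
    have r: "smooth_eucl ?n (Rn ?n) m (Rn m) ?r"
      using rR Cs_coord[OF opn_Rn] Cs_const[OF opn_Rn] by (auto simp: smooth_eucl_def)
    define Q0 where "Q0 = {w \<in> Rn ?n. ?r w \<in> Q}"
    have Q0: "opn ?n Q0"
      unfolding Q0_def by (rule smooth_eucl_preimage_opn[OF opn_Rn opn_Rn r Q])
    have r0: "smooth_eucl ?n Q0 m Q ?r"
      using r Cs_subset[OF opn_Rn Q0] by (auto simp: smooth_eucl_def Q0_def)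
    \<comment> \<open>The new variable shifts the time at which the curve is evaluated.\<close>
    define P' where "P' w = (z (?r w), \<tau> (?r w) + w m)" for w
    have P'0: "plot ?ZR ?n Q0 P'"
      unfolding plot_prod P'_def fst_conv snd_conv
    proof
      show "plot Z ?n Q0 (\<lambda>w. z (?r w))" by (rule plot_comp[OF Z zp Q0 r0])
      show "plot real_diffeology ?n Q0 (\<lambda>w. \<tau> (?r w) + w m)"
        using plot_comp[OF diffeology_real \<tau>p Q0 r0] Cs_add[OF Q0 _ Cs_coord[OF Q0]] by (simp add: plot_real)
    qed
    define Q' where "Q' = {w \<in> Q0. P' w \<in> B}"
    have Q': "opn ?n Q'" unfolding Q'_def by (rule openin_D_plot[OF ZR B P'0])
    have Q'sub: "Q' \<subseteq> Q0" by (auto simp: Q'_def)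
    have P'1: "plot ?Y ?n Q' P'"
      using plot_restrict[OF ZR P'0 Q' Q'sub] by (auto simp: plot_subset Q'_def)
    have "smooth_eucl ?n Q' m Q ?r"
      using r0 Cs_subset[OF Q0 Q' Q'sub] Q'sub by (auto simp: smooth_eucl_def)
    then have Pr: "plot ?Y ?n Q' (\<lambda>w. P (?r w))" by (rule plot_comp[OF Y P Q'])
    let ?g = "\<lambda>(z, t). g z t"
    \<comment> \<open>Dividing by the value at the unshifted time makes \<open>q\<close> the
      identity where the new variable vanishes, so that its tangent vectors there lie in the Lie
      algebra.\<close>
    define q where "q w = ?g (P' w) \<otimes> inv (?g (P (?r w)))" for w
    have q: "plot D ?n Q' q"
    proof -
      have "smooth (eucl_diffeology ?n Q') D (\<lambda>w. ?g (P' w))" "smooth (eucl_diffeology ?n Q') D (\<lambda>w. ?g (P (?r w)))"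
        using smooth_plotD[OF g P'1] smooth_plotD[OF g Pr] plot_iff_smooth[OF diffeology_D] by blast+
      from smooth_times[OF this(1) smooth_inverse[OF this(2)]]
      show ?thesis unfolding plot_iff_smooth[OF diffeology_D] q_def using Q' by blast
    qed
    define e where "e = zero_vec(m := 1::real)"
    have e: "e \<in> Rn ?n" by (auto simp: e_def Rn_iff)
    have QQ': "u \<in> Q'" if "u \<in> Q" for u
    proof -
      have u: "u \<in> Rn m" using that opn_subset[OF Q] by blast
      then have "?r u = u" "u \<in> Rn ?n" "u m = 0" by (auto simp: Rn_iff fun_eq_iff)
      then show ?thesis using that PO[OF that] by (simp add: Q'_def Q0_def P'_def)
    qed
    have "plot (prod_diffeology (eucl_diffeology ?n Q') (eucl_diffeology ?n (Rn ?n))) m Q (\<lambda>u. (u, e))"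
      unfolding plot_prod plot_eucl fst_conv snd_conv
      using Q QQ' e Cs_coord[OF Q] Cs_const[OF Q] by (auto simp: smooth_eucl_def)
    from smooth_plotD[OF TA[OF q] this]
    have T: "plot A m Q (\<lambda>u. plot_tangent D ?n Q' q u e)" by simp
    show "plot A m Q (\<lambda>u. case P u of (z, t) \<Rightarrow> tvec D \<one> (log_deriv {s. (z, s) \<in> B} (g z) t))"
    proof (rule plot_cong[OF dA T])
      fix u assume u: "u \<in> Q"
      have uR: "u \<in> Rn m" using u opn_subset[OF Q] by blast
      then have um: "?r u = u" "u m = 0" by (auto simp: Rn_iff fun_eq_iff)
      let ?S = "{s. (z u, s) \<in> B}"
      have S: "open ?S" "smooth (interval_diffeology ?S) D (g (z u))" "\<tau> u \<in> ?S"
        using slice_open gs PO[OF u] by auto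
      let ?U = "{w. (\<lambda>i. u i + w i) \<in> Q'}"
      have tr: "smooth_eucl ?n (Rn ?n) ?n (Rn ?n) (\<lambda>w i. u i + w i)"
        using uR Cs_add[OF opn_Rn Cs_const[OF opn_Rn] Cs_coord[OF opn_Rn]]
        by (auto simp: smooth_eucl_def Rn_iff)
      have UR: "?U = {w \<in> Rn ?n. (\<lambda>i. u i + w i) \<in> Q'}"
      proof -
        have "w \<in> Rn ?n" if "(\<lambda>i. u i + w i) \<in> Q'" for w
          using that uR opn_subset[OF Q'] by (force simp: Rn_iff subset_iff)
        then show ?thesis by blast
      qed
      have U: "opn ?n ?U" unfolding UR by (rule smooth_eucl_preimage_opn[OF opn_Rn opn_Rn tr Q'])
      have "smooth_eucl ?n ?U ?n Q' (\<lambda>w i. u i + w i)"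
        using tr Cs_subset[OF opn_Rn U] opn_subset[OF U] by (auto simp: smooth_eucl_def)
      then have qu: "plot D ?n ?U (\<lambda>w. q (\<lambda>i. u i + w i))" by (rule plot_comp[OF diffeology_D q U])
      have upd: "(\<lambda>i. u i + (zero_vec(m := s)) i) = u(m := s)" for s using um by auto
      have rup: "?r (u(m := s)) = u" for s using um by simp
      \<comment> \<open>Along the new axis \<open>q\<close> runs through the curve that defines
        \<open>log_deriv\<close>.\<close>
      have q1: "q (u(m := s)) = g (z u) (\<tau> u + s) \<otimes> inv (g (z u) (\<tau> u))" for s
        unfolding q_def P'_def rup by (simp add: z_def \<tau>_def case_prod_unfold)
      have q0: "q u = \<one>" using q1[of 0] um curve_carrier[OF S(2,3)] by simp
      have memU: "zero_vec(m := s) \<in> ?U" if "\<tau> u + s \<in> ?S" for s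
        unfolding mem_Collect_eq upd Q'_def Q0_def P'_def rup using that u uR by (auto simp: Rn_iff)
      have "log_deriv ?S (g (z u)) (\<tau> u) \<doteq> germ ?n ?U (\<lambda>w. q (\<lambda>i. u i + w i)) e"
        unfolding log_deriv_def
      proof (rule curve_germ_arrow[OF diffeology_D open_shift[OF S(1)] _ log_deriv_curve[OF S(2,3)] qu, where f = "\<lambda>s. zero_vec(m := s)"])
        show "zero_vec \<in> ?U" using memU[of 0] S(3) by simp
        show "smooth (interval_diffeology {s. \<tau> u + s \<in> ?S}) real_diffeology (\<lambda>s. (zero_vec(m := s)) j)" for j
          using smooth_incl smooth_real_const[OF diffeology_interval] by (cases "j = m") auto
        show "(\<lambda>j. deriv (\<lambda>s. (zero_vec(m := s)) j) 0) = e"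
          by (auto simp: e_def fun_eq_iff)
        show "g (z u) (\<tau> u + 0) \<otimes> inv (g (z u) (\<tau> u)) = \<one>" using curve_carrier[OF S(2,3)] by simp
      qed (use S(3) memU q1 upd in auto)
      then show "(case P u of (z, t) \<Rightarrow> tvec D \<one> (log_deriv {s. (z, s) \<in> B} (g z) t)) = plot_tangent D ?n Q' q u e"
        unfolding plot_tangent_tvec q0 by (simp add: tvec_cong z_def \<tau>_def case_prod_unfold)
    qed
  qed
qed

end

section \<open>Regular diffeological Lie groups\<close>

abbreviation unit_interval :: "real diffeological_space" where
  "unit_interval \<equiv> interval_diffeology {0..1}"

context dgroup
begin

section \<open>Smooth maps into the Lie algebra\<close>

abbreviation lie :: "'g tangent diffeological_space" where "lie \<equiv> tangent_at D \<one>"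

lemma one_D: "\<one> \<in> points D" by simp

lemma admissible_diffeology: "tangent_admissible D A \<Longrightarrow> diffeology A"
  by (simp add: tangent_admissible_def)

lemma smooth_lie_iff:
  "diffeology Z \<Longrightarrow> smooth Z lie f \<longleftrightarrow>
    (\<forall>z\<in>points Z. f z \<in> tangent_space D \<one>) \<and> (\<forall>A. tangent_admissible D A \<longrightarrow> smooth Z A f)"
  by (rule smooth_tangent_at[OF _ diffeology_D one_D])

lemma smooth_lie_cong:
  assumes "diffeology Z" "smooth Z lie f" "\<And>z. z \<in> points Z \<Longrightarrow> g z = f z"
  shows "smooth Z lie g"
  unfolding smooth_lie_iff[OF assms(1)]
proof (intro conjI ballI allI impI)
  show "g z \<in> tangent_space D \<one>" if "z \<in> points Z" for z
    using assms(2) that assms(3)[OF that] unfolding smooth_lie_iff[OF assms(1)] by simp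
  show "smooth Z A g" if A: "tangent_admissible D A" for A
    using assms(2) A unfolding smooth_lie_iff[OF assms(1)]
    by (intro smooth_cong[OF assms(1) admissible_diffeology[OF A] _ assms(3)]) blast
qed

lemma smooth_lie_local:
  assumes Z: "diffeology Z"
    and *: "\<And>z. z \<in> points Z \<Longrightarrow>
      \<exists>N. openin (D_topology Z) N \<and> z \<in> N \<and> smooth (subset_diffeology Z N) lie f"
  shows "smooth Z lie f"
  unfolding smooth_lie_iff[OF Z]
proof (intro conjI ballI allI impI)
  fix z assume z: "z \<in> points Z"
  then obtain N where "z \<in> N" "smooth (subset_diffeology Z N) lie f" using * by blast
  then show "f z \<in> tangent_space D \<one>"
    using z unfolding smooth_lie_iff[OF diffeology_subset[OF Z]] by simp
next
  fix A assume A: "tangent_admissible D A"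
  show "smooth Z A f"
  proof (rule smooth_local[OF Z admissible_diffeology[OF A]])
    fix z assume "z \<in> points Z"
    then obtain N where "openin (D_topology Z) N" "z \<in> N" "smooth (subset_diffeology Z N) lie f" using * by blast
    then show "\<exists>N. openin (D_topology Z) N \<and> z \<in> N \<and> smooth (subset_diffeology Z N) A f"
      using A unfolding smooth_lie_iff[OF diffeology_subset[OF Z]] by blast
  qed
qed

text \<open>The scaling axiom of each admissible diffeology, read on representatives. Smoothness
  concerns the classes; the representatives themselves carry no regularity in
  \<open>z\<close>.\<close>

lemma smooth_lie_scale:
  assumes Z: "diffeology Z" and r: "smooth Z real_diffeology r"
    and x: "\<And>z. z \<in> points Z \<Longrightarrow> x z \<in> formal_vecs D \<one>" "smooth Z lie (\<lambda>z. tvec D \<one> (x z))"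
  shows "smooth Z lie (\<lambda>z. tvec D \<one> (\<lambda>P i. r z * x z P i))"
  unfolding smooth_lie_iff[OF Z]
proof (intro conjI ballI allI impI)
  show "tvec D \<one> (\<lambda>P i. r z * x z P i) \<in> tangent_space D \<one>" if "z \<in> points Z" for z
    by (intro tvec_tangent_space formal_vecs_scale x(1) that)
  fix A assume A: "tangent_admissible D A"
  then have sc: "smooth (prod_diffeology real_diffeology A) A (\<lambda>(r, \<xi>). tangent_scale D r \<xi>)"
    by (simp add: tangent_admissible_def)
  have "smooth Z A (\<lambda>z. tvec D \<one> (x z))" using x(2) A unfolding smooth_lie_iff[OF Z] by blast
  from smooth_compose2[OF sc r this] show "smooth Z A (\<lambda>z. tvec D \<one> (\<lambda>P i. r z * x z P i))"
    by (rule smooth_cong[OF Z admissible_diffeology[OF A]]) (simp add: tangent_scale_tvec x(1))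
qed

lemma smooth_lie_add:
  assumes Z: "diffeology Z"
    and x: "\<And>z. z \<in> points Z \<Longrightarrow> x z \<in> formal_vecs D \<one>" "smooth Z lie (\<lambda>z. tvec D \<one> (x z))"
    and y: "\<And>z. z \<in> points Z \<Longrightarrow> y z \<in> formal_vecs D \<one>" "smooth Z lie (\<lambda>z. tvec D \<one> (y z))"
  shows "smooth Z lie (\<lambda>z. tvec D \<one> (\<lambda>P i. x z P i + y z P i))"
  unfolding smooth_lie_iff[OF Z]
proof (intro conjI ballI allI impI)
  show "tvec D \<one> (\<lambda>P i. x z P i + y z P i) \<in> tangent_space D \<one>" if "z \<in> points Z" for z
    by (intro tvec_tangent_space formal_vecs_add x(1) y(1) that)
  fix A assume A: "tangent_admissible D A"
  then have ad: "smooth (subset_diffeology (prod_diffeology A A) {(\<xi>, \<eta>). fst \<xi> = fst \<eta>}) A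
            (\<lambda>(\<xi>, \<eta>). tangent_add D \<xi> \<eta>)"
    by (simp add: tangent_admissible_def)
  have xy: "smooth Z A (\<lambda>z. tvec D \<one> (x z))" "smooth Z A (\<lambda>z. tvec D \<one> (y z))"
    using x(2) y(2) A unfolding smooth_lie_iff[OF Z] by blast+
  have "smooth Z (subset_diffeology (prod_diffeology A A) {(\<xi>, \<eta>). fst \<xi> = fst \<eta>})
      (\<lambda>z. (tvec D \<one> (x z), tvec D \<one> (y z)))"
    by (rule smooth_into_subset[OF Z smooth_Pair[OF xy]]) (simp add: tvec_def)
  from smooth_compose[OF ad this] show "smooth Z A (\<lambda>z. tvec D \<one> (\<lambda>P i. x z P i + y z P i))"
    by (rule smooth_cong[OF Z admissible_diffeology[OF A]]) (simp add: tangent_add_tvec x(1) y(1))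
qed

lemma smooth_lie_zero: "diffeology Z \<Longrightarrow> smooth Z lie (\<lambda>z. tvec D \<one> (\<lambda>P i. 0))"
  unfolding smooth_lie_iff
  by (auto intro!: tvec_tangent_space formal_vecs_zero smooth_const admissible_diffeology
      simp: tangent_admissible_def TX_points_def)

lemma smooth_lie_sum:
  assumes Z: "diffeology Z" and "finite B" and r: "\<And>j. j \<in> B \<Longrightarrow> smooth Z real_diffeology (r j)"
    and x: "\<And>j z. j \<in> B \<Longrightarrow> z \<in> points Z \<Longrightarrow> x j z \<in> formal_vecs D \<one>"
      "\<And>j. j \<in> B \<Longrightarrow> smooth Z lie (\<lambda>z. tvec D \<one> (x j z))"
  shows "smooth Z lie (\<lambda>z. tvec D \<one> (\<lambda>P i. \<Sum>j\<in>B. r j z * x j z P i))"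
  using assms(2) r x
proof (induction B)
  case empty
  then show ?case using smooth_lie_zero[OF Z] by simp
next
  case (insert j B)
  have "smooth Z lie (\<lambda>z. tvec D \<one> (\<lambda>P i. r j z * x j z P i + (\<Sum>j\<in>B. r j z * x j z P i)))"
    by (rule smooth_lie_add[OF Z _ smooth_lie_scale[OF Z] _ insert.IH])
      (use insert.prems in \<open>auto intro!: formal_vecs_scale formal_vecs_sum\<close>)
  then show ?case using insert.hyps by simp
qed

text \<open>By the product rule the constant factor contributes Ad of zero. This allows solutions to
  be renormalised at another starting time.\<close>

lemma log_deriv_right:
  assumes "open S" "t \<in> S" "smooth (interval_diffeology S) D g" "a \<in> carrier G"
    "\<And>s. s \<in> S \<Longrightarrow> k s = g s \<otimes> a"
  shows "log_deriv S k t \<doteq> log_deriv S g t"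
proof -
  let ?c = "log_deriv S (\<lambda>_. a) t"
  have g: "g t \<in> carrier G" using curve_carrier assms by blast
  have a: "smooth (interval_diffeology S) D (\<lambda>_. a)" by (rule smooth_D_const[OF diffeology_interval assms(4)])
  have "?c \<doteq> (\<lambda>P i. 0)" by (rule log_deriv_const[OF assms(1,2,4)]) simp
  from push_tangent_eq[OF diffeology_D smooth_conj[OF g] log_deriv_formal_vecs[OF assms(1) a assms(2)] formal_vecs_zero this]
  have "push_formal (conj (g t)) ?c \<doteq> (\<lambda>P i. 0)" using g by (simp add: push_zero)
  from tangent_eq_trans[OF log_deriv_mult[OF assms(1,2,3) a assms(5)] tangent_eq_add[OF tangent_eq_refl this]]
  show ?thesis by simp
qed

lemma log_deriv_left:
  assumes "open S" "t \<in> S" "smooth (interval_diffeology S) D g" "a \<in> carrier G"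
    "\<And>s. s \<in> S \<Longrightarrow> k s = a \<otimes> g s"
  shows "log_deriv S k t \<doteq> push_formal (conj a) (log_deriv S g t)"
proof -
  have a: "smooth (interval_diffeology S) D (\<lambda>_. a)" by (rule smooth_D_const[OF diffeology_interval assms(4)])
  have "log_deriv S (\<lambda>_. a) t \<doteq> (\<lambda>P i. 0)" by (rule log_deriv_const[OF assms(1,2,4)]) simp
  from tangent_eq_trans[OF log_deriv_mult[OF assms(1,2) a assms(3,5)] tangent_eq_add[OF this tangent_eq_refl]]
  show ?thesis by simp
qed

text \<open>Left multiplication by \<open>a\<close> contributes Ad, right multiplication by its
  inverse nothing.\<close>

lemma log_deriv_conj:
  assumes "open S" "t \<in> S" "smooth (interval_diffeology S) D g" "a \<in> carrier G"
    "\<And>s. s \<in> S \<Longrightarrow> k s = conj a (g s)"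
  shows "log_deriv S k t \<doteq> push_formal (conj a) (log_deriv S g t)"
proof -
  have ag: "smooth (interval_diffeology S) D (\<lambda>s. a \<otimes> g s)"
    by (intro smooth_times smooth_D_const diffeology_interval assms)
  have "log_deriv S k t \<doteq> log_deriv S (\<lambda>s. a \<otimes> g s) t"
    by (rule log_deriv_right[OF assms(1,2) ag inv_closed[OF assms(4)]]) (simp add: assms(5) conj_def)
  also have "\<dots> \<doteq> push_formal (conj a) (log_deriv S g t)"
    by (rule log_deriv_left[OF assms(1-4)]) simp
  finally show ?thesis .
qed

end

section \<open>Solutions of the logarithmic differential equation\<close>

locale regular_dgroup = dgroup G D for G :: "'g monoid" (structure) and D :: "'g diffeological_space" +
  fixes Exp :: "(real \<Rightarrow> 'g tangent) \<Rightarrow> real \<Rightarrow> 'g"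
  assumes Exp_smooth: "smooth (smooth_maps unit_interval lie) (smooth_maps unit_interval D) Exp"
    and Exp_iff: "\<xi> \<in> points (smooth_maps unit_interval lie) \<Longrightarrow> g \<in> points (smooth_maps unit_interval D) \<Longrightarrow>
      log_derivative_solution G D \<xi> g \<longleftrightarrow> g = Exp \<xi>"
begin

text \<open>The points of \<open>smooth_maps\<close> are extensional functions, hence the
  restriction.\<close>

abbreviation vfield :: "(real \<Rightarrow> 'g formal_vec) \<Rightarrow> real \<Rightarrow> 'g tangent" where
  "vfield x \<equiv> restrict (\<lambda>t. tvec D \<one> (x t)) {0..1}"

lemma smooth_maps_points:
  "f \<in> points (smooth_maps unit_interval Y) \<longleftrightarrow> f \<in> extensional {0..1} \<and> smooth unit_interval Y f"
  by (simp add: smooth_maps_def)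

lemma vfield_points:
  assumes "smooth unit_interval lie (\<lambda>t. tvec D \<one> (x t))"
  shows "vfield x \<in> points (smooth_maps unit_interval lie)"
  unfolding smooth_maps_points using smooth_lie_cong[OF diffeology_interval assms] by auto

lemma log_derivative_solution_iff:
  assumes "smooth unit_interval D g"
  shows "log_derivative_solution G D \<xi> g \<longleftrightarrow> g 0 = \<one> \<and> (\<forall>t\<in>{0<..<1}. tvec D \<one> (log_deriv {0<..<1} g t) = \<xi> t)"
proof -
  have g: "smooth (interval_diffeology {0<..<1}) D g" by (rule smooth_subset_mono[OF assms]) auto
  have "tangent_map D (\<lambda>x. x \<otimes> inv g t) (velocity D {0<..<1} g t) = tvec D \<one> (log_deriv {0<..<1} g t)"
    if "t \<in> {0<..<1}" for t
    by (rule tangent_map_velocity[OF _ g that]) simp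
  then show ?thesis by (simp add: log_derivative_solution_def)
qed

text \<open>Restricting \<open>h\<close> to the unit interval makes it a point of
  \<open>smooth_maps\<close> and does not change its logarithmic derivative at interior times, where
  regularity imposes the equation.\<close>

lemma Exp_unique:
  assumes h: "smooth unit_interval D h" "h 0 = \<one>"
    and x: "smooth unit_interval lie (\<lambda>t. tvec D \<one> (x t))"
    and LDh: "\<And>t. t \<in> {0<..<1} \<Longrightarrow> log_deriv {0<..<1} h t \<doteq> x t" and s: "s \<in> {0..1}"
  shows "Exp (vfield x) s = h s"
proof -
  let ?g = "restrict h {0..1}"
  have g: "smooth unit_interval D ?g"
    by (rule smooth_cong[OF diffeology_interval diffeology_D h(1)]) auto
  have h': "smooth (interval_diffeology {0<..<1}) D h" by (rule smooth_subset_mono[OF h(1)]) auto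
  have "log_derivative_solution G D (vfield x) ?g"
    unfolding log_derivative_solution_iff[OF g]
  proof (intro conjI ballI)
    fix t :: real assume t: "t \<in> {0<..<1}"
    have "log_deriv {0<..<1} ?g t \<doteq> log_deriv {0<..<1} h t"
      by (rule log_deriv_cong[OF _ h' _ t]) auto
    from tvec_cong[OF tangent_eq_trans[OF this LDh[OF t]]] t
    show "tvec D \<one> (log_deriv {0<..<1} ?g t) = vfield x t" by simp
  qed (use h in auto)
  moreover have "?g \<in> points (smooth_maps unit_interval D)"
    using g unfolding smooth_maps_points by simp
  ultimately have "?g = Exp (vfield x)" using Exp_iff[OF vfield_points[OF x]] by blast
  then show ?thesis using s by (metis restrict_apply')
qed

lemma Exp_solution:
  assumes x: "smooth unit_interval lie (\<lambda>t. tvec D \<one> (x t))"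
  shows "smooth unit_interval D (Exp (vfield x))" "Exp (vfield x) 0 = \<one>"
    "t \<in> {0<..<1} \<Longrightarrow> log_deriv {0<..<1} (Exp (vfield x)) t \<doteq> x t"
proof -
  have E: "Exp (vfield x) \<in> points (smooth_maps unit_interval D)"
    using smooth_intoD[OF Exp_smooth vfield_points[OF x]] .
  then show g: "smooth unit_interval D (Exp (vfield x))" unfolding smooth_maps_points by blast
  have *: "log_derivative_solution G D (vfield x) (Exp (vfield x))"
    using Exp_iff[OF vfield_points[OF x] E] by blast
  then show "Exp (vfield x) 0 = \<one>" unfolding log_derivative_solution_iff[OF g] by blast
  assume t: "t \<in> {0<..<1}"
  then have eq: "tvec D \<one> (log_deriv {0<..<1} (Exp (vfield x)) t) = tvec D \<one> (x t)"
    using * unfolding log_derivative_solution_iff[OF g] by simp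
  have "log_deriv {0<..<1} (Exp (vfield x)) t \<in> formal_vecs D \<one>"
    by (rule log_deriv_formal_vecs[OF _ smooth_subset_mono[OF g] t]) auto
  from tvec_eq_iff[OF this, THEN iffD1, OF eq] show "log_deriv {0<..<1} (Exp (vfield x)) t \<doteq> x t" .
qed

text \<open>Joint smoothness in parameter and time is what makes a family of fields a plot for the
  functional diffeology. Smoothness of \<open>Exp\<close> turns it into a plot of curves, which is
  then evaluated at 1.\<close>

lemma Exp_eval_smooth:
  assumes Z: "diffeology Z"
    and x: "smooth (prod_diffeology Z unit_interval) lie (\<lambda>(z, s). tvec D \<one> (x z s))"
  shows "smooth Z D (\<lambda>z. Exp (vfield (x z)) 1)"
proof -
  have slice: "smooth unit_interval lie (\<lambda>s. tvec D \<one> (x z s))" if "z \<in> points Z" for z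
    using that by (intro smooth_compose2[OF x] smooth_const smooth_id diffeology_interval Z)
  show ?thesis
  proof (rule smoothI)
    show "Exp (vfield (x z)) 1 \<in> points D" if "z \<in> points Z" for z
      using smooth_intoD[OF Exp_solution(1)[OF slice[OF that]], of 1] by simp
    fix n U p assume p: "plot Z n U p"
    have U: "opn n U" and pZ: "p \<in> U \<rightarrow> points Z" using plot_openD[OF Z p] plot_intoD[OF Z p] by auto
    have ps: "smooth (eucl_diffeology n U) Z p" using p plot_iff_smooth[OF Z] by blast
    let ?E = "prod_diffeology (eucl_diffeology n U) unit_interval"
    have E: "diffeology ?E" by (intro diffeology_prod diffeology_interval diffeology_eucl U)
    have "smooth ?E lie (\<lambda>y. tvec D \<one> (x (p (fst y)) (snd y)))"
      by (intro smooth_compose2[OF x] smooth_compose[OF ps smooth_fst] smooth_snd)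
    then have vE: "smooth ?E lie (\<lambda>(u, s). vfield (x (p u)) s)"
      by (rule smooth_lie_cong[OF E]) auto
    have "plot (smooth_maps unit_interval lie) n U (\<lambda>u. vfield (x (p u)))"
    proof -
      have pl: "plot (smooth_maps unit_interval lie) n U q \<longleftrightarrow> opn n U \<and>
          (\<forall>u\<in>U. q u \<in> points (smooth_maps unit_interval lie)) \<and> smooth ?E lie (\<lambda>(u, s). q u s)" for q
        by (simp add: smooth_maps_def)
      show ?thesis
        unfolding pl using U vfield_points[OF slice] pZ vE by blast
    qed
    from smooth_plotD[OF Exp_smooth this]
    have S: "smooth ?E D (\<lambda>(u, s). Exp (vfield (x (p u))) s)" by (simp add: smooth_maps_def)
    have "smooth (eucl_diffeology n U) D (\<lambda>u. Exp (vfield (x (p u))) 1)"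
      by (intro smooth_compose2[OF S] smooth_id smooth_const diffeology_eucl diffeology_interval U) auto
    then show "plot D n U (\<lambda>u. Exp (vfield (x (p u))) 1)" using U plot_iff_smooth[OF diffeology_D] by blast
  qed
qed

text \<open>\<open>sol x t0 t\<close> is the value at \<open>t\<close> of the curve with logarithmic derivative \<open>x\<close> that starts at the
  identity at time \<open>t0\<close>. Regularity only provides solutions on the unit interval, so \<open>x\<close> is first rescaled from
  the segment between \<open>t0\<close> and \<open>t\<close>; for \<open>t < t0\<close> time is reversed.\<close>

definition seg :: "(real \<Rightarrow> 'g formal_vec) \<Rightarrow> real \<Rightarrow> real \<Rightarrow> real \<Rightarrow> 'g formal_vec" where
  "seg x t0 t s = (\<lambda>P i. (t - t0) * x (t0 + s * (t - t0)) P i)"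

definition sol :: "(real \<Rightarrow> 'g formal_vec) \<Rightarrow> real \<Rightarrow> real \<Rightarrow> 'g" where
  "sol x t0 t = Exp (vfield (seg x t0 t)) 1"

text \<open>Time-dependent elements of the Lie algebra on an open interval, given by
  representatives; smoothness is asked of their classes only.\<close>

definition field :: "real set \<Rightarrow> (real \<Rightarrow> 'g formal_vec) \<Rightarrow> bool" where
  "field V x \<longleftrightarrow> open V \<and> is_interval V \<and> (\<forall>t\<in>V. x t \<in> formal_vecs D \<one>) \<and>
     smooth (interval_diffeology V) lie (\<lambda>t. tvec D \<one> (x t))"

lemma seg_mem:
  assumes "is_interval V" "t0 \<in> V" "t \<in> V" "s \<in> {0..1}"
  shows "t0 + s * (t - t0) \<in> (V :: real set)"
proof -
  have "(1 - s) *\<^sub>R t0 + s *\<^sub>R t \<in> V"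
    using assms is_interval_convex convexD_alt[of V t0 t s] by auto
  then show ?thesis by (simp add: algebra_simps)
qed

text \<open>The rescaled field is jointly smooth in the unit-interval variable and in all data, the
  ends of the segment included. Both ends vary because the connection depends on the starting time
  as well as on the time of evaluation.\<close>

lemma sol_smooth:
  assumes Z: "diffeology Z" and V: "is_interval V"
    and a: "smooth Z (interval_diffeology V) a" and b: "smooth Z (interval_diffeology V) b"
    and x: "\<And>z t. z \<in> points Z \<Longrightarrow> t \<in> V \<Longrightarrow> x z t \<in> formal_vecs D \<one>"
      "smooth (prod_diffeology Z (interval_diffeology V)) lie (\<lambda>(z, t). tvec D \<one> (x z t))"
  shows "smooth Z D (\<lambda>z. sol (x z) (a z) (b z))"
  unfolding sol_def
proof (rule Exp_eval_smooth[OF Z])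
  let ?E = "prod_diffeology Z unit_interval"
  have E: "diffeology ?E" by (intro diffeology_prod diffeology_interval Z)
  have ab: "a z \<in> V" "b z \<in> V" if "z \<in> points Z" for z
    using smooth_intoD[OF a that] smooth_intoD[OF b that] by auto
  have a': "smooth ?E real_diffeology (\<lambda>y. a (fst y))" and b': "smooth ?E real_diffeology (\<lambda>y. b (fst y))"
    by (rule smooth_compose[OF smooth_subset_D smooth_fst], rule a b)+
  have s': "smooth ?E real_diffeology snd" by (rule smooth_subset_D[OF smooth_snd])
  have d': "smooth ?E real_diffeology (\<lambda>y. b (fst y) - a (fst y))" by (rule smooth_diff[OF E b' a'])
  have "smooth ?E (interval_diffeology V) (\<lambda>y. a (fst y) + snd y * (b (fst y) - a (fst y)))"
    by (rule smooth_into_subset[OF E smooth_add[OF a' smooth_mult[OF s' d']]])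
      (use seg_mem[OF V] ab in auto)
  from smooth_compose2[OF x(2) smooth_fst this]
  have "smooth ?E lie (\<lambda>y. tvec D \<one> (x (fst y) (a (fst y) + snd y * (b (fst y) - a (fst y)))))" .
  from smooth_lie_scale[OF E d' _ this]
  have "smooth ?E lie (\<lambda>y. tvec D \<one> (seg (x (fst y)) (a (fst y)) (b (fst y)) (snd y)))"
    unfolding seg_def using x(1) seg_mem[OF V] ab by auto
  then show "smooth ?E lie (\<lambda>(z, s). tvec D \<one> (seg (x z) (a z) (b z) s))"
    by (simp add: case_prod_unfold)
qed

lemma seg_curve:
  assumes "is_interval V" "t0 \<in> V" "t \<in> V"
  shows "smooth unit_interval (interval_diffeology V) (\<lambda>s. t0 + s * (t - t0))"
  by (rule smooth_into_subset[OF diffeology_interval smooth_affine]) (use seg_mem[OF assms] in auto)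

lemma seg_smooth:
  assumes "field V x" "t0 \<in> V" "t \<in> V"
  shows "smooth unit_interval lie (\<lambda>s. tvec D \<one> (seg x t0 t s))"
  unfolding seg_def
proof (rule smooth_lie_scale[OF diffeology_interval smooth_real_const[OF diffeology_interval]])
  have V: "is_interval V" using assms(1) by (simp add: field_def)
  show "x (t0 + s * (t - t0)) \<in> formal_vecs D \<one>" if "s \<in> points unit_interval" for s
    using assms seg_mem[OF V assms(2,3), of s] that by (auto simp: field_def)
  show "smooth unit_interval lie (\<lambda>s. tvec D \<one> (x (t0 + s * (t - t0))))"
    by (rule smooth_compose[OF _ seg_curve[OF V assms(2,3)]]) (use assms(1) in \<open>simp add: field_def\<close>)
qed

lemma deriv_affine: "deriv (\<lambda>s. a + s * b) t = (b::real)"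
  by (rule DERIV_imp_deriv) (auto intro!: derivative_eq_intros)

lemma between:
  assumes "0 < s" "s < 1" "t \<noteq> (t0::real)"
  shows "min t0 t < t0 + s * (t - t0) \<and> t0 + s * (t - t0) < max t0 t"
proof -
  have eq: "t - (t0 + s * (t - t0)) = (1 - s) * (t - t0)" by (simp add: algebra_simps)
  show ?thesis
  proof (cases "t0 < t")
    case True
    then have "0 < s * (t - t0)" "0 < (1 - s) * (t - t0)" using assms by auto
    then show ?thesis using True unfolding eq[symmetric] by simp
  next
    case False
    then have "s * (t - t0) < 0" "(1 - s) * (t - t0) < 0" using assms by (auto simp: mult_less_0_iff)
    then show ?thesis using False unfolding eq[symmetric] by simp
  qed
qed

text \<open>Pulling \<open>h\<close> back along the affine parametrisation of the segment scales its
  logarithmic derivative just as \<open>seg\<close> scales the field. The equation is asked strictly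
  between the ends only, so other times, where it may not be known, do not matter.\<close>

lemma sol_unique:
  assumes x: "field V x" and t: "t0 \<in> V" "t \<in> V"
    and h: "smooth (interval_diffeology V) D h" "h t0 = \<one>"
    and LDh: "\<And>s. s \<in> V \<Longrightarrow> min t0 t < s \<Longrightarrow> s < max t0 t \<Longrightarrow> log_deriv V h s \<doteq> x s"
  shows "sol x t0 t = h t"
proof -
  have V: "open V" "is_interval V" using x by (auto simp: field_def)
  let ?f = "\<lambda>s. t0 + s * (t - t0)"
  have f: "smooth unit_interval (interval_diffeology V) ?f" by (rule seg_curve[OF V(2) t])
  have f': "smooth (interval_diffeology {0<..<1}) (interval_diffeology V) ?f" by (rule smooth_subset_mono[OF f]) auto
  have "log_deriv {0<..<1} (\<lambda>s. h (?f s)) s \<doteq> seg x t0 t s" if s: "s \<in> {0<..<1}" for s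
  proof -
    have "log_deriv {0<..<1} (\<lambda>s. h (?f s)) s \<doteq> (\<lambda>P i. (t - t0) * log_deriv V h (?f s) P i)"
      using log_deriv_chain[OF V(1) h(1) _ s f'] unfolding deriv_affine by simp
    also have "\<dots> \<doteq> (\<lambda>P i. (t - t0) * x (?f s) P i)"
    \<comment> \<open>For a degenerate segment both sides carry the factor 0.\<close>
    proof (cases "t = t0")
      case False
      have "min t0 t < ?f s" "?f s < max t0 t" using between[of s t t0] s False by auto
      moreover have "?f s \<in> V" using s by (intro seg_mem[OF V(2) t]) auto
      ultimately show ?thesis by (intro tangent_eq_scale LDh)
    qed (simp add: tangent_eq_refl)
    finally show ?thesis by (simp add: seg_def)
  qed
  from Exp_unique[OF smooth_compose[OF h(1) f] _ seg_smooth[OF x t] this, of 1]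
  show ?thesis using h(2) by (simp add: sol_def)
qed

text \<open>No time lies strictly between \<open>t0\<close> and itself, so the constant curve
  qualifies in \<open>sol_unique\<close>.\<close>

lemma sol_start: "field V x \<Longrightarrow> t0 \<in> V \<Longrightarrow> sol x t0 t0 = \<one>"
  by (rule sol_unique[of V x t0 t0 "\<lambda>_. \<one>"]) (auto intro!: smooth_D_const diffeology_interval)

text \<open>\<open>Exp\<close> receives classes, so the choice of representatives has no
  influence.\<close>

lemma sol_cong:
  assumes "is_interval V" "t0 \<in> V" "t \<in> V" "\<And>s. s \<in> V \<Longrightarrow> x s \<doteq> y s"
  shows "sol x t0 t = sol y t0 t"
proof -
  have "tvec D \<one> (seg x t0 t s) = tvec D \<one> (seg y t0 t s)" if "s \<in> {0..1}" for s
    unfolding seg_def by (intro tvec_cong tangent_eq_scale assms(4) seg_mem[OF assms(1-3) that])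
  then have "vfield (seg x t0 t) = vfield (seg y t0 t)" by auto
  then show ?thesis by (simp add: sol_def)
qed

lemma sol_curve:
  assumes "field V x" "t0 \<in> V"
  shows "smooth (interval_diffeology V) D (sol x t0)"
proof -
  have V: "is_interval V" and x: "\<And>t. t \<in> V \<Longrightarrow> x t \<in> formal_vecs D \<one>"
    "smooth (interval_diffeology V) lie (\<lambda>t. tvec D \<one> (x t))" using assms(1) by (auto simp: field_def)
  have "smooth (prod_diffeology (interval_diffeology V) (interval_diffeology V)) lie (\<lambda>y. tvec D \<one> (x (snd y)))"
    by (rule smooth_compose[OF x(2) smooth_snd])
  then show ?thesis
    using assms(2) x
    by (intro sol_smooth[OF diffeology_interval V, where a = "\<lambda>_. t0" and b = "\<lambda>t. t" and x = "\<lambda>_. x"]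
        smooth_const diffeology_interval smooth_id) (auto simp: case_prod_unfold)
qed

text \<open>Slowing the solution over the segment up to \<open>r\<close> by the factor
  \<open>l\<close> solves the equation over the shorter segment. Hence the values of
  \<open>sol\<close>, each defined by a segment of its own, are points of one curve and can be
  differentiated.\<close>

lemma sol_rescale:
  assumes x: "field V x" and t: "t0 \<in> V" "r \<in> V" and l: "l \<in> {0..1}"
  shows "Exp (vfield (seg x t0 r)) l = sol x t0 (t0 + l * (r - t0))"
\<comment> \<open>For \<open>l = 0\<close> the rescaling would send interior times to the endpoint
  0, where no equation is available.\<close>
proof (cases "l = 0")
  case True
  then show ?thesis using sol_start[OF x t(1)] Exp_solution(2)[OF seg_smooth[OF x t]] by simp
next
  case False
  then have l: "0 < l" "l \<le> 1" using l by auto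
  let ?g = "Exp (vfield (seg x t0 r))" let ?r = "t0 + l * (r - t0)"
  have V: "is_interval V" using x by (auto simp: field_def)
  have r: "?r \<in> V" using l by (intro seg_mem[OF V t]) auto
  note g = Exp_solution[OF seg_smooth[OF x t]]
  have f: "smooth unit_interval unit_interval (\<lambda>s. 0 + s * l)"
    by (rule smooth_into_subset[OF diffeology_interval smooth_affine]) (use l in \<open>auto simp: mult_le_one\<close>)
  have f': "smooth (interval_diffeology {0<..<1}) (interval_diffeology {0<..<1}) (\<lambda>s. 0 + s * l)"
  proof (rule smooth_into_subset[OF diffeology_interval smooth_affine])
    fix s assume "s \<in> points (interval_diffeology {0<..<1})"
    then have "0 < s" "s < 1" by auto
    have "s * l \<le> s" using l \<open>0 < s\<close> by (intro mult_left_le) auto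
    from order_le_less_trans[OF this \<open>s < 1\<close>] \<open>0 < s\<close> l(1) have "0 < s * l" "s * l < 1" by simp_all
    then show "0 + s * l \<in> {0<..<1}" by simp
  qed
  have g': "smooth (interval_diffeology {0<..<1}) D ?g" by (rule smooth_subset_mono[OF g(1)]) auto
  have "log_deriv {0<..<1} (\<lambda>s. ?g (0 + s * l)) s \<doteq> seg x t0 ?r s" if s: "s \<in> {0<..<1}" for s
  proof -
    have sl: "0 + s * l \<in> {0<..<1}" using smooth_intoD[OF f', of s] s by auto
    have "log_deriv {0<..<1} (\<lambda>s. ?g (0 + s * l)) s \<doteq> (\<lambda>P i. l * log_deriv {0<..<1} ?g (0 + s * l) P i)"
      using log_deriv_chain[OF _ g' _ s f'] unfolding deriv_affine by simp
    also have "\<dots> \<doteq> (\<lambda>P i. l * seg x t0 r (0 + s * l) P i)"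
      by (rule tangent_eq_scale[OF g(3)[OF sl]])
    finally show ?thesis by (simp add: seg_def mult.assoc)
  qed
  from Exp_unique[OF smooth_compose[OF g(1) f] _ seg_smooth[OF x t(1) r] this, of 1]
  show ?thesis using g(2) by (simp add: sol_def)
qed

text \<open>The point \<open>r\<close> overshoots \<open>t\<close>, seen from \<open>t0\<close>, so
  that \<open>t\<close> becomes an interior time of the segment from \<open>t0\<close> to
  \<open>r\<close>.\<close>

lemma open_interval_between:
  assumes "open V" "t \<in> V" "t \<noteq> (t0::real)"
  shows "\<exists>r\<in>V. \<exists>l. 0 < l \<and> l < 1 \<and> t = t0 + l * (r - t0) \<and> r \<noteq> t0"
proof -
  obtain e where e: "e > 0" "\<And>y. \<bar>y - t\<bar> < e \<Longrightarrow> y \<in> V"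
    using assms(1,2) unfolding open_dist dist_real_def by blast
  \<comment> \<open>This makes the overshoot equal to half the radius \<open>e\<close>.\<close>
  define d where "d = e / (2 * \<bar>t - t0\<bar>)"
  have d: "d > 0" using e(1) assms(3) by (simp add: d_def)
  let ?r = "t + d * (t - t0)"
  have "\<bar>?r - t\<bar> = e / 2" using e(1) assms(3) by (simp add: d_def abs_mult)
  then have "?r \<in> V" using e by simp
  moreover have "?r - t0 = (1 + d) * (t - t0)" by (simp add: algebra_simps)
  ultimately show ?thesis using d assms(3)
    by (intro bexI[of _ ?r] exI[of _ "1 / (1 + d)"]) (auto simp: add_pos_pos)
qed

text \<open>Near \<open>t\<close> the solution is the single curve given by \<open>Exp\<close> over
  the longer segment, run at speed \<open>k = 1 / (r - t0)\<close>. The factor \<open>k\<close> from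
  the chain rule cancels the factor \<open>r - t0\<close> in \<open>seg\<close>.\<close>

lemma log_deriv_sol_away:
  assumes x: "field V x" and t: "t0 \<in> V" "t \<in> V" "t \<noteq> t0"
  shows "log_deriv V (sol x t0) t \<doteq> x t"
proof -
  have V: "open V" "is_interval V" using x by (auto simp: field_def)
  obtain r l where r: "r \<in> V" "r \<noteq> t0" and l: "0 < l" "l < 1" "t = t0 + l * (r - t0)"
    using open_interval_between[OF V(1) t(2,3)] by blast
  let ?g = "Exp (vfield (seg x t0 r))"
  define k where "k = 1 / (r - t0)"
  have k: "k * (r - t0) = 1" using r(2) by (simp add: k_def)
  let ?f = "\<lambda>s. - t0 * k + s * k"
  note g = Exp_solution[OF seg_smooth[OF x t(1) r(1)]]
  have g': "smooth (interval_diffeology {0<..<1}) D ?g" by (rule smooth_subset_mono[OF g(1)]) auto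
  define S where "S = ?f -` {0<..<1}"
  have S: "open S" unfolding S_def by (intro open_vimage continuous_intros open_greaterThanLessThan)
  have inv: "t0 + ?f s * (r - t0) = s" for s using k by algebra
  have ft: "?f t = l" using l(3) k by algebra
  have tS: "t \<in> S" using ft l by (simp add: S_def)
  have SV: "S \<subseteq> V"
  proof
    fix s assume "s \<in> S"
    then have "?f s \<in> {0..1}" by (auto simp: S_def)
    from seg_mem[OF V(2) t(1) r(1) this] show "s \<in> V" by (simp only: inv)
  qed
  have f: "smooth (interval_diffeology S) (interval_diffeology {0<..<1}) ?f"
    by (rule smooth_into_subset[OF diffeology_interval smooth_affine]) (auto simp: S_def)
  have eq: "sol x t0 s = ?g (?f s)" if "s \<in> S" for s
  proof -
    have "?f s \<in> {0..1}" using that by (auto simp: S_def)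
    from sol_rescale[OF x t(1) r(1) this] show ?thesis by (simp only: inv)
  qed
  have "log_deriv V (sol x t0) t \<doteq> log_deriv S (sol x t0) t"
    by (rule tangent_eq_sym[OF log_deriv_cong[OF V(1) sol_curve[OF x t(1)] S tS SV]]) simp
  also have "\<dots> \<doteq> (\<lambda>P i. k * log_deriv {0<..<1} ?g (?f t) P i)"
    by (rule log_deriv_chain[OF open_greaterThanLessThan g' S tS f eq, unfolded deriv_affine])
  also have "\<dots> \<doteq> (\<lambda>P i. k * seg x t0 r l P i)"
    unfolding ft using g(3)[of l] l by (intro tangent_eq_scale) auto
  also have "(\<lambda>P i. k * seg x t0 r l P i) = x t"
    unfolding seg_def l(3)[symmetric] mult.assoc[symmetric] k by simp
  finally show ?thesis .
qed

text \<open>The regularity hypothesis says nothing about the derivative at the endpoint \<open>t0\<close> of the segment, so the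
  solution is compared with the one started at an earlier point.\<close>

lemma log_deriv_sol:
  assumes x: "field V x" and t: "t0 \<in> V" "t \<in> V"
  shows "log_deriv V (sol x t0) t \<doteq> x t"
proof -
  have V: "open V" "is_interval V" using x by (auto simp: field_def)
  obtain t1 where t1: "t1 \<in> V" "t1 < t0" "t1 < t"
  proof -
    have "min t0 t \<in> V" using t by (simp add: min_def)
    then obtain e where "e > 0" "\<And>y. \<bar>y - min t0 t\<bar> < e \<Longrightarrow> y \<in> V"
      using V(1) unfolding open_dist dist_real_def by blast
    then show ?thesis using that[of "min t0 t - e / 2"] by (smt (verit) field_sum_of_halves)
  qed
  let ?c = "inv (sol x t1 t0)"
  have K: "smooth (interval_diffeology V) D (sol x t1)" by (rule sol_curve[OF x t1(1)])
  have c: "?c \<in> carrier G" and c0: "sol x t1 t0 \<in> carrier G" using curve_carrier[OF K t(1)] by auto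
  \<comment> \<open>Right translation normalises the earlier solution at \<open>t0\<close> and keeps
    its logarithmic derivative.\<close>
  let ?h = "\<lambda>s. sol x t1 s \<otimes> ?c"
  have h: "smooth (interval_diffeology V) D ?h" by (intro smooth_times K smooth_D_const diffeology_interval c)
  have LDh: "log_deriv V ?h s \<doteq> x s" if "s \<in> V" "s \<noteq> t1" for s
    using tangent_eq_trans[OF log_deriv_right[OF V(1) that(1) K c] log_deriv_sol_away[OF x t1(1) that]] by simp
  have eq: "sol x t0 s = ?h s" if "s \<in> V" "t1 < s" for s
    by (rule sol_unique[OF x t(1) that(1) h]) (use c0 t1(2) that LDh in auto)
  have S: "open (V \<inter> {t1<..})" "t \<in> V \<inter> {t1<..}" using V(1) t t1 by auto
  have "log_deriv V (sol x t0) t \<doteq> log_deriv (V \<inter> {t1<..}) (sol x t0) t"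
    by (rule tangent_eq_sym[OF log_deriv_cong[OF V(1) sol_curve[OF x t(1)] S]]) auto
  also have "\<dots> \<doteq> log_deriv V ?h t"
    by (rule log_deriv_cong[OF V(1) h S]) (use eq in auto)
  also have "\<dots> \<doteq> x t" using LDh t(2) t1(3) by blast
  finally show ?thesis .
qed

text \<open>Uniqueness for the zero field takes the place of the mean value theorem: after
  normalisation at \<open>t0\<close>, \<open>h\<close> and the constant curve solve the same
  equation.\<close>

lemma log_deriv_zero_imp_const:
  assumes V: "open V" "is_interval V" "t0 \<in> V" "t \<in> V" and h: "smooth (interval_diffeology V) D h"
    and LDh: "\<And>s. s \<in> V \<Longrightarrow> log_deriv V h s \<doteq> (\<lambda>P i. 0)"
  shows "h t = h t0"
proof -
  have x: "field V (\<lambda>t P i. 0)"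
    using V by (auto simp: field_def formal_vecs_zero smooth_lie_zero[OF diffeology_interval])
  have car: "h t \<in> carrier G" "h t0 \<in> carrier G" using curve_carrier[OF h] V by auto
  let ?h = "\<lambda>s. h s \<otimes> inv (h t0)"
  have h': "smooth (interval_diffeology V) D ?h"
    by (intro smooth_times h smooth_D_const diffeology_interval inv_closed car)
  have "log_deriv V ?h s \<doteq> (\<lambda>P i. 0)" if "s \<in> V" for s
    using tangent_eq_trans[OF log_deriv_right[OF V(1) that h inv_closed[OF car(2)]] LDh[OF that]] by simp
  then have "sol (\<lambda>t P i. 0) t0 t = ?h t"
    by (intro sol_unique[OF x V(3,4) h']) (use car in auto)
  moreover have "sol (\<lambda>t P i. 0) t0 t = \<one>"
    using sol_unique[OF x V(3,4), of "\<lambda>_. \<one>"] log_deriv_const[OF V(1) _ one_closed]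
    by (simp add: smooth_D_const[OF diffeology_interval])
  ultimately have "h t \<otimes> inv (h t0) = \<one>" by simp
  then show ?thesis using car by (metis inv_closed inv_inv inv_equality)
qed

end

section \<open>Principal bundles\<close>

text \<open>A plot into \<open>Z\<close> times the line lands in \<open>Z\<close> times
  \<open>V\<close> on an open part of its domain. This passes from families over \<open>V\<close> to
  the setting of \<open>log_deriv_smooth\<close>, where time runs through the whole line.\<close>

lemma openin_D_prod_interval:
  assumes Z: "diffeology Z" and V: "open V"
    and B: "openin (D_topology (prod_diffeology Z (interval_diffeology V))) B"
  shows "openin (D_topology (prod_diffeology Z real_diffeology)) B"
proof -
  let ?ZR = "prod_diffeology Z real_diffeology" let ?ZV = "prod_diffeology Z (interval_diffeology V)"
  have ZR: "diffeology ?ZR" and ZV: "diffeology ?ZV"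
    by (intro diffeology_prod Z diffeology_real diffeology_interval)+
  have BV: "B \<subseteq> points Z \<times> V" using openin_subset[OF B] topspace_D_topology[OF ZV] by simp
  have "opn n {u \<in> U. p u \<in> B}" if p: "plot ?ZR n U p" for n U p
  proof -
    let ?U = "{u \<in> U. snd (p u) \<in> V}"
    have U: "opn n ?U" using openin_D_plot[OF diffeology_real openin_D_real[OF V] smooth_plotD[OF smooth_snd p]] .
    have "plot ?ZR n ?U p" by (rule plot_restrict[OF ZR p U]) auto
    then have "plot ?ZV n ?U p" by (auto simp: plot_prod plot_subset)
    from openin_D_plot[OF ZV B this] have "opn n {u \<in> ?U. p u \<in> B}" .
    moreover have "{u \<in> ?U. p u \<in> B} = {u \<in> U. p u \<in> B}" using BV by auto
    ultimately show ?thesis by simp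
  qed
  then show ?thesis using BV by (auto simp: openin_D_topology[OF ZR])
qed

text \<open>The trivialisation need not respect the group action. Only a section with constant fibre
  coordinate is taken from it; equivariant coordinates relative to that section then come from the
  principal structure.\<close>

lemma trivial_over_section:
  assumes E: "diffeology E" and X: "diffeology X" and surj: "\<pi> ` points E = points X"
    and U: "U \<subseteq> points X" and triv: "trivial_over E X \<pi> U"
  shows "\<exists>s. smooth (subset_diffeology X U) E s \<and> (\<forall>x\<in>U. \<pi> (s x) = x)"
proof (cases "U = {}")
  case True
  \<comment> \<open>Over the empty set there may be no fibre point to choose, but the plots of the
    empty subspace have empty domains.\<close>
  have "smooth (subset_diffeology X {}) E s" for s
  proof (rule smoothI)
    show "plot E n V (\<lambda>x. s (p x))" if "plot (subset_diffeology X {}) n V p" for n V p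
      using that plot_openD[OF X] by (intro plot_local[OF E]) (auto simp: plot_subset)
  qed simp
  then show ?thesis using True by blast
next
  case False
  let ?EU = "restrict_total E \<pi> U" let ?XU = "subset_diffeology X U"
  obtain F :: "'a diffeological_space" and \<Phi> where F: "diffeology F"
    and \<Phi>: "diffeomorphism ?EU (prod_diffeology ?XU F) \<Phi>" "\<And>e. e \<in> points ?EU \<Longrightarrow> fst (\<Phi> e) = \<pi> e"
    using triv unfolding trivial_over_def trivial_bundle_def by metis
  have EU: "points ?EU = points E \<inter> {e. \<pi> e \<in> U}" by (simp add: restrict_total_def)
  obtain x where x: "x \<in> U" using False by blast
  then have "x \<in> \<pi> ` points E" using U unfolding surj by blast
  then obtain e where "e \<in> points ?EU" using x unfolding EU by auto
  then obtain f0 where f0: "f0 \<in> points F"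
    using \<Phi>(1) smooth_intoD[of ?EU "prod_diffeology ?XU F" \<Phi> e] unfolding diffeomorphism_def by auto
  let ?\<Psi> = "inv_into (points ?EU) \<Phi>"
  let ?s = "\<lambda>x. ?\<Psi> (x, f0)"
  have "smooth ?XU (prod_diffeology ?XU F) (\<lambda>x. (x, f0))"
    by (intro smooth_Pair smooth_id smooth_const diffeology_subset X F f0)
  then have "smooth ?XU ?EU ?s"
    using smooth_compose \<Phi>(1) unfolding diffeomorphism_def by blast
  then have "smooth ?XU E ?s" unfolding restrict_total_def by (rule smooth_subset_D)
  moreover have "\<pi> (?s x) = x" if "x \<in> U" for x
  proof -
    have im: "\<Phi> ` points ?EU = points (prod_diffeology ?XU F)"
      using \<Phi>(1) unfolding diffeomorphism_def bij_betw_def by blast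
    have x: "(x, f0) \<in> \<Phi> ` points ?EU" unfolding im using that U f0 by auto
    then show ?thesis using \<Phi>(2)[OF inv_into_into[OF x]] f_inv_into_f[OF x] by simp
  qed
  ultimately show ?thesis by blast
qed

section \<open>Fibres of a principal bundle and division in them\<close>

locale principal = dgroup G D for G :: "'g monoid" (structure) and D :: "'g diffeological_space" +
  fixes act :: "'g \<Rightarrow> 'e \<Rightarrow> 'e" and E :: "'e diffeological_space" and X :: "'x diffeological_space"
    and \<pi> :: "'e \<Rightarrow> 'x"
  assumes principal_bundle: "principal_bundle G D act E X \<pi>"
begin

lemma diffeology_E: "diffeology E" and diffeology_X: "diffeology X"
  and smooth_\<pi>: "smooth E X \<pi>"
  using principal_bundle by (auto simp: principal_bundle_def diffeological_fibre_bundle_def)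

lemma group_action: "group_action G (points E) act"
  using principal_bundle by (auto simp: principal_bundle_def smooth_action_def)

lemma act_closed: "g \<in> carrier G \<Longrightarrow> e \<in> points E \<Longrightarrow> act g e \<in> points E"
  using group_action.element_image[OF group_action] by blast

lemma act_mult: "g \<in> carrier G \<Longrightarrow> h \<in> carrier G \<Longrightarrow> e \<in> points E \<Longrightarrow> act (g \<otimes> h) e = act g (act h e)"
  using group_action.composition_rule[OF group_action] by blast

lemma act_one [simp]: "e \<in> points E \<Longrightarrow> act \<one> e = e"
  using group_action.id_eq_one[OF group_action] by (metis restrict_apply')

lemma smooth_act:
  assumes "smooth Z D g" "smooth Z E e"
  shows "smooth Z E (\<lambda>z. act (g z) (e z))"
  by (rule smooth_compose2[OF _ assms])
    (use principal_bundle in \<open>simp add: principal_bundle_def smooth_action_def\<close>)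

lemma local_trivialisation:
  assumes "plot X n U p" "u \<in> U"
  obtains V q where "opn n V" "u \<in> V" "V \<subseteq> U" "plot E n V q" "\<And>v. v \<in> V \<Longrightarrow> \<pi> (q v) = p v"
    "diffeomorphism (prod_diffeology (eucl_diffeology n V) D)
       (pullback (eucl_diffeology n V) p E \<pi>) (\<lambda>(v, g). (v, act g (q v)))"
proof -
  have "\<exists>V q. opn n V \<and> u \<in> V \<and> V \<subseteq> U \<and> plot E n V q \<and> (\<forall>v\<in>V. \<pi> (q v) = p v) \<and>
      diffeomorphism (prod_diffeology (eucl_diffeology n V) D)
        (pullback (eucl_diffeology n V) p E \<pi>) (\<lambda>(v, g). (v, act g (q v)))"
    using principal_bundle[unfolded principal_bundle_def Let_def, THEN conjunct2, THEN conjunct2, THEN conjunct2,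
        rule_format, OF assms] by (elim exE conjE) (intro exI conjI)
  then show ?thesis using that by (elim exE conjE) blast
qed

lemma points_pullback: "points (pullback Y f E \<pi>) = {(y, e). y \<in> points Y \<and> e \<in> points E \<and> f y = \<pi> e}"
  by (auto simp: pullback_def)

text \<open>The defining condition concerns plots; for the constant plot on the one-point space
  \<open>Rn 0\<close> it says that the fibre over \<open>x\<close> is a free orbit.\<close>

lemma fibre:
  assumes x: "x \<in> points X"
  obtains y where "y \<in> points E" "\<pi> y = x"
    "bij_betw (\<lambda>g. act g y) (carrier G) {e \<in> points E. \<pi> e = x}"
proof -
  have p: "plot X 0 (Rn 0) (\<lambda>_. x)" by (rule plot_const[OF diffeology_X opn_Rn x])
  have 0: "zero_vec \<in> Rn 0" by (simp add: Rn_iff)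
  obtain V q where V: "opn 0 V" "zero_vec \<in> V" and q: "plot E 0 V q" "\<And>v. v \<in> V \<Longrightarrow> \<pi> (q v) = x"
    and d: "diffeomorphism (prod_diffeology (eucl_diffeology 0 V) D)
       (pullback (eucl_diffeology 0 V) (\<lambda>_. x) E \<pi>) (\<lambda>(v, g). (v, act g (q v)))"
    by (rule local_trivialisation[OF p 0]) (rule that)
  have b: "bij_betw (\<lambda>(v, g). (v, act g (q v))) (V \<times> carrier G) {(v, e). v \<in> V \<and> e \<in> points E \<and> x = \<pi> e}"
    using d unfolding diffeomorphism_def points_pullback by simp
  have "inj_on (\<lambda>g. act g (q zero_vec)) (carrier G)"
    using bij_betw_imp_inj_on[OF b] V(2) by (auto simp: inj_on_def)
  moreover have "(\<lambda>g. act g (q zero_vec)) ` carrier G = {e \<in> points E. \<pi> e = x}"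
  proof (intro equalityI subsetI)
    fix e assume "e \<in> (\<lambda>g. act g (q zero_vec)) ` carrier G"
    then obtain g where g: "g \<in> carrier G" "e = act g (q zero_vec)" by blast
    then have "(zero_vec, e) \<in> (\<lambda>(v, g). (v, act g (q v))) ` (V \<times> carrier G)"
      using V(2) by (auto intro!: image_eqI[of _ _ "(zero_vec, g)"])
    then show "e \<in> {e \<in> points E. \<pi> e = x}" unfolding bij_betw_imp_surj_on[OF b] by auto
  next
    fix e assume "e \<in> {e \<in> points E. \<pi> e = x}"
    then have "(zero_vec, e) \<in> (\<lambda>(v, g). (v, act g (q v))) ` (V \<times> carrier G)"
      unfolding bij_betw_imp_surj_on[OF b] using V(2) by auto
    then show "e \<in> (\<lambda>g. act g (q zero_vec)) ` carrier G" by auto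
  qed
  moreover have "q zero_vec \<in> points E" using plot_intoD[OF diffeology_E q(1)] V(2) by blast
  ultimately show ?thesis using that q(2)[OF V(2)] by (simp add: bij_betw_def)
qed

lemma \<pi>_points: "e \<in> points E \<Longrightarrow> \<pi> e \<in> points X"
  by (rule smooth_intoD[OF smooth_\<pi>])

text \<open>Invariance of the projection is not an explicit axiom. It follows because a fibre is the
  whole orbit of one of its points.\<close>

lemma \<pi>_act:
  assumes "g \<in> carrier G" "e \<in> points E"
  shows "\<pi> (act g e) = \<pi> e"
proof -
  obtain y where y: "y \<in> points E" "bij_betw (\<lambda>g. act g y) (carrier G) {e' \<in> points E. \<pi> e' = \<pi> e}"
    using fibre[OF \<pi>_points[OF assms(2)]] by metis
  then obtain h where h: "h \<in> carrier G" "e = act h y"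
    using assms(2) bij_betw_imp_surj_on[OF y(2)] by blast
  have "act (g \<otimes> h) y \<in> {e' \<in> points E. \<pi> e' = \<pi> e}"
    using bij_betw_imp_surj_on[OF y(2)] m_closed[OF assms(1) h(1)] by blast
  then show ?thesis using h assms y by (simp add: act_mult)
qed

lemma act_regular:
  assumes "e \<in> points E" "e' \<in> points E" "\<pi> e = \<pi> e'"
  shows "\<exists>!g. g \<in> carrier G \<and> act g e' = e"
proof -
  obtain y where y: "y \<in> points E" "bij_betw (\<lambda>g. act g y) (carrier G) {e'' \<in> points E. \<pi> e'' = \<pi> e}"
    using fibre[OF \<pi>_points[OF assms(1)]] by metis
  note surj = bij_betw_imp_surj_on[OF y(2)] and inj = bij_betw_imp_inj_on[OF y(2)]
  obtain h h' where h: "h \<in> carrier G" "e = act h y" "h' \<in> carrier G" "e' = act h' y"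
  proof -
    have "e \<in> (\<lambda>g. act g y) ` carrier G" "e' \<in> (\<lambda>g. act g y) ` carrier G"
      unfolding surj using assms by auto
    then show ?thesis using that by blast
  qed
  show ?thesis
  proof (rule ex1I[of _ "h \<otimes> inv h'"])
    show "h \<otimes> inv h' \<in> carrier G \<and> act (h \<otimes> inv h') e' = e"
      using h y by (simp flip: act_mult add: m_assoc)
    fix g assume g: "g \<in> carrier G \<and> act g e' = e"
    then have "act (g \<otimes> h') y = act h y" using h y by (simp add: act_mult)
    then have "g \<otimes> h' = h" using inj g h by (auto dest: inj_onD)
    then show "g = h \<otimes> inv h'" using g h by (metis inv_solve_right)
  qed
qed

text \<open>The division map of the principal bundle, meaningful for two points of one
  fibre.\<close>

definition fibre_quotient :: "'e \<Rightarrow> 'e \<Rightarrow> 'g" where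
  "fibre_quotient e e' = (THE g. g \<in> carrier G \<and> act g e' = e)"

lemma fibre_quotient_props:
  assumes "e \<in> points E" "e' \<in> points E" "\<pi> e = \<pi> e'"
  shows "fibre_quotient e e' \<in> carrier G" "act (fibre_quotient e e') e' = e"
  using theI'[OF act_regular[OF assms]] by (auto simp: fibre_quotient_def)

lemma fibre_quotient_eq:
  assumes "e' \<in> points E" "g \<in> carrier G" "act g e' = e"
  shows "fibre_quotient e e' = g"
  unfolding fibre_quotient_def
  by (rule the1_equality[OF act_regular]) (use assms act_closed \<pi>_act in auto)

lemma fibre_quotient_act:
  assumes "e \<in> points E" "e' \<in> points E" "\<pi> e = \<pi> e'" "a \<in> carrier G"
  shows "fibre_quotient (act a e) e' = a \<otimes> fibre_quotient e e'"
  by (rule fibre_quotient_eq) (use assms fibre_quotient_props[OF assms(1-3)] in \<open>auto simp: act_mult\<close>)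

text \<open>Along a plot there is a local lift \<open>q\<close>, and the inverse trivialisation
  makes the coordinates of \<open>a\<close> and \<open>b\<close> relative to \<open>q\<close>
  smooth. The quotient is the first coordinate times the inverse of the second.\<close>

lemma smooth_fibre_quotient:
  assumes Z: "diffeology Z" and a: "smooth Z E a" and b: "smooth Z E b"
    and eq: "\<And>z. z \<in> points Z \<Longrightarrow> \<pi> (a z) = \<pi> (b z)"
  shows "smooth Z D (\<lambda>z. fibre_quotient (a z) (b z))"
proof (rule smoothI)
  have aE: "a z \<in> points E" and bE: "b z \<in> points E" if "z \<in> points Z" for z
    using smooth_intoD[OF a that] smooth_intoD[OF b that] by auto
  show "fibre_quotient (a z) (b z) \<in> points D" if "z \<in> points Z" for z
    using fibre_quotient_props(1)[OF aE bE eq] that by simp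
  fix n U p assume p: "plot Z n U p"
  have U: "opn n U" and pZ: "\<And>u. u \<in> U \<Longrightarrow> p u \<in> points Z"
    using plot_openD[OF Z p] plot_intoD[OF Z p] by auto
  let ?x = "\<lambda>u. \<pi> (b (p u))"
  have x: "plot X n U ?x" by (rule smooth_plotD[OF smooth_\<pi> smooth_plotD[OF b p]])
  show "plot D n U (\<lambda>u. fibre_quotient (a (p u)) (b (p u)))"
  proof (rule plot_local[OF diffeology_D U])
    fix u assume u: "u \<in> U"
    obtain V q where V: "opn n V" "u \<in> V" "V \<subseteq> U" and q: "plot E n V q" "\<And>v. v \<in> V \<Longrightarrow> \<pi> (q v) = ?x v"
      and d: "diffeomorphism (prod_diffeology (eucl_diffeology n V) D)
         (pullback (eucl_diffeology n V) ?x E \<pi>) (\<lambda>(v, g). (v, act g (q v)))"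
      by (rule local_trivialisation[OF x u]) (rule that)
    let ?P = "pullback (eucl_diffeology n V) ?x E \<pi>"
    have qE: "q v \<in> points E" if "v \<in> V" for v using plot_intoD[OF diffeology_E q(1)] that by blast
    let ?\<Psi> = "\<lambda>(v, g). (v, act g (q v))"
    let ?inv = "inv_into (V \<times> carrier G) ?\<Psi>"
    have inv: "smooth ?P (prod_diffeology (eucl_diffeology n V) D) ?inv"
      and bij: "bij_betw ?\<Psi> (V \<times> carrier G) (points ?P)"
      using d unfolding diffeomorphism_def by simp_all
    have coord: "plot D n V (\<lambda>v. fibre_quotient (c (p v)) (q v))"
      if c: "smooth Z E c" "\<And>v. v \<in> V \<Longrightarrow> \<pi> (c (p v)) = ?x v" for c
    proof -
      have cE: "c (p v) \<in> points E" if "v \<in> V" for v using smooth_intoD[OF c(1)] pZ that V(3) by blast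
      have "plot E n V (\<lambda>v. c (p v))"
        by (rule plot_restrict[OF diffeology_E smooth_plotD[OF c(1) p] V(1,3)])
      then have "plot ?P n V (\<lambda>v. (v, c (p v)))"
        using c(2) V(1) smooth_eucl_incl[OF V(1) subset_refl]
        unfolding pullback_def plot_subset plot_prod plot_eucl by auto
      from smooth_plotD[OF smooth_snd smooth_plotD[OF inv this]]
      show ?thesis
      proof (rule plot_cong[OF diffeology_D])
        fix v assume v: "v \<in> V"
        have "(v, c (p v)) \<in> points ?P" unfolding points_pullback using v cE[OF v] c(2)[OF v] by simp
        then have mem: "(v, c (p v)) \<in> ?\<Psi> ` (V \<times> carrier G)" using bij_betw_imp_surj_on[OF bij] by simp
        obtain v' g where vg: "?inv (v, c (p v)) = (v', g)" by fastforce
        have "(v', g) \<in> V \<times> carrier G" "?\<Psi> (v', g) = (v, c (p v))"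
          using inv_into_into[OF mem] f_inv_into_f[OF mem] unfolding vg by auto
        then show "fibre_quotient (c (p v)) (q v) = snd (?inv (v, c (p v)))"
          unfolding vg using fibre_quotient_eq[OF qE[OF v]] by auto
      qed
    qed
    have ab: "plot D n V (\<lambda>v. fibre_quotient (a (p v)) (q v))" "plot D n V (\<lambda>v. fibre_quotient (b (p v)) (q v))"
      using coord[OF a] coord[OF b] eq pZ V(3) by blast+
    then have "smooth (eucl_diffeology n V) D (\<lambda>v. fibre_quotient (a (p v)) (q v))" "smooth (eucl_diffeology n V) D (\<lambda>v. fibre_quotient (b (p v)) (q v))"
      using plot_iff_smooth[OF diffeology_D] by blast+
    from smooth_times[OF this(1) smooth_inverse[OF this(2)]] V(1)
    have "plot D n V (\<lambda>v. fibre_quotient (a (p v)) (q v) \<otimes> inv (fibre_quotient (b (p v)) (q v)))"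
      using plot_iff_smooth[OF diffeology_D] by blast
    then have "plot D n V (\<lambda>v. fibre_quotient (a (p v)) (b (p v)))"
    proof (rule plot_cong[OF diffeology_D])
      fix v assume v: "v \<in> V"
      then have z: "p v \<in> points Z" using pZ V(3) by blast
      note A = fibre_quotient_props[OF aE[OF z] qE[OF v]] and B = fibre_quotient_props[OF bE[OF z] qE[OF v]]
      have pe: "\<pi> (a (p v)) = \<pi> (q v)" "\<pi> (b (p v)) = \<pi> (q v)" using q(2)[OF v] eq[OF z] by auto
      let ?\<beta> = "fibre_quotient (b (p v)) (q v)"
      have "act (inv ?\<beta>) (b (p v)) = act (inv ?\<beta>) (act ?\<beta> (q v))" using B(2)[OF pe(2)] by simp
      also have "\<dots> = q v" using act_mult[of "inv ?\<beta>" ?\<beta> "q v"] B(1)[OF pe(2)] qE[OF v] by simp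
      finally have "act (fibre_quotient (a (p v)) (q v) \<otimes> inv ?\<beta>) (b (p v)) = a (p v)"
        using A[OF pe(1)] B(1)[OF pe(2)] bE[OF z] by (simp add: act_mult)
      then show "fibre_quotient (a (p v)) (b (p v)) = fibre_quotient (a (p v)) (q v) \<otimes> inv ?\<beta>"
        using A(1)[OF pe(1)] B(1)[OF pe(2)] by (intro fibre_quotient_eq bE[OF z]) auto
    qed
    then show "\<exists>V. opn n V \<and> u \<in> V \<and> V \<subseteq> U \<and> plot D n V (\<lambda>u. fibre_quotient (a (p u)) (b (p u)))"
      using V by blast
  qed
qed

end

section \<open>The averaged logarithmic derivative\<close>

locale partitioned = regular_dgroup G D Exp + principal G D act E X \<pi>
  for G :: "'g monoid" (structure) and D :: "'g diffeological_space"
    and Exp :: "(real \<Rightarrow> 'g tangent) \<Rightarrow> real \<Rightarrow> 'g"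
    and act :: "'g \<Rightarrow> 'e \<Rightarrow> 'e" and E :: "'e diffeological_space" and X :: "'x diffeological_space"
    and \<pi> :: "'e \<Rightarrow> 'x" +
  fixes \<U> :: "'x set set" and sec :: "'x set \<Rightarrow> 'x \<Rightarrow> 'e" and \<rho> :: "'x set \<Rightarrow> 'x \<Rightarrow> real"
  assumes cover_open: "U \<in> \<U> \<Longrightarrow> openin (D_topology X) U"
    and sec_smooth: "U \<in> \<U> \<Longrightarrow> smooth (subset_diffeology X U) E (sec U)"
    and \<pi>_sec: "U \<in> \<U> \<Longrightarrow> x \<in> U \<Longrightarrow> \<pi> (sec U x) = x"
    and partition: "subordinate_partition X \<U> \<rho>"
begin

definition supp :: "'x \<Rightarrow> 'x set set" where "supp x = {U \<in> \<U>. \<rho> U x \<noteq> 0}"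

lemma partition_smooth: "U \<in> \<U> \<Longrightarrow> smooth X real_diffeology (\<rho> U)"
  using partition smooth_subset_D unfolding subordinate_partition_def by blast

lemma partition_sum: "x \<in> points X \<Longrightarrow> (\<Sum>U\<in>supp x. \<rho> U x) = 1"
  using partition unfolding subordinate_partition_def supp_def by blast

lemma partition_locally_finite:
  assumes "x \<in> points X"
  obtains N where "openin (D_topology X) N" "x \<in> N" "finite {U \<in> \<U>. \<exists>y\<in>N. \<rho> U y \<noteq> 0}"
  using assms partition unfolding subordinate_partition_def by blast

abbreviation clsupp :: "'x set \<Rightarrow> 'x set" where
  "clsupp U \<equiv> Abstract_Topology.closure_of (D_topology X) {x \<in> points X. \<rho> U x \<noteq> 0}"

lemma clsupp: "U \<in> \<U> \<Longrightarrow> clsupp U \<subseteq> U" "x \<in> points X \<Longrightarrow> \<rho> U x \<noteq> 0 \<Longrightarrow> x \<in> clsupp U"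
proof -
  show "clsupp U \<subseteq> U" if "U \<in> \<U>"
    using partition that unfolding subordinate_partition_def by blast
  have "{x \<in> points X. \<rho> U x \<noteq> 0} \<subseteq> clsupp U"
    by (rule closure_of_subset) (auto simp: topspace_D_topology[OF diffeology_X])
  then show "x \<in> points X \<Longrightarrow> \<rho> U x \<noteq> 0 \<Longrightarrow> x \<in> clsupp U" by blast
qed

lemma supp_mem: "x \<in> points X \<Longrightarrow> U \<in> supp x \<Longrightarrow> U \<in> \<U> \<and> x \<in> U"
  using clsupp by (auto simp: supp_def)

definition coord :: "'x set \<Rightarrow> (real \<Rightarrow> 'e) \<Rightarrow> real \<Rightarrow> 'g" where
  "coord U \<gamma> t = fibre_quotient (\<gamma> t) (sec U (\<pi> (\<gamma> t)))"

text \<open>This can consist of several intervals, as a path may leave \<open>U\<close> and return;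
  hence \<open>log_deriv\<close> is set up for arbitrary open sets.\<close>

definition part :: "real set \<Rightarrow> (real \<Rightarrow> 'e) \<Rightarrow> 'x set \<Rightarrow> real set" where
  "part I \<gamma> U = {t \<in> I. \<pi> (\<gamma> t) \<in> U}"

text \<open>The average of the flat connection forms given by the local sections, evaluated on the velocity of
  \<open>\<gamma>\<close>: in the trivialisation by \<open>sec U\<close> the path \<open>\<gamma>\<close> is the curve \<open>coord U \<gamma>\<close> in \<open>G\<close>.\<close>

definition mean_log_deriv :: "real set \<Rightarrow> (real \<Rightarrow> 'e) \<Rightarrow> real \<Rightarrow> 'g formal_vec" where
  "mean_log_deriv I \<gamma> t = (\<lambda>P i. \<Sum>U\<in>supp (\<pi> (\<gamma> t)). \<rho> U (\<pi> (\<gamma> t)) * log_deriv (part I \<gamma> U) (coord U \<gamma>) t P i)"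

definition path :: "real set \<Rightarrow> (real \<Rightarrow> 'e) \<Rightarrow> bool" where
  "path I \<gamma> \<longleftrightarrow> open I \<and> smooth (interval_diffeology I) E \<gamma>"

lemma path_points: "path I \<gamma> \<Longrightarrow> t \<in> I \<Longrightarrow> \<gamma> t \<in> points E"
  using smooth_intoD[of "interval_diffeology I" E \<gamma> t] by (simp add: path_def)

lemma path_part:
  assumes \<gamma>: "path I \<gamma>" and U: "U \<in> \<U>"
  shows "open (part I \<gamma> U)" "smooth (interval_diffeology (part I \<gamma> U)) D (coord U \<gamma>)" "part I \<gamma> U \<subseteq> I"
proof -
  have I: "open I" and s: "smooth (interval_diffeology I) E \<gamma>" using \<gamma> by (auto simp: path_def)
  have sx: "smooth (interval_diffeology I) X (\<lambda>t. \<pi> (\<gamma> t))" by (rule smooth_compose[OF smooth_\<pi> s])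
  show "open (part I \<gamma> U)" unfolding part_def
    by (rule open_curve_preimage[OF diffeology_X I sx cover_open[OF U]])
  show sub: "part I \<gamma> U \<subseteq> I" by (auto simp: part_def)
  have sx': "smooth (interval_diffeology (part I \<gamma> U)) (subset_diffeology X U) (\<lambda>t. \<pi> (\<gamma> t))"
    by (rule smooth_into_subset[OF diffeology_interval smooth_subset_mono[OF sx sub]]) (auto simp: part_def)
  show "smooth (interval_diffeology (part I \<gamma> U)) D (coord U \<gamma>)"
    unfolding coord_def
    by (rule smooth_fibre_quotient[OF diffeology_interval smooth_subset_mono[OF s sub] smooth_compose[OF sec_smooth[OF U] sx']])
      (auto simp: \<pi>_sec[OF U] part_def)
qed

lemma supp_part: "path I \<gamma> \<Longrightarrow> t \<in> I \<Longrightarrow> U \<in> supp (\<pi> (\<gamma> t)) \<Longrightarrow> U \<in> \<U> \<and> t \<in> part I \<gamma> U"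
  using supp_mem[OF \<pi>_points[OF path_points]] by (auto simp: part_def)

lemma coord_formal:
  "path I \<gamma> \<Longrightarrow> t \<in> I \<Longrightarrow> U \<in> supp (\<pi> (\<gamma> t)) \<Longrightarrow> log_deriv (part I \<gamma> U) (coord U \<gamma>) t \<in> formal_vecs D \<one>"
  using supp_part[of I \<gamma> t U] path_part[of I \<gamma> U] log_deriv_formal_vecs by blast

lemma mean_log_deriv_formal: "path I \<gamma> \<Longrightarrow> t \<in> I \<Longrightarrow> mean_log_deriv I \<gamma> t \<in> formal_vecs D \<one>"
  unfolding mean_log_deriv_def by (intro formal_vecs_sum coord_formal)

text \<open>The weights depend only on the point of \<open>X\<close> that is reached, so the chain
  rule in each trivialisation passes to the average. For an inclusion it shows that the average is
  local in time.\<close>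

lemma mean_log_deriv_reparam:
  assumes \<gamma>: "path I \<gamma>" and J: "open J" "t \<in> J"
    and f: "smooth (interval_diffeology J) (interval_diffeology I) f"
    and \<delta>: "\<And>s. s \<in> J \<Longrightarrow> \<delta> s = \<gamma> (f s)"
  shows "mean_log_deriv J \<delta> t \<doteq> (\<lambda>P i. deriv f t * mean_log_deriv I \<gamma> (f t) P i)"
proof -
  have fI: "f s \<in> I" if "s \<in> J" for s using smooth_intoD[OF f, of s] that by simp
  have E\<delta>: "smooth (interval_diffeology J) E \<delta>"
    by (rule smooth_cong[OF diffeology_interval diffeology_E smooth_compose[OF _ f]])
      (use \<gamma> \<delta> in \<open>auto simp: path_def\<close>)
  have p\<delta>: "path J \<delta>" using J E\<delta> by (simp add: path_def)
  let ?x = "\<pi> (\<delta> t)"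
  have x: "?x = \<pi> (\<gamma> (f t))" using \<delta>[OF J(2)] by simp
  have "log_deriv (part J \<delta> U) (coord U \<delta>) t \<doteq> (\<lambda>P i. deriv f t * log_deriv (part I \<gamma> U) (coord U \<gamma>) (f t) P i)"
    if U: "U \<in> supp ?x" for U
  proof -
    have U': "U \<in> \<U>" "t \<in> part J \<delta> U" using supp_part[OF p\<delta> J(2) U] by auto
    have f': "smooth (interval_diffeology (part J \<delta> U)) (interval_diffeology (part I \<gamma> U)) f"
    proof (rule smooth_into_subset[OF diffeology_interval])
      show "smooth (interval_diffeology (part J \<delta> U)) real_diffeology f"
        by (rule smooth_subset_mono[OF smooth_subset_D[OF f] path_part(3)[OF p\<delta> U'(1)]])
    qed (use \<delta> fI in \<open>auto simp: part_def\<close>)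
    show ?thesis
      by (rule log_deriv_chain[OF path_part(1,2)[OF \<gamma> U'(1)] path_part(1)[OF p\<delta> U'(1)] U'(2) f'])
        (use \<delta> in \<open>auto simp: part_def coord_def\<close>)
  qed
  from tangent_eq_sum[OF this, of "supp ?x" "\<lambda>U. U" "\<lambda>U. \<rho> U ?x"]
  have "mean_log_deriv J \<delta> t \<doteq> (\<lambda>P i. \<Sum>U\<in>supp ?x. \<rho> U ?x * (deriv f t * log_deriv (part I \<gamma> U) (coord U \<gamma>) (f t) P i))"
    unfolding mean_log_deriv_def by simp
  also have "(\<lambda>P i. \<Sum>U\<in>supp ?x. \<rho> U ?x * (deriv f t * log_deriv (part I \<gamma> U) (coord U \<gamma>) (f t) P i))
      = (\<lambda>P i. deriv f t * mean_log_deriv I \<gamma> (f t) P i)"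
    unfolding mean_log_deriv_def x by (simp add: sum_distrib_left mult.left_commute)
  finally show ?thesis .
qed

lemma mean_log_deriv_restrict:
  assumes "path I \<gamma>" "open J" "t \<in> J" "J \<subseteq> I" "\<And>s. s \<in> J \<Longrightarrow> \<delta> s = \<gamma> s"
  shows "mean_log_deriv J \<delta> t \<doteq> mean_log_deriv I \<gamma> t"
  using mean_log_deriv_reparam[OF assms(1-3) smooth_interval_id[OF assms(4)], of \<delta>] assms(5) by simp

lemma path_act:
  assumes "path I \<gamma>" "smooth (interval_diffeology I) D h" "\<And>s. s \<in> I \<Longrightarrow> \<delta> s = act (h s) (\<gamma> s)"
  shows "path I \<delta>"
  using assms(1) smooth_cong[OF diffeology_interval diffeology_E smooth_act[OF assms(2)], of \<gamma> \<delta>] assms(3)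
  by (auto simp: path_def)

text \<open>The product rule in each trivialisation. Equivariance of the coordinates comes from
  \<open>fibre_quotient_act\<close>, and \<open>partition_sum\<close> removes the weights from the
  term common to all.\<close>

lemma mean_log_deriv_act:
  assumes \<gamma>: "path I \<gamma>" and t: "t \<in> I" and h: "smooth (interval_diffeology I) D h"
    and \<delta>: "\<And>s. s \<in> I \<Longrightarrow> \<delta> s = act (h s) (\<gamma> s)"
  shows "mean_log_deriv I \<delta> t \<doteq> (\<lambda>P i. log_deriv I h t P i + push_formal (conj (h t)) (mean_log_deriv I \<gamma> t) P i)"
proof -
  have I: "open I" using \<gamma> by (simp add: path_def)
  have p\<delta>: "path I \<delta>" by (rule path_act[OF \<gamma> h \<delta>])
  have car: "h s \<in> carrier G" if "s \<in> I" for s using curve_carrier[OF h that] .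
  have \<pi>\<delta>: "\<pi> (\<delta> s) = \<pi> (\<gamma> s)" if "s \<in> I" for s
    using \<delta>[OF that] \<pi>_act[OF car[OF that] path_points[OF \<gamma> that]] by simp
  have part: "part I \<delta> U = part I \<gamma> U" for U using \<pi>\<delta> by (auto simp: part_def)
  let ?x = "\<pi> (\<gamma> t)" let ?c = "push_formal (conj (h t))"
  have "log_deriv (part I \<delta> U) (coord U \<delta>) t \<doteq> (\<lambda>P i. log_deriv I h t P i + ?c (log_deriv (part I \<gamma> U) (coord U \<gamma>) t) P i)"
    if U: "U \<in> supp ?x" for U
  proof -
    have U': "U \<in> \<U>" "t \<in> part I \<gamma> U" using supp_part[OF \<gamma> t U] by auto
    note P = path_part[OF \<gamma> U'(1)]
    have hU: "smooth (interval_diffeology (part I \<gamma> U)) D h" by (rule smooth_subset_mono[OF h P(3)])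
    have secE: "sec U x \<in> points E" if "x \<in> U" for x
      using smooth_intoD[OF sec_smooth[OF U'(1)], of x] that openin_subset[OF cover_open[OF U'(1)]]
        topspace_D_topology[OF diffeology_X] by auto
    have eq: "coord U \<delta> s = h s \<otimes> coord U \<gamma> s" if "s \<in> part I \<gamma> U" for s
    proof -
      have s: "s \<in> I" "\<pi> (\<gamma> s) \<in> U" using that by (auto simp: part_def)
      show ?thesis unfolding coord_def \<pi>\<delta>[OF s(1)] unfolding \<delta>[OF s(1)]
        by (rule fibre_quotient_act[OF path_points[OF \<gamma> s(1)] secE[OF s(2)] _ car[OF s(1)]]) (simp add: \<pi>_sec U'(1) s)
    qed
    have "log_deriv (part I \<gamma> U) (coord U \<delta>) t \<doteq>
        (\<lambda>P i. log_deriv (part I \<gamma> U) h t P i + ?c (log_deriv (part I \<gamma> U) (coord U \<gamma>) t) P i)"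
      by (rule log_deriv_mult[OF P(1) U'(2) hU P(2) eq])
    also have "\<dots> \<doteq> (\<lambda>P i. log_deriv I h t P i + ?c (log_deriv (part I \<gamma> U) (coord U \<gamma>) t) P i)"
      by (rule tangent_eq_add[OF log_deriv_cong[OF I h P(1) U'(2) P(3)] tangent_eq_refl]) simp
    finally show ?thesis unfolding part .
  qed
  from tangent_eq_sum[OF this, of "supp ?x" "\<lambda>U. U" "\<lambda>U. \<rho> U ?x"]
  have "mean_log_deriv I \<delta> t \<doteq> (\<lambda>P i. \<Sum>U\<in>supp ?x. \<rho> U ?x * (log_deriv I h t P i + ?c (log_deriv (part I \<gamma> U) (coord U \<gamma>) t) P i))"
    unfolding mean_log_deriv_def \<pi>\<delta>[OF t] by simp
  also have "\<dots> = (\<lambda>P i. log_deriv I h t P i + ?c (mean_log_deriv I \<gamma> t) P i)"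
  proof -
    have c: "?c (mean_log_deriv I \<gamma> t) = (\<lambda>P i. \<Sum>U\<in>supp ?x. \<rho> U ?x * ?c (log_deriv (part I \<gamma> U) (coord U \<gamma>) t) P i)"
      unfolding mean_log_deriv_def by (rule push_sum[OF coord_formal[OF \<gamma> t]])
    have "(\<Sum>U\<in>supp ?x. \<rho> U ?x * log_deriv I h t P i) = log_deriv I h t P i" for P i
      using partition_sum[OF \<pi>_points[OF path_points[OF \<gamma> t]]] by (simp flip: sum_distrib_right)
    then show ?thesis unfolding c by (simp add: distrib_left sum.distrib)
  qed
  finally show ?thesis .
qed

text \<open>Near a given point one finite index set must serve, and every summand must be smooth
  there. Local finiteness gives the first. The second is in doubt for a set \<open>U\<close> whose
  boundary contains the base point, but then the closed support of its weight keeps away and the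
  term drops out.\<close>

lemma mean_log_deriv_smooth:
  assumes Z: "diffeology Z" and V: "open V"
    and \<Gamma>: "smooth (prod_diffeology Z (interval_diffeology V)) E (\<lambda>(z, t). \<Gamma> z t)"
  shows "smooth (prod_diffeology Z (interval_diffeology V)) lie (\<lambda>(z, t). tvec D \<one> (mean_log_deriv V (\<Gamma> z) t))"
proof -
  let ?Y = "prod_diffeology Z (interval_diffeology V)"
  let ?ZR = "prod_diffeology Z real_diffeology"
  have Y: "diffeology ?Y" and ZR: "diffeology ?ZR" by (intro diffeology_prod Z diffeology_interval diffeology_real)+
  have path: "path V (\<Gamma> z)" if "z \<in> points Z" for z
    unfolding path_def using V smooth_compose2[OF \<Gamma> smooth_const[OF diffeology_interval Z that] smooth_id] by blast
  let ?x = "\<lambda>y. \<pi> (\<Gamma> (fst y) (snd y))"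
  have \<Gamma>': "smooth ?Y E (\<lambda>y. \<Gamma> (fst y) (snd y))" using \<Gamma> by (simp add: case_prod_unfold)
  have x: "smooth ?Y X ?x" by (rule smooth_compose[OF smooth_\<pi> \<Gamma>'])
  \<comment> \<open>Where the base point stays in \<open>U\<close> the coordinates are defined, and
    \<open>log_deriv_smooth\<close> applies over the D-open set \<open>B\<close> of all such
    parameters and times.\<close>
  have om: "smooth (subset_diffeology ?Y M) lie (\<lambda>y. tvec D \<one> (log_deriv (part V (\<Gamma> (fst y)) U) (coord U (\<Gamma> (fst y))) (snd y)))"
    if U: "U \<in> \<U>" and M: "\<And>y. y \<in> points ?Y \<Longrightarrow> y \<in> M \<Longrightarrow> ?x y \<in> U" for U M
  proof -
    define B where "B = {y \<in> points ?Y. ?x y \<in> U}"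
    have B: "openin (D_topology ?ZR) B"
      unfolding B_def by (rule openin_D_prod_interval[OF Z V openin_D_preimage[OF Y diffeology_X x cover_open[OF U]]])
    let ?B = "subset_diffeology ?ZR B"
    have dB: "diffeology ?B" by (rule diffeology_subset[OF ZR])
    have BY: "smooth ?B ?Y (\<lambda>y. y)"
    proof -
      have "smooth ?B (interval_diffeology V) snd"
        by (rule smooth_into_subset[OF dB smooth_from_subset[OF smooth_snd]]) (auto simp: B_def)
      from smooth_Pair[OF smooth_from_subset[OF smooth_fst] this] show ?thesis by simp
    qed
    have "smooth ?B D (\<lambda>y. fibre_quotient (\<Gamma> (fst y) (snd y)) (sec U (?x y)))"
    proof (rule smooth_fibre_quotient[OF dB])
      show "smooth ?B E (\<lambda>y. \<Gamma> (fst y) (snd y))" by (rule smooth_compose[OF \<Gamma>' BY])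
      have "smooth ?B (subset_diffeology X U) ?x"
        by (rule smooth_into_subset[OF dB smooth_compose[OF x BY]]) (simp add: B_def)
      then show "smooth ?B E (\<lambda>y. sec U (?x y))" by (rule smooth_compose[OF sec_smooth[OF U]])
    qed (auto simp: B_def \<pi>_sec[OF U])
    then have g: "smooth ?B D (\<lambda>(z, t). coord U (\<Gamma> z) t)" by (simp add: coord_def case_prod_unfold)
    have part: "{s. (z, s) \<in> B} = part V (\<Gamma> z) U" if "z \<in> points Z" for z
      using that by (auto simp: B_def part_def)
    have "smooth ?B lie (\<lambda>(z, t). tvec D \<one> (log_deriv {s. (z, s) \<in> B} (coord U (\<Gamma> z)) t))"
      unfolding smooth_lie_iff[OF dB]
    proof (intro conjI ballI allI impI)
      fix y assume "y \<in> points ?B"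
      then obtain z t where y: "y = (z, t)" "z \<in> points Z" "(z, t) \<in> B" by auto
      have t: "t \<in> part V (\<Gamma> z) U" using part[OF y(2)] y(3) by auto
      show "(case y of (z, t) \<Rightarrow> tvec D \<one> (log_deriv {s. (z, s) \<in> B} (coord U (\<Gamma> z)) t)) \<in> tangent_space D \<one>"
        unfolding y(1) prod.case part[OF y(2)]
        by (intro tvec_tangent_space log_deriv_formal_vecs path_part[OF path[OF y(2)] U] t)
    qed (rule log_deriv_smooth[OF Z _ B g])
    moreover have "smooth (subset_diffeology ?Y M) ?B (\<lambda>y. y)"
    proof (rule smooth_into_subset[OF diffeology_subset[OF Y]])
      have "smooth ?Y ?ZR (\<lambda>y. (fst y, snd y))"
        by (rule smooth_Pair[OF smooth_fst smooth_subset_D[OF smooth_snd]])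
      then show "smooth (subset_diffeology ?Y M) ?ZR (\<lambda>y. y)" by (simp add: smooth_from_subset)
    qed (use M in \<open>auto simp: B_def\<close>)
    ultimately have "smooth (subset_diffeology ?Y M) lie
        (\<lambda>y. case y of (z, t) \<Rightarrow> tvec D \<one> (log_deriv {s. (z, s) \<in> B} (coord U (\<Gamma> z)) t))"
      by (rule smooth_compose)
    then show ?thesis
      by (rule smooth_lie_cong[OF diffeology_subset[OF Y]]) (auto simp: part)
  qed
  show ?thesis
  proof (rule smooth_lie_local[OF Y])
    fix y0 assume y0: "y0 \<in> points ?Y"
    let ?bp = "?x y0"
    have x0: "?bp \<in> points X" by (rule smooth_intoD[OF x y0])
    obtain N where N: "openin (D_topology X) N" "?bp \<in> N" and fin: "finite {U \<in> \<U>. \<exists>y\<in>N. \<rho> U y \<noteq> 0}"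
      by (rule partition_locally_finite[OF x0])
    let ?F = "{U \<in> \<U>. \<exists>y\<in>N. \<rho> U y \<noteq> 0}"
    define F where "F = {U \<in> ?F. ?bp \<in> U}"
    \<comment> \<open>Either \<open>U\<close> is itself a neighbourhood of the base point, or the
      closed support of its weight misses that point.\<close>
    define nb where "nb U = (if ?bp \<in> U then U else points X - clsupp U)" for U
    have nb: "openin (D_topology X) (nb U) \<and> ?bp \<in> nb U" if "U \<in> ?F" for U
    proof (cases "?bp \<in> U")
      case True then show ?thesis using that cover_open by (simp add: nb_def)
    next
      case False
      have "openin (D_topology X) (points X - clsupp U)"
        using openin_diff[OF openin_topspace closedin_closure_of] topspace_D_topology[OF diffeology_X] by metis
      then show ?thesis using False that clsupp(1) x0 by (auto simp: nb_def)
    qed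
    define N' where "N' = N \<inter> (\<Inter>U\<in>?F. nb U)"
    have N': "openin (D_topology X) N'" "?bp \<in> N'"
    proof -
      have "openin (D_topology X) (\<Inter>(insert N (nb ` ?F)))"
        by (rule openin_Inter) (use fin nb N in auto)
      then show "openin (D_topology X) N'" by (simp add: N'_def)
      show "?bp \<in> N'" using nb N by (simp add: N'_def)
    qed
    have N'X: "N' \<subseteq> points X" using openin_subset[OF N'(1)] topspace_D_topology[OF diffeology_X] by simp
    have FN: "x \<in> U" if "U \<in> F" "x \<in> N'" for U x using that by (auto simp: F_def N'_def nb_def)
    have supp: "supp x \<subseteq> F" if "x \<in> N'" for x
    proof
      fix U assume U: "U \<in> supp x"
      then have UF: "U \<in> ?F" using that by (auto simp: supp_def N'_def)
      have "x \<in> clsupp U" using clsupp(2) U that N'X by (auto simp: supp_def)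
      moreover have "x \<in> nb U" using that UF by (simp add: N'_def)
      ultimately show "U \<in> F" using UF by (auto simp: F_def nb_def split: if_splits)
    qed
    have finF: "finite F" using fin by (rule rev_finite_subset) (auto simp: F_def)
    have FU: "F \<subseteq> \<U>" by (auto simp: F_def)
    define M where "M = {y \<in> points ?Y. ?x y \<in> N'}"
    let ?M = "subset_diffeology ?Y M"
    have dM: "diffeology ?M" by (rule diffeology_subset[OF Y])
    have "smooth ?M lie (\<lambda>y. tvec D \<one> (\<lambda>P i. \<Sum>U\<in>F. \<rho> U (?x y) * log_deriv (part V (\<Gamma> (fst y)) U) (coord U (\<Gamma> (fst y))) (snd y) P i))"
    proof (rule smooth_lie_sum[OF dM finF])
      fix U assume U: "U \<in> F"
      then have U': "U \<in> \<U>" using FU by blast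
      show "smooth ?M real_diffeology (\<lambda>y. \<rho> U (?x y))"
        by (rule smooth_compose[OF partition_smooth[OF U'] smooth_from_subset[OF x]])
      show "log_deriv (part V (\<Gamma> (fst y)) U) (coord U (\<Gamma> (fst y))) (snd y) \<in> formal_vecs D \<one>" if "y \<in> points ?M" for y
      proof -
        have "fst y \<in> points Z" "snd y \<in> part V (\<Gamma> (fst y)) U"
          using that FN[OF U] by (auto simp: M_def part_def)
        then show ?thesis using path_part[OF path U'] log_deriv_formal_vecs by blast
      qed
      show "smooth ?M lie (\<lambda>y. tvec D \<one> (log_deriv (part V (\<Gamma> (fst y)) U) (coord U (\<Gamma> (fst y))) (snd y)))"
        by (rule om[OF U']) (use FN[OF U] in \<open>auto simp: M_def\<close>)
    qed
    then have "smooth ?M lie (\<lambda>(z, t). tvec D \<one> (mean_log_deriv V (\<Gamma> z) t))"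
    proof (rule smooth_lie_cong[OF dM])
      fix y assume "y \<in> points ?M"
      then have "?x y \<in> N'" by (auto simp: M_def)
      \<comment> \<open>The index set \<open>supp\<close> varies with the point; on
        \<open>N'\<close> it lies in the fixed set \<open>F\<close>, and the added terms have weight
        0.\<close>
      then have "(\<Sum>U\<in>supp (?x y). \<rho> U (?x y) * c U) = (\<Sum>U\<in>F. \<rho> U (?x y) * c U)" for c
        using supp FU by (intro sum.mono_neutral_left finF) (auto simp: supp_def)
      then show "(case y of (z, t) \<Rightarrow> tvec D \<one> (mean_log_deriv V (\<Gamma> z) t)) =
          tvec D \<one> (\<lambda>P i. \<Sum>U\<in>F. \<rho> U (?x y) * log_deriv (part V (\<Gamma> (fst y)) U) (coord U (\<Gamma> (fst y))) (snd y) P i)"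
        by (simp add: mean_log_deriv_def case_prod_unfold)
    qed
    moreover have "openin (D_topology ?Y) M" unfolding M_def by (rule openin_D_preimage[OF Y diffeology_X x N'(1)])
    moreover have "y0 \<in> M" using y0 N'(2) by (simp add: M_def)
    ultimately show "\<exists>N. openin (D_topology ?Y) N \<and> y0 \<in> N \<and>
        smooth (subset_diffeology ?Y N) lie (\<lambda>(z, t). tvec D \<one> (mean_log_deriv V (\<Gamma> z) t))" by blast
  qed
qed

lemma mean_log_deriv_field:
  assumes \<gamma>: "path I \<gamma>" and I: "is_interval I"
  shows "field I (mean_log_deriv I \<gamma>)"
proof -
  have o: "open I" and s: "smooth (interval_diffeology I) E \<gamma>" using \<gamma> by (auto simp: path_def)
  have "smooth (prod_diffeology (interval_diffeology I) (interval_diffeology I)) E (\<lambda>(z, t). \<gamma> t)"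
    using smooth_compose[OF s smooth_snd] by (simp add: case_prod_unfold)
  from smooth_compose2[OF mean_log_deriv_smooth[OF diffeology_interval o this] smooth_id smooth_id]
  show ?thesis using o I mean_log_deriv_formal[OF \<gamma>] by (simp add: field_def)
qed

end

section \<open>The averaged connection\<close>

lemma points_Paths_loc:
  "(I, \<gamma>) \<in> points (Paths_loc E) \<longleftrightarrow>
    open_interval I \<and> \<gamma> \<in> extensional I \<and> smooth (interval_diffeology I) E \<gamma>"
  by (simp add: Paths_loc_def Let_def)

lemma plot_Paths_loc:
  "plot (Paths_loc E) n U p \<longleftrightarrow> openin (Euclidean_space n) U \<and> p \<in> U \<rightarrow> points (Paths_loc E) \<and>
     (\<forall>u\<in>U. \<forall>v\<in>fst (p u). \<exists>U' V'.
        openin (Euclidean_space n) U' \<and> u \<in> U' \<and> U' \<subseteq> U \<and> open V' \<and> v \<in> V' \<and>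
        (\<forall>u'\<in>U'. V' \<subseteq> fst (p u')) \<and>
        smooth (prod_diffeology (eucl_diffeology n U') (interval_diffeology V')) E
               (\<lambda>(u', v'). snd (p u') v'))"
  by (simp add: Paths_loc_def Let_def)

text \<open>A plot of local paths is controlled only near each single time, whereas a solution from
  \<open>t\<close> to \<open>v\<close> involves the whole segment between them. Compactness of the
  segment yields one parameter neighbourhood and one interval for all of it.\<close>

lemma plot_Paths_loc_tube:
  assumes E: "diffeology E" and p: "plot (Paths_loc E) n U p" and u: "u \<in> U" and t: "t \<in> fst (p u)" "v \<in> fst (p u)"
  obtains U' V' where "opn n U'" "u \<in> U'" "U' \<subseteq> U" "open V'" "is_interval V'" "t \<in> V'" "v \<in> V'"
    "\<And>u'. u' \<in> U' \<Longrightarrow> V' \<subseteq> fst (p u')"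
    "smooth (prod_diffeology (eucl_diffeology n U') (interval_diffeology V')) E (\<lambda>(u', v'). snd (p u') v')"
proof -
  let ?C = "closed_segment t v"
  have pu: "p u \<in> points (Paths_loc E)" using p u unfolding plot_Paths_loc by blast
  then have "is_interval (fst (p u))"
    using points_Paths_loc[of "fst (p u)" "snd (p u)" E] by (simp add: open_interval_def)
  then have C: "?C \<subseteq> fst (p u)" using t is_interval_convex closed_segment_subset by blast
  have "\<forall>c\<in>?C. \<exists>U' V'. opn n U' \<and> u \<in> U' \<and> U' \<subseteq> U \<and> open V' \<and> c \<in> V' \<and> (\<forall>u'\<in>U'. V' \<subseteq> fst (p u')) \<and>
      smooth (prod_diffeology (eucl_diffeology n U') (interval_diffeology V')) E (\<lambda>(u', v'). snd (p u') v')"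
    using p u C unfolding plot_Paths_loc by blast
  then obtain A B where AB: "\<And>c. c \<in> ?C \<Longrightarrow> opn n (A c) \<and> u \<in> A c \<and> A c \<subseteq> U \<and> open (B c) \<and> c \<in> B c \<and>
      (\<forall>u'\<in>A c. B c \<subseteq> fst (p u')) \<and>
      smooth (prod_diffeology (eucl_diffeology n (A c)) (interval_diffeology (B c))) E (\<lambda>(u', v'). snd (p u') v')"
    unfolding bchoice_iff by (auto simp: Bex_def) metis
  obtain C' where C': "C' \<subseteq> ?C" "finite C'" "?C \<subseteq> (\<Union>c\<in>C'. B c)"
    by (rule compactE_image[OF compact_segment, of ?C B t v]) (use AB in blast)+
  have ne: "C' \<noteq> {}" using C'(3) by force
  define U' where "U' = (\<Inter>c\<in>C'. A c)"
  define W where "W = (\<Union>c\<in>C'. B c)"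
  \<comment> \<open>The union \<open>W\<close> need not be an interval; its component containing the
    segment is one.\<close>
  define V' where "V' = connected_component_set W t"
  have "opn n (\<Inter>(A ` C'))" by (rule openin_Inter) (use C' ne AB in auto)
  then have U'o: "opn n U'" by (simp add: U'_def)
  have U'u: "u \<in> U'" using AB C'(1) by (auto simp: U'_def)
  have U'U: "U' \<subseteq> U"
  proof -
    obtain c where "c \<in> C'" using ne by blast
    then show ?thesis using AB[of c] C'(1) unfolding U'_def by blast
  qed
  have "open W" unfolding W_def using AB C'(1) by blast
  then have V'o: "open V'" unfolding V'_def by (rule open_connected_component)
  have V'i: "is_interval V'" unfolding V'_def is_interval_connected_1 by (rule connected_connected_component)
  have V'W: "V' \<subseteq> W" unfolding V'_def by (rule connected_component_subset)
  have "?C \<subseteq> V'"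
    unfolding V'_def by (rule connected_component_maximal) (use C'(3) in \<open>auto simp: W_def\<close>)
  then have tv: "t \<in> V'" "v \<in> V'" by auto
  have sub: "V' \<subseteq> fst (p u')" if "u' \<in> U'" for u'
  proof
    fix x assume "x \<in> V'"
    then obtain c where c: "c \<in> C'" "x \<in> B c" using V'W by (auto simp: W_def)
    moreover have "u' \<in> A c" using that c(1) by (auto simp: U'_def)
    ultimately show "x \<in> fst (p u')" using AB[of c] C'(1) by blast
  qed
  let ?Y = "prod_diffeology (eucl_diffeology n U') (interval_diffeology V')"
  have Y: "diffeology ?Y" by (intro diffeology_prod diffeology_eucl diffeology_interval U'o)
  have "smooth ?Y E (\<lambda>(u', v'). snd (p u') v')"
  proof (rule smooth_local[OF Y E])
    fix y assume "y \<in> points ?Y"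
    then have y: "fst y \<in> U'" "snd y \<in> V'" by auto
    then obtain c where c: "c \<in> C'" "snd y \<in> B c" using V'W by (auto simp: W_def)
    note AB = AB[OF subsetD[OF C'(1) c(1)]]
    have "smooth ?Y real_diffeology snd" by (rule smooth_subset_D[OF smooth_snd])
    from openin_D_preimage[OF Y diffeology_real this openin_D_real, of "B c"] AB
    have "openin (D_topology ?Y) {y \<in> points ?Y. snd y \<in> B c}" (is "openin _ ?M") by blast
    moreover have "smooth (subset_diffeology ?Y ?M) E (\<lambda>(u', v'). snd (p u') v')"
    proof -
      let ?S = "subset_diffeology ?Y ?M"
      have S: "diffeology ?S" by (rule diffeology_subset[OF Y])
      have 1: "smooth ?S (eucl_diffeology n (A c)) fst"
      proof (rule smooth_into_eucl[OF S])
        show "smooth ?S real_diffeology (\<lambda>x. fst x j)" for j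
          by (rule smooth_compose[OF smooth_coord[OF U'o] smooth_from_subset[OF smooth_fst]])
      qed (use c(1) in \<open>auto simp: U'_def\<close>)
      have 2: "smooth ?S (interval_diffeology (B c)) snd"
        by (rule smooth_into_subset[OF S smooth_from_subset[OF smooth_subset_D[OF smooth_snd]]]) auto
      show ?thesis
        using smooth_compose2[OF _ 1 2, of E "\<lambda>u' v'. snd (p u') v'"] AB by (simp add: case_prod_unfold)
    qed
    ultimately show "\<exists>N. openin (D_topology ?Y) N \<and> y \<in> N \<and> smooth (subset_diffeology ?Y N) E (\<lambda>(u', v'). snd (p u') v')"
      using \<open>y \<in> points ?Y\<close> c(2) by blast
  qed
  then show ?thesis using that U'o U'u U'U V'o V'i tv sub by blast
qed

section \<open>The connection \<open>theta\<close> and its axioms\<close>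

context partitioned
begin

definition theta :: "'e local_path \<times> real \<Rightarrow> 'e local_path" where
  "theta = (\<lambda>((I, \<gamma>), t0). (I, \<lambda>t\<in>I. act (inv (sol (mean_log_deriv I \<gamma>) t0 t)) (\<gamma> t)))"

abbreviation zero_formal :: "'g formal_vec" where "zero_formal \<equiv> (\<lambda>P i. 0)"

lemma path_interval: "open_interval I \<Longrightarrow> smooth (interval_diffeology I) E \<gamma> \<Longrightarrow> path I \<gamma>"
  by (simp add: path_def open_interval_def)

lemma path_cong:
  assumes "path I \<gamma>" "\<And>t. t \<in> I \<Longrightarrow> \<delta> t = \<gamma> t"
  shows "path I \<delta>"
  using assms smooth_cong[OF diffeology_interval diffeology_E, of I \<gamma> \<delta>] by (auto simp: path_def)

context
  fixes I \<gamma> t0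
  assumes \<gamma>: "path I \<gamma>" and I: "is_interval I" and t0: "t0 \<in> I"
begin

private definition "k = sol (mean_log_deriv I \<gamma>) t0"

private lemma Io: "open I" using \<gamma> by (simp add: path_def)

private lemma k: "smooth (interval_diffeology I) D k" "k t0 = \<one>" "t \<in> I \<Longrightarrow> log_deriv I k t \<doteq> mean_log_deriv I \<gamma> t"
  unfolding k_def using sol_curve[OF mean_log_deriv_field[OF \<gamma> I] t0] sol_start[OF mean_log_deriv_field[OF \<gamma> I] t0]
    log_deriv_sol[OF mean_log_deriv_field[OF \<gamma> I] t0] by auto

private lemma kc: "t \<in> I \<Longrightarrow> k t \<in> carrier G"
  by (rule curve_carrier[OF k(1)])

lemma theta_eq: "theta ((I, \<gamma>), t0) = (I, \<lambda>t\<in>I. act (inv (k t)) (\<gamma> t))"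
  by (simp add: theta_def k_def)

lemma theta_curve: "path I (snd (theta ((I, \<gamma>), t0)))"
  unfolding theta_eq snd_conv by (rule path_act[OF \<gamma> smooth_inverse[OF k(1)]]) simp

lemma theta_start: "snd (theta ((I, \<gamma>), t0)) t0 = \<gamma> t0"
  using path_points[OF \<gamma> t0] t0 by (simp add: theta_eq k(2))

lemma theta_\<pi>: "t \<in> I \<Longrightarrow> \<pi> (snd (theta ((I, \<gamma>), t0)) t) = \<pi> (\<gamma> t)"
  using path_points[OF \<gamma>] kc by (simp add: theta_eq \<pi>_act)

text \<open>Differentiating \<open>k^-1 k = 1\<close>: with the average of the given path replaced
  by the logarithmic derivative of \<open>k\<close>, the product rule read backwards gives that of a
  constant curve.\<close>

lemma mean_log_deriv_theta:
  assumes t: "t \<in> I"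
  shows "mean_log_deriv I (snd (theta ((I, \<gamma>), t0))) t \<doteq> zero_formal"
proof -
  let ?h = "\<lambda>t. inv (k t)" let ?\<delta> = "snd (theta ((I, \<gamma>), t0))"
  have h: "smooth (interval_diffeology I) D ?h" by (rule smooth_inverse[OF k(1)])
  have "mean_log_deriv I ?\<delta> t \<doteq> (\<lambda>P i. log_deriv I ?h t P i + push_formal (conj (?h t)) (mean_log_deriv I \<gamma> t) P i)"
    by (rule mean_log_deriv_act[OF \<gamma> t h]) (simp add: theta_eq)
  also have "\<dots> \<doteq> (\<lambda>P i. log_deriv I ?h t P i + push_formal (conj (?h t)) (log_deriv I k t) P i)"
  proof (rule tangent_eq_add[OF tangent_eq_refl])
    show "push_formal (conj (?h t)) (mean_log_deriv I \<gamma> t) \<doteq> push_formal (conj (?h t)) (log_deriv I k t)"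
      using push_tangent_eq[OF diffeology_D smooth_conj[OF inv_closed[OF kc[OF t]]] mean_log_deriv_formal[OF \<gamma> t]
          log_deriv_formal_vecs[OF Io k(1) t] tangent_eq_sym[OF k(3)[OF t]]] kc[OF t] by simp
  qed
  also have "\<dots> \<doteq> log_deriv I (\<lambda>_. \<one>) t"
    by (rule tangent_eq_sym[OF log_deriv_mult[OF Io t h k(1)]]) (simp add: kc)
  also have "\<dots> \<doteq> zero_formal" by (rule log_deriv_const[OF Io t one_closed]) simp
  finally show ?thesis .
qed

text \<open>The constant curve at the identity solves the zero equation, so the correction
  \<open>k\<close> is trivial. Idempotence and the description of horizontal paths both rest on
  this.\<close>

lemma theta_flat:
  assumes "\<gamma> \<in> extensional I" and "\<And>t. t \<in> I \<Longrightarrow> mean_log_deriv I \<gamma> t \<doteq> zero_formal"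
  shows "theta ((I, \<gamma>), t0) = (I, \<gamma>)"
proof -
  have "k t = \<one>" if t: "t \<in> I" for t
    unfolding k_def
  proof (rule sol_unique[OF mean_log_deriv_field[OF \<gamma> I] t0 t smooth_D_const[OF diffeology_interval one_closed] refl])
    show "log_deriv I (\<lambda>_. \<one>) s \<doteq> mean_log_deriv I \<gamma> s" if "s \<in> I" for s
      using tangent_eq_trans[OF log_deriv_const[OF Io that one_closed refl] tangent_eq_sym[OF assms(2)[OF that]]] .
  qed
  then have "(\<lambda>t\<in>I. act (inv (k t)) (\<gamma> t)) = \<gamma>"
    using path_points[OF \<gamma>] assms(1) by (auto simp: extensional_def fun_eq_iff)
  then show ?thesis by (simp add: theta_eq)
qed

text \<open>A constant \<open>a\<close> changes the average by Ad, and \<open>a k a^-1\<close>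
  solves the new equation; moreover \<open>(a k a^-1)^-1 a = a k^-1\<close>.\<close>

lemma theta_act:
  assumes a: "a \<in> carrier G"
  shows "theta (act_path act a (I, \<gamma>), t0) = act_path act a (theta ((I, \<gamma>), t0))"
proof -
  let ?\<delta> = "\<lambda>t\<in>I. act a (\<gamma> t)"
  have ac: "smooth (interval_diffeology I) D (\<lambda>_. a)" by (rule smooth_D_const[OF diffeology_interval a])
  have \<delta>: "path I ?\<delta>" by (rule path_act[OF \<gamma> ac]) simp
  have "sol (mean_log_deriv I ?\<delta>) t0 t = conj a (k t)" if t: "t \<in> I" for t
  proof (rule sol_unique[OF mean_log_deriv_field[OF \<delta> I] t0 t smooth_compose[OF smooth_conj[OF a] k(1)]])
    show "conj a (k t0) = \<one>" using a k(2) by simp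
    fix s assume s: "s \<in> I"
    have "log_deriv I (\<lambda>s. conj a (k s)) s \<doteq> push_formal (conj a) (log_deriv I k s)"
      by (rule log_deriv_conj[OF Io s k(1) a]) simp
    also have "\<dots> \<doteq> push_formal (conj a) (mean_log_deriv I \<gamma> s)"
      using push_tangent_eq[OF diffeology_D smooth_conj[OF a] log_deriv_formal_vecs[OF Io k(1) s] mean_log_deriv_formal[OF \<gamma> s] k(3)[OF s]] a
      by simp
    also have "\<dots> \<doteq> (\<lambda>P i. log_deriv I (\<lambda>_. a) s P i + push_formal (conj a) (mean_log_deriv I \<gamma> s) P i)"
      using tangent_eq_add[OF tangent_eq_sym[OF log_deriv_const[OF Io s a refl]] tangent_eq_refl] by simp
    also have "\<dots> \<doteq> mean_log_deriv I ?\<delta> s"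
      by (rule tangent_eq_sym[OF mean_log_deriv_act[OF \<gamma> s ac]]) simp
    finally show "log_deriv I (\<lambda>s. conj a (k s)) s \<doteq> mean_log_deriv I ?\<delta> s" .
  qed
  moreover have "act (inv (conj a (k t))) (act a (\<gamma> t)) = act a (act (inv (k t)) (\<gamma> t))" if t: "t \<in> I" for t
  proof -
    have "inv (conj a (k t)) \<otimes> a = a \<otimes> inv (k t)"
      using a kc[OF t] by (simp add: conj_def inv_mult_group m_assoc)
    then show ?thesis
      using a kc[OF t] path_points[OF \<gamma> t] by (simp add: conj_def flip: act_mult)
  qed
  ultimately show ?thesis
    by (simp add: act_path_def theta_def k_def restrict_def fun_eq_iff)
qed

text \<open>By the chain rule on both sides, \<open>k\<close> composed with \<open>f\<close> solves
  the equation of the reparametrised path, whether \<open>f\<close> is monotone or not.\<close>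

lemma theta_reparam:
  assumes J: "open J" "is_interval J" "s0 \<in> J" and f: "smooth (interval_diffeology J) (interval_diffeology I) f"
    and s0: "f s0 = t0"
  shows "theta (reparam (I, \<gamma>) J f, s0) = reparam (theta ((I, \<gamma>), t0)) J f"
proof -
  let ?\<delta> = "\<lambda>s\<in>J. \<gamma> (f s)"
  have fI: "f s \<in> I" if "s \<in> J" for s using smooth_intoD[OF f, of s] that by simp
  have "path J (\<lambda>s. \<gamma> (f s))" unfolding path_def
    using J(1) smooth_compose[OF _ f] \<gamma> by (auto simp: path_def)
  then have \<delta>: "path J ?\<delta>" by (rule path_cong) simp
  have "sol (mean_log_deriv J ?\<delta>) s0 s = k (f s)" if s: "s \<in> J" for s
  proof (rule sol_unique[OF mean_log_deriv_field[OF \<delta> J(2)] J(3) s smooth_compose[OF k(1) f]])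
    show "k (f s0) = \<one>" using s0 k(2) by simp
    fix r assume r: "r \<in> J"
    have "log_deriv J (\<lambda>s. k (f s)) r \<doteq> (\<lambda>P i. deriv f r * log_deriv I k (f r) P i)"
      by (rule log_deriv_chain[OF Io k(1) J(1) r f refl])
    also have "\<dots> \<doteq> (\<lambda>P i. deriv f r * mean_log_deriv I \<gamma> (f r) P i)" by (rule tangent_eq_scale[OF k(3)[OF fI[OF r]]])
    also have "\<dots> \<doteq> mean_log_deriv J ?\<delta> r" by (rule tangent_eq_sym[OF mean_log_deriv_reparam[OF \<gamma> J(1) r f]]) simp
    finally show "log_deriv J (\<lambda>s. k (f s)) r \<doteq> mean_log_deriv J ?\<delta> r" .
  qed
  then show ?thesis
    using fI by (auto simp: k_def theta_def reparam_def restrict_def fun_eq_iff)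
qed

end

text \<open>The domains of the paths vary with the parameter. On a tube they all contain one
  interval \<open>V\<close> that holds the starting and evaluation times, and the solution can be
  computed from the restrictions to \<open>V\<close>, a family over a fixed interval.\<close>

lemma theta_smooth: "smooth (tbPaths_loc E) (Paths_loc E) theta"
proof (rule smoothI)
  have into: "theta ((I, \<gamma>), t0) \<in> points (Paths_loc E)"
    if "(I, \<gamma>) \<in> points (Paths_loc E)" "t0 \<in> I" for I \<gamma> t0
  proof -
    have I: "open_interval I" "smooth (interval_diffeology I) E \<gamma>" using that by (auto simp: points_Paths_loc)
    have "path I (snd (theta ((I, \<gamma>), t0)))"
      by (rule theta_curve[OF path_interval[OF I] _ that(2)]) (use I in \<open>simp add: open_interval_def\<close>)
    then show ?thesis using I by (simp add: theta_def points_Paths_loc path_def)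
  qed
  have tb: "((I, \<gamma>), t0) \<in> points (tbPaths_loc E) \<longleftrightarrow> (I, \<gamma>) \<in> points (Paths_loc E) \<and> t0 \<in> I" for I \<gamma> t0
    by (simp add: tbPaths_loc_def)
  show into': "theta x \<in> points (Paths_loc E)" if "x \<in> points (tbPaths_loc E)" for x
    using that into tb by (metis prod.collapse)
  fix n U p assume p: "plot (tbPaths_loc E) n U p"
  then have pp: "plot (Paths_loc E) n U (\<lambda>u. fst (p u))" and pt: "plot real_diffeology n U (\<lambda>u. snd (p u))"
    and partial_deriv: "\<And>u. u \<in> U \<Longrightarrow> snd (p u) \<in> fst (fst (p u))"
    by (auto simp: tbPaths_loc_def plot_subset plot_prod Pi_iff case_prod_unfold)
  have U: "opn n U" and pP: "fst (p u) \<in> points (Paths_loc E)" if "u \<in> U" for u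
    using pp that unfolding plot_Paths_loc by auto
  define Ip where "Ip u = fst (fst (p u))" for u
  define \<gamma> where "\<gamma> u = snd (fst (p u))" for u
  define \<tau> where "\<tau> u = snd (p u)" for u
  have p_eq: "p u = ((Ip u, \<gamma> u), \<tau> u)" for u by (simp add: Ip_def \<gamma>_def \<tau>_def)
  have path: "path (Ip u) (\<gamma> u)" if "u \<in> U" for u
    using pP[OF that] unfolding p_eq fst_conv points_Paths_loc by (auto intro: path_interval)
  show "plot (Paths_loc E) n U (\<lambda>u. theta (p u))"
    unfolding plot_Paths_loc
  proof (intro conjI ballI)
    show "opn n U" using plot_openD[OF diffeology_real pt] .
    show "(\<lambda>u. theta (p u)) \<in> U \<rightarrow> points (Paths_loc E)"
      using into pP partial_deriv by (force simp: p_eq)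
    fix u v assume u: "u \<in> U" and "v \<in> fst (theta (p u))"
    then have v: "v \<in> fst (fst (p u))" by (simp add: theta_def p_eq)
    obtain U1 V where U1: "opn n U1" "u \<in> U1" "U1 \<subseteq> U" and V: "open V" "is_interval V" "snd (p u) \<in> V" "v \<in> V"
      and sub: "\<And>u'. u' \<in> U1 \<Longrightarrow> V \<subseteq> fst (fst (p u'))"
      and sm: "smooth (prod_diffeology (eucl_diffeology n U1) (interval_diffeology V)) E (\<lambda>(u', v'). snd (fst (p u')) v')"
      by (rule plot_Paths_loc_tube[OF diffeology_E pp u partial_deriv[OF u] v]) (rule that)
    \<comment> \<open>The starting time moves with the parameter too and has to stay in
      \<open>V\<close>.\<close>
    define U2 where "U2 = {u' \<in> U1. \<tau> u' \<in> V}"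
    have pt1: "plot real_diffeology n U1 \<tau>"
      using plot_restrict[OF diffeology_real pt U1(1,3)] by (simp add: \<tau>_def[abs_def])
    have U2: "opn n U2" unfolding U2_def by (rule openin_D_plot[OF diffeology_real openin_D_real[OF V(1)] pt1])
    have U21: "U2 \<subseteq> U1" by (auto simp: U2_def)
    have u2: "u \<in> U2" using U1(2) V(3) by (simp add: U2_def \<tau>_def)
    let ?E2 = "eucl_diffeology n U2" let ?V = "interval_diffeology V"
    let ?Y = "prod_diffeology ?E2 ?V"
    have E2: "diffeology ?E2" by (rule diffeology_eucl[OF U2])
    have Y: "diffeology ?Y" by (intro diffeology_prod E2 diffeology_interval)
    have \<tau>: "smooth ?E2 ?V \<tau>"
    proof (rule smooth_into_subset[OF E2])
      have "plot real_diffeology n U2 \<tau>" by (rule plot_restrict[OF diffeology_real pt1 U2 U21])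
      then show "smooth ?E2 real_diffeology \<tau>" using plot_iff_smooth[OF diffeology_real] by blast
    qed (simp add: U2_def)
    have E21: "smooth ?E2 (eucl_diffeology n U1) (\<lambda>u. u)"
      by (rule smooth_into_eucl[OF E2 _ smooth_coord[OF U2]]) (use U21 in auto)
    have \<Gamma>: "smooth ?Y E (\<lambda>(u, v). \<gamma> u v)"
      using smooth_compose2[OF sm smooth_compose[OF E21 smooth_fst] smooth_snd]
      by (simp add: \<gamma>_def case_prod_unfold)
    have pathV: "path V (\<gamma> u')" if "u' \<in> U2" for u'
    proof -
      have "smooth (interval_diffeology V) E (\<gamma> u')"
        using smooth_subset_mono[of real_diffeology "Ip u'" E "\<gamma> u'" V] path[of u'] sub[of u'] that U21 U1(3)
        by (auto simp: path_def Ip_def)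
      then show ?thesis using V(1) by (simp add: path_def)
    qed
    \<comment> \<open>The interval occurs twice: inside \<open>?Y\<close> for the time of
      evaluation, and once more for the time variable of the field that is integrated up to
      it.\<close>
    have "smooth (prod_diffeology ?Y ?V) lie (\<lambda>y. tvec D \<one> (mean_log_deriv V (\<gamma> (fst (fst y))) (snd y)))"
      using smooth_compose2[OF mean_log_deriv_smooth[OF E2 V(1) \<Gamma>] smooth_compose[OF smooth_fst smooth_fst] smooth_snd] .
    then have "smooth ?Y D (\<lambda>y. sol (mean_log_deriv V (\<gamma> (fst y))) (\<tau> (fst y)) (snd y))"
      using mean_log_deriv_formal[OF pathV]
      by (intro sol_smooth[OF Y V(2), where x = "\<lambda>y. mean_log_deriv V (\<gamma> (fst y))"] smooth_compose[OF \<tau> smooth_fst] smooth_snd)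
        (auto simp: case_prod_unfold)
    from smooth_act[OF smooth_inverse[OF this], of "\<lambda>y. \<gamma> (fst y) (snd y)"] \<Gamma>
    have "smooth ?Y E (\<lambda>y. act (inv (sol (mean_log_deriv V (\<gamma> (fst y))) (\<tau> (fst y)) (snd y))) (\<gamma> (fst y) (snd y)))"
      by (simp add: case_prod_unfold)
    then have "smooth ?Y E (\<lambda>(u', v'). snd (theta (p u')) v')"
    proof (rule smooth_cong[OF Y diffeology_E])
      fix y assume "y \<in> points ?Y"
      then obtain u' v' where y: "y = (u', v')" "u' \<in> U2" "v' \<in> V" by auto
      then have u': "u' \<in> U1" "u' \<in> U" "\<tau> u' \<in> V" using U21 U1(3) by (auto simp: U2_def)
      have VI: "V \<subseteq> Ip u'" using sub[OF u'(1)] by (simp add: Ip_def)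
      \<comment> \<open>The segment of integration lies in \<open>V\<close>, where both averages
        represent the same vectors.\<close>
      have "sol (mean_log_deriv (Ip u') (\<gamma> u')) (\<tau> u') v' = sol (mean_log_deriv V (\<gamma> u')) (\<tau> u') v'"
        by (rule sol_cong[OF V(2) u'(3) y(3)])
          (rule tangent_eq_sym[OF mean_log_deriv_restrict[OF path[OF u'(2)] V(1) _ VI refl]])
      then show "(case y of (u', v') \<Rightarrow> snd (theta (p u')) v') =
          act (inv (sol (mean_log_deriv V (\<gamma> (fst y))) (\<tau> (fst y)) (snd y))) (\<gamma> (fst y) (snd y))"
        using y VI by (auto simp: p_eq theta_def)
    qed
    moreover have "V \<subseteq> fst (theta (p u'))" if "u' \<in> U2" for u'
      using sub[of u'] that U21 by (auto simp: p_eq theta_def)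
    ultimately show "\<exists>U' V'. opn n U' \<and> u \<in> U' \<and> U' \<subseteq> U \<and> open V' \<and> v \<in> V' \<and>
        (\<forall>u'\<in>U'. V' \<subseteq> fst (theta (p u'))) \<and>
        smooth (prod_diffeology (eucl_diffeology n U') (interval_diffeology V')) E (\<lambda>(u', v'). snd (theta (p u')) v')"
      using U2 u2 U21 U1(3) V by (intro exI[of _ U2] exI[of _ V]) auto
  qed
qed

lemma fst_theta: "fst (theta (\<gamma>, t0)) = fst \<gamma>"
  by (simp add: theta_def case_prod_unfold)

lemma diffeological_connection_theta: "diffeological_connection G act E \<pi> theta"
  unfolding diffeological_connection_def
proof (intro conjI allI impI ballI)
  show "smooth (tbPaths_loc E) (Paths_loc E) theta" by (rule theta_smooth)
next
  fix \<gamma> :: "'e local_path" and t0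
  assume "(\<gamma>, t0) \<in> points (tbPaths_loc E)"
  moreover obtain I c where \<gamma>: "\<gamma> = (I, c)" by fastforce
  ultimately have I: "open_interval I" "is_interval I" "c \<in> extensional I" "smooth (interval_diffeology I) E c" and t0: "t0 \<in> I"
    by (auto simp: tbPaths_loc_def points_Paths_loc open_interval_def)
  have c: "path I c" by (rule path_interval[OF I(1,4)])
  show "fst (theta (\<gamma>, t0)) = fst \<gamma>" by (rule fst_theta)
  show "\<pi> (snd (theta (\<gamma>, t0)) t) = \<pi> (snd \<gamma> t)" if "t \<in> fst \<gamma>" for t
    using theta_\<pi>[OF c I(2) t0] that by (simp add: \<gamma>)
  show "snd (theta (\<gamma>, t0)) t0 = snd \<gamma> t0" using theta_start[OF c I(2) t0] by (simp add: \<gamma>)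
  show "theta (act_path act g \<gamma>, t0) = act_path act g (theta (\<gamma>, t0))" if "g \<in> carrier G" for g
    using theta_act[OF c I(2) t0 that] by (simp add: \<gamma>)
  define d where "d = snd (theta ((I, c), t0))"
  have th: "theta ((I, c), t0) = (I, d)" using fst_theta[of "(I, c)" t0] by (metis d_def fst_conv prod.collapse)
  \<comment> \<open>Values of \<open>theta\<close> have vanishing average, so a second application
    changes nothing.\<close>
  have "theta ((I, d), t0) = (I, d)" unfolding d_def
    by (rule theta_flat[OF theta_curve[OF c I(2) t0] I(2) t0 _ mean_log_deriv_theta[OF c I(2) t0]]) (simp add: theta_def)
  then show "theta (theta (\<gamma>, t0), t0) = theta (\<gamma>, t0)" unfolding \<gamma> th .
next
  fix \<gamma> :: "'e local_path" and J f s
  assume "\<gamma> \<in> points (Paths_loc E)" and J: "open_interval J"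
    and f: "smooth (interval_diffeology J) (interval_diffeology (fst \<gamma>)) f" and s: "s \<in> J"
  moreover obtain I c where \<gamma>: "\<gamma> = (I, c)" by fastforce
  ultimately have I: "open_interval I" "is_interval I" "smooth (interval_diffeology I) E c"
    by (auto simp: points_Paths_loc open_interval_def)
  have fs: "f s \<in> I" using smooth_intoD[OF f, of s] s by (simp add: \<gamma>)
  show "theta (reparam \<gamma> J f, s) = reparam (theta (\<gamma>, f s)) J f"
    using theta_reparam[OF path_interval[OF I(1,3)] I(2) fs, of J s f] J f s by (simp add: open_interval_def \<gamma>)
qed

subsection \<open>Horizontal lifts\<close>

definition flat :: "real set \<Rightarrow> (real \<Rightarrow> 'e) \<Rightarrow> bool" where
  "flat I \<gamma> \<longleftrightarrow> path I \<gamma> \<and> (\<forall>t\<in>I. mean_log_deriv I \<gamma> t \<doteq> zero_formal)"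

text \<open>A fixed point of \<open>theta\<close> is one of its values and so has vanishing average;
  conversely \<open>theta_flat\<close> makes such a path a fixed point for every starting
  time.\<close>

lemma horizontal_iff:
  "horizontal E theta (I, \<gamma>) \<longleftrightarrow> open_interval I \<and> \<gamma> \<in> extensional I \<and> flat I \<gamma>"
proof
  assume h: "horizontal E theta (I, \<gamma>)"
  then have I: "open_interval I" "is_interval I" "\<gamma> \<in> extensional I" "smooth (interval_diffeology I) E \<gamma>"
    by (auto simp: horizontal_def points_Paths_loc open_interval_def)
  have c: "path I \<gamma>" by (rule path_interval[OF I(1,4)])
  have "mean_log_deriv I \<gamma> t \<doteq> zero_formal" if "t \<in> I" for t
    using mean_log_deriv_theta[OF c I(2) that that] h that by (simp add: horizontal_def)
  then show "open_interval I \<and> \<gamma> \<in> extensional I \<and> flat I \<gamma>" using I c by (simp add: flat_def)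
next
  assume *: "open_interval I \<and> \<gamma> \<in> extensional I \<and> flat I \<gamma>"
  then have I: "is_interval I" and c: "path I \<gamma>" by (auto simp: open_interval_def flat_def)
  have "theta ((I, \<gamma>), t) = (I, \<gamma>)" if "t \<in> I" for t
    by (rule theta_flat[OF c I that]) (use * in \<open>auto simp: flat_def\<close>)
  then show "horizontal E theta (I, \<gamma>)" using * c by (simp add: horizontal_def points_Paths_loc path_def)
qed

lemma push_zero_tangent_eq:
  assumes "a \<in> carrier G" "x \<in> formal_vecs D \<one>" "x \<doteq> zero_formal"
  shows "push_formal (conj a) x \<doteq> zero_formal"
  using push_tangent_eq[OF diffeology_D smooth_conj[OF assms(1)] assms(2) formal_vecs_zero assms(3)] assms(1)
  by (simp add: push_zero)

lemma flat_unique: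
  assumes \<gamma>: "flat I \<gamma>" and \<delta>: "flat I \<delta>" and I: "is_interval I"
    and \<pi>: "\<And>t. t \<in> I \<Longrightarrow> \<pi> (\<gamma> t) = \<pi> (\<delta> t)" and t0: "t0 \<in> I" "\<gamma> t0 = \<delta> t0" and t: "t \<in> I"
  shows "\<gamma> t = \<delta> t"
proof -
  have P: "path I \<gamma>" "path I \<delta>" using \<gamma> \<delta> by (auto simp: flat_def)
  have Io: "open I" using P by (simp add: path_def)
  let ?h = "\<lambda>s. fibre_quotient (\<gamma> s) (\<delta> s)"
  have h: "smooth (interval_diffeology I) D ?h"
    by (rule smooth_fibre_quotient[OF diffeology_interval]) (use P \<pi> in \<open>auto simp: path_def\<close>)
  have hd: "\<gamma> s = act (?h s) (\<delta> s)" if "s \<in> I" for s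
    using fibre_quotient_props(2)[OF path_points[OF P(1) that] path_points[OF P(2) that] \<pi>[OF that]] by simp
  have "log_deriv I ?h s \<doteq> zero_formal" if s: "s \<in> I" for s
  proof -
    have "push_formal (conj (?h s)) (mean_log_deriv I \<delta> s) \<doteq> zero_formal"
      using push_zero_tangent_eq[OF curve_carrier[OF h s] mean_log_deriv_formal[OF P(2) s]] \<delta> s by (simp add: flat_def)
    from tangent_eq_add[OF tangent_eq_refl tangent_eq_sym[OF this], of "log_deriv I ?h s"]
    have "log_deriv I ?h s \<doteq> (\<lambda>P i. log_deriv I ?h s P i + push_formal (conj (?h s)) (mean_log_deriv I \<delta> s) P i)" by simp
    also have "\<dots> \<doteq> mean_log_deriv I \<gamma> s" by (rule tangent_eq_sym[OF mean_log_deriv_act[OF P(2) s h hd]])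
    also have "\<dots> \<doteq> zero_formal" using \<gamma> s by (simp add: flat_def)
    finally show ?thesis .
  qed
  then have "?h t = ?h t0" by (rule log_deriv_zero_imp_const[OF Io I t0(1) t h])
  \<comment> \<open>The paths meet at \<open>t0\<close>, which determines the constant.\<close>
  also have "\<dots> = \<one>" using path_points[OF P(2) t0(1)] t0(2) by (intro fibre_quotient_eq) auto
  finally show ?thesis using hd[OF t] path_points[OF P(2) t] by simp
qed

lemma flat_act:
  assumes \<gamma>: "flat I \<gamma>" and a: "a \<in> carrier G"
  shows "flat I (\<lambda>t. act a (\<gamma> t))"
proof -
  have P: "path I \<gamma>" using \<gamma> by (simp add: flat_def)
  have Io: "open I" using P by (simp add: path_def)
  have c: "smooth (interval_diffeology I) D (\<lambda>_. a)" by (rule smooth_D_const[OF diffeology_interval a])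
  have "mean_log_deriv I (\<lambda>t. act a (\<gamma> t)) t \<doteq> zero_formal" if t: "t \<in> I" for t
  proof -
    have "push_formal (conj a) (mean_log_deriv I \<gamma> t) \<doteq> zero_formal"
      using push_zero_tangent_eq[OF a mean_log_deriv_formal[OF P t]] \<gamma> t by (simp add: flat_def)
    from tangent_eq_trans[OF mean_log_deriv_act[OF P t c refl] tangent_eq_add[OF log_deriv_const[OF Io t a refl] this]]
    show ?thesis by simp
  qed
  then show ?thesis using path_act[OF P c, of "\<lambda>t. act a (\<gamma> t)"] by (simp add: flat_def)
qed

lemma flat_restrict:
  assumes \<gamma>: "flat I \<gamma>" and J: "open J" "J \<subseteq> I" and eq: "\<And>t. t \<in> J \<Longrightarrow> \<delta> t = \<gamma> t"
  shows "flat J \<delta>"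
proof -
  have P: "path I \<gamma>" using \<gamma> by (simp add: flat_def)
  have "path J \<gamma>" using P J smooth_subset_mono[of real_diffeology I E \<gamma> J] by (auto simp: path_def)
  then have "path J \<delta>" by (rule path_cong) (rule eq)
  moreover have "mean_log_deriv J \<delta> t \<doteq> zero_formal" if "t \<in> J" for t
    using tangent_eq_trans[OF mean_log_deriv_restrict[OF P J(1) that J(2) eq]] \<gamma> that J(2) by (auto simp: flat_def)
  ultimately show ?thesis by (simp add: flat_def)
qed

lemma flat_local:
  assumes I: "open I" and *: "\<And>t. t \<in> I \<Longrightarrow> \<exists>J. open J \<and> t \<in> J \<and> J \<subseteq> I \<and> flat J \<gamma>"
  shows "flat I \<gamma>"
proof -
  have "smooth (interval_diffeology I) E \<gamma>"
  proof (rule smooth_curve_local[OF diffeology_E I])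
    fix t assume "t \<in> I"
    then obtain J where "open J" "t \<in> J" "flat J \<gamma>" using * by blast
    then show "\<exists>T. open T \<and> t \<in> T \<and> smooth (interval_diffeology T) E \<gamma>" by (auto simp: flat_def path_def)
  qed
  then have P: "path I \<gamma>" using I by (simp add: path_def)
  have "mean_log_deriv I \<gamma> t \<doteq> zero_formal" if t: "t \<in> I" for t
  proof -
    obtain J where J: "open J" "t \<in> J" "J \<subseteq> I" "flat J \<gamma>" using *[OF t] by blast
    have "mean_log_deriv J \<gamma> t \<doteq> zero_formal" using J by (simp add: flat_def)
    from tangent_eq_trans[OF tangent_eq_sym[OF mean_log_deriv_restrict[OF P J(1-3) refl]] this] show ?thesis .
  qed
  then show ?thesis using P by (simp add: flat_def)
qed

lemma open_real_interval:
  assumes "open S" "t \<in> S"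
  obtains J where "open J" "is_interval J" "(t::real) \<in> J" "J \<subseteq> S"
proof -
  obtain e where "e > 0" "ball t e \<subseteq> S" using assms open_contains_ball by blast
  then show ?thesis using that[of "ball t e"] by (simp add: is_interval_convex_1)
qed

text \<open>A section of the cover gives some smooth path over \<open>c\<close> near
  \<open>t0\<close>, which \<open>theta\<close> makes flat. A suitable \<open>U\<close> exists
  because weights adding up to 1 cannot all vanish.\<close>

lemma local_flat_lift:
  assumes I: "open I" and c: "smooth (interval_diffeology I) X c" and t0: "t0 \<in> I"
  obtains J \<gamma> where "open J" "is_interval J" "t0 \<in> J" "J \<subseteq> I" "flat J \<gamma>" "\<And>t. t \<in> J \<Longrightarrow> \<pi> (\<gamma> t) = c t"
proof -
  have ct0: "c t0 \<in> points X" using smooth_intoD[OF c, of t0] t0 by simp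
  have "supp (c t0) \<noteq> {}" using partition_sum[OF ct0] by auto
  then obtain U where U: "U \<in> \<U>" "c t0 \<in> U" using supp_mem[OF ct0] by blast
  have "open {t \<in> I. c t \<in> U}" by (rule open_curve_preimage[OF diffeology_X I c cover_open[OF U(1)]])
  then obtain J where J: "open J" "is_interval J" "t0 \<in> J" "J \<subseteq> {t \<in> I. c t \<in> U}"
    using open_real_interval[of "{t \<in> I. c t \<in> U}" t0] t0 U(2) by blast
  have "smooth (interval_diffeology J) (subset_diffeology X U) c"
    by (rule smooth_into_subset[OF diffeology_interval smooth_subset_mono[OF c]]) (use J(4) in auto)
  from smooth_compose[OF sec_smooth[OF U(1)] this]
  have P: "path J (\<lambda>t. sec U (c t))" using J(1) by (simp add: path_def)
  let ?\<gamma> = "snd (theta ((J, \<lambda>t. sec U (c t)), t0))"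
  have "flat J ?\<gamma>"
    using theta_curve[OF P J(2,3)] mean_log_deriv_theta[OF P J(2,3)] by (simp add: flat_def)
  moreover have "\<pi> (?\<gamma> t) = c t" if "t \<in> J" for t
    using theta_\<pi>[OF P J(2,3) that] \<pi>_sec[OF U(1)] J(4) that by auto
  ultimately show ?thesis using that[of J ?\<gamma>] J by blast
qed

text \<open>Translation by a constant group element preserves flatness and reaches every point of
  the fibre.\<close>

lemma flat_lift_through:
  assumes \<gamma>: "flat J \<gamma>" and t: "t \<in> J" and y: "y \<in> points E" "\<pi> y = \<pi> (\<gamma> t)"
  obtains \<delta> where "flat J \<delta>" "\<And>s. s \<in> J \<Longrightarrow> \<pi> (\<delta> s) = \<pi> (\<gamma> s)" "\<delta> t = y"
proof -
  have P: "path J \<gamma>" using \<gamma> by (simp add: flat_def)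
  note g = fibre_quotient_props[OF y(1) path_points[OF P t] y(2)]
  show ?thesis
    by (rule that[of "\<lambda>s. act (fibre_quotient y (\<gamma> t)) (\<gamma> s)"]) (use flat_act[OF \<gamma> g(1)] g \<pi>_act path_points[OF P] in auto)
qed

text \<open>\<open>theta\<close> corrects a given path in \<open>E\<close> but supplies none over
  all of \<open>I\<close>. So the set \<open>R\<close> of times reached by partial lifts through
  \<open>y\<close> is shown to be open and closed in the connected set \<open>I\<close>.\<close>

lemma flat_lift:
  assumes I: "open I" "is_interval I" and c: "smooth (interval_diffeology I) X c" and t0: "t0 \<in> I"
    and y: "y \<in> points E" "\<pi> y = c t0"
  shows "\<exists>\<gamma>. flat I \<gamma> \<and> (\<forall>t\<in>I. \<pi> (\<gamma> t) = c t) \<and> \<gamma> t0 = y"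
proof -
  define L where "L J \<gamma> \<longleftrightarrow> open J \<and> is_interval J \<and> t0 \<in> J \<and> J \<subseteq> I \<and> flat J \<gamma> \<and> (\<forall>t\<in>J. \<pi> (\<gamma> t) = c t) \<and> \<gamma> t0 = y"
    for J \<gamma>
  \<comment> \<open>Two intervals containing \<open>t0\<close> intersect in an interval, on which
    \<open>flat_unique\<close> applies.\<close>
  have agree: "\<gamma> t = \<gamma>' t" if L: "L J \<gamma>" "L J' \<gamma>'" and t: "t \<in> J" "t \<in> J'" for J \<gamma> J' \<gamma>' t
  proof (rule flat_unique[where I = "J \<inter> J'" and ?t0.0 = t0])
    show "flat (J \<inter> J') \<gamma>" "flat (J \<inter> J') \<gamma>'"
      using L flat_restrict[of J \<gamma> "J \<inter> J'" \<gamma>] flat_restrict[of J' \<gamma>' "J \<inter> J'" \<gamma>'] by (auto simp: L_def)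
  qed (use L t in \<open>auto simp: L_def is_interval_Int\<close>)
  define R where "R = {r. \<exists>J \<gamma>. L J \<gamma> \<and> r \<in> J}"
  have RI: "R \<subseteq> I" by (auto simp: R_def L_def)
  have Ro: "open R"
  proof -
    have "R = \<Union>{J. \<exists>\<gamma>. L J \<gamma>}" by (auto simp: R_def)
    then show ?thesis by (auto simp: L_def)
  qed
  \<comment> \<open>If the domain \<open>B\<close> of a local lift touches \<open>R\<close>, that
    lift is translated to meet a partial lift and glued to it. So \<open>R\<close> and its
    complement in \<open>I\<close> are both open.\<close>
  have dich: "\<exists>B. open B \<and> r \<in> B \<and> B \<subseteq> I \<and> (B \<subseteq> R \<or> B \<inter> R = {})" if r: "r \<in> I" for r
  proof -
    obtain B \<delta>0 where B: "open B" "is_interval B" "r \<in> B" "B \<subseteq> I" and \<delta>0: "flat B \<delta>0" "\<And>t. t \<in> B \<Longrightarrow> \<pi> (\<delta>0 t) = c t"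
      by (rule local_flat_lift[OF I(1) c r]) (rule that)
    have "B \<subseteq> R" if BR: "B \<inter> R \<noteq> {}"
    proof -
      obtain r' where r'B: "r' \<in> B" "r' \<in> R" using BR by blast
      then obtain J \<gamma> where L: "L J \<gamma>" and r'J: "r' \<in> J" unfolding R_def by blast
      note r' = r'B(1) r'J
      have J: "open J" "is_interval J" "t0 \<in> J" "J \<subseteq> I" "flat J \<gamma>" "\<And>t. t \<in> J \<Longrightarrow> \<pi> (\<gamma> t) = c t" "\<gamma> t0 = y"
        using L by (auto simp: L_def)
      have "\<gamma> r' \<in> points E" using J(5) r'(2) by (auto simp: flat_def intro: path_points)
      moreover have "\<pi> (\<gamma> r') = \<pi> (\<delta>0 r')" using J(6) \<delta>0(2) r' by simp
      ultimately obtain \<delta> where \<delta>: "flat B \<delta>" "\<And>t. t \<in> B \<Longrightarrow> \<pi> (\<delta> t) = \<pi> (\<delta>0 t)" "\<delta> r' = \<gamma> r'"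
        by (rule flat_lift_through[OF \<delta>0(1) r'(1)]) (rule that)
      have eq: "\<delta> t = \<gamma> t" if t: "t \<in> J" "t \<in> B" for t
      proof (rule flat_unique[where I = "J \<inter> B" and ?t0.0 = r'])
        show "flat (J \<inter> B) \<delta>" by (rule flat_restrict[OF \<delta>(1)]) (use J B in auto)
        show "flat (J \<inter> B) \<gamma>" by (rule flat_restrict[OF J(5)]) (use J B in auto)
      qed (use J B r' t \<delta> \<delta>0 in \<open>auto simp: is_interval_Int\<close>)
      define \<eta> where "\<eta> t = (if t \<in> J then \<gamma> t else \<delta> t)" for t
      have \<eta>: "flat J \<eta>" "flat B \<eta>"
        by (rule flat_restrict[OF J(5) J(1)], simp, simp add: \<eta>_def)
          (rule flat_restrict[OF \<delta>(1) B(1)], simp, use eq in \<open>simp add: \<eta>_def\<close>)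
      have "flat (J \<union> B) \<eta>"
        by (rule flat_local) (use J(1) B(1) \<eta> in auto)
      moreover have "is_interval (J \<union> B)"
        using J(2) B(2) r' unfolding is_interval_connected_1 by (intro connected_Un) auto
      ultimately have "L (J \<union> B) \<eta>"
        using J B \<delta>(2) \<delta>0(2) by (auto simp: L_def \<eta>_def)
      then show ?thesis by (auto simp: R_def)
    qed
    then show ?thesis using B by blast
  qed
  have t0R: "t0 \<in> R"
  proof -
    obtain B \<delta>0 where B: "open B" "is_interval B" "t0 \<in> B" "B \<subseteq> I" and \<delta>0: "flat B \<delta>0" "\<And>t. t \<in> B \<Longrightarrow> \<pi> (\<delta>0 t) = c t"
      by (rule local_flat_lift[OF I(1) c t0]) (rule that)
    have "\<pi> y = \<pi> (\<delta>0 t0)" using y(2) \<delta>0(2)[OF B(3)] by simp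
    then obtain \<delta> where "flat B \<delta>" "\<And>t. t \<in> B \<Longrightarrow> \<pi> (\<delta> t) = \<pi> (\<delta>0 t)" "\<delta> t0 = y"
      by (rule flat_lift_through[OF \<delta>0(1) B(3) y(1)]) (rule that)
    then have "L B \<delta>" using B \<delta>0(2) by (simp add: L_def)
    then show ?thesis using B(3) by (auto simp: R_def)
  qed
  have "R = I"
  proof -
    define Q where "Q = \<Union>{B. open B \<and> B \<subseteq> I \<and> B \<inter> R = {}}"
    have "connected I" using I(2) is_interval_connected_1 by blast
    moreover have "open Q" unfolding Q_def by (rule open_Union) simp
    moreover have cov: "I \<subseteq> R \<union> Q"
    proof
      fix r assume "r \<in> I"
      then obtain B where "open B" "r \<in> B" "B \<subseteq> I" "B \<subseteq> R \<or> B \<inter> R = {}" using dich by metis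
      then show "r \<in> R \<union> Q" unfolding Q_def by (elim disjE) auto
    qed
    moreover have "R \<inter> Q \<inter> I = {}" by (auto simp: Q_def)
    ultimately have "R \<inter> I = {} \<or> Q \<inter> I = {}" using connectedD[OF _ Ro] by metis
    then show ?thesis using t0R RI t0 cov by auto
  qed
  then have "\<forall>r\<in>I. \<exists>J \<gamma>. L J \<gamma> \<and> r \<in> J" by (auto simp: R_def)
  then obtain Jr \<gamma>r where Lr: "\<And>r. r \<in> I \<Longrightarrow> L (Jr r) (\<gamma>r r) \<and> r \<in> Jr r" by metis
  \<comment> \<open>Each time takes its value from a partial lift chosen for it. By
    \<open>agree\<close> the result coincides with the lift chosen for \<open>r\<close> on the whole
    domain of that lift, which makes it flat.\<close>
  define \<gamma> where "\<gamma> r = \<gamma>r r r" for r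
  have eq: "\<gamma> t = \<gamma>r r t" if "r \<in> I" "t \<in> Jr r" for r t
  proof -
    have "t \<in> I" using Lr[OF that(1)] that(2) by (auto simp: L_def)
    then show ?thesis unfolding \<gamma>_def using agree[of "Jr t" "\<gamma>r t" "Jr r" "\<gamma>r r" t] Lr that by blast
  qed
  have "flat I \<gamma>"
  proof (rule flat_local[OF I(1)])
    fix r assume r: "r \<in> I"
    have "flat (Jr r) \<gamma>"
      by (rule flat_restrict[of "Jr r" "\<gamma>r r"]) (use Lr[OF r] eq[OF r] in \<open>auto simp: L_def\<close>)
    then show "\<exists>J. open J \<and> r \<in> J \<and> J \<subseteq> I \<and> flat J \<gamma>" using Lr[OF r] by (auto simp: L_def)
  qed
  moreover have "\<pi> (\<gamma> t) = c t" if "t \<in> I" for t using Lr[OF that] by (simp add: \<gamma>_def L_def)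
  moreover have "\<gamma> t0 = y" using Lr[OF t0] by (simp add: \<gamma>_def L_def)
  ultimately show ?thesis by blast
qed

lemma unique_horizontal_lift:
  assumes c: "c \<in> points (Paths_loc X)" and t0: "t0 \<in> fst c" and y: "y \<in> points E" "\<pi> y = snd c t0"
  shows "\<exists>!\<gamma>. horizontal_lift E \<pi> theta c t0 y \<gamma>"
proof -
  obtain I c' where c': "c = (I, c')" by fastforce
  have I: "open_interval I" "open I" "is_interval I" "smooth (interval_diffeology I) X c'"
    using c by (auto simp: c' points_Paths_loc open_interval_def)
  have t0: "t0 \<in> I" "\<pi> y = c' t0" using t0 y(2) by (auto simp: c')
  have lift: "horizontal_lift E \<pi> theta c t0 y (J, \<gamma>) \<longleftrightarrow>
      J = I \<and> \<gamma> \<in> extensional I \<and> flat I \<gamma> \<and> (\<forall>t\<in>I. \<pi> (\<gamma> t) = c' t) \<and> \<gamma> t0 = y" for J \<gamma>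
    using I(1) by (auto simp: horizontal_lift_def horizontal_iff c')
  obtain \<gamma> where \<gamma>: "flat I \<gamma>" "\<forall>t\<in>I. \<pi> (\<gamma> t) = c' t" "\<gamma> t0 = y"
    using flat_lift[OF I(2-4) t0(1) y(1) t0(2)] by blast
  \<comment> \<open>Local paths are extensional, so only the restriction can be the unique
    lift.\<close>
  let ?\<gamma> = "restrict \<gamma> I"
  show ?thesis
  proof (rule ex1I[of _ "(I, ?\<gamma>)"])
    have "flat I ?\<gamma>" by (rule flat_restrict[OF \<gamma>(1) I(2)]) auto
    then show "horizontal_lift E \<pi> theta c t0 y (I, ?\<gamma>)" unfolding lift using \<gamma> t0 by simp
    fix \<delta> assume "horizontal_lift E \<pi> theta c t0 y \<delta>"
    moreover obtain J d where d: "\<delta> = (J, d)" by fastforce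
    ultimately have D: "J = I" "d \<in> extensional I" "flat I d" "\<forall>t\<in>I. \<pi> (d t) = c' t" "d t0 = y"
      using lift by auto
    have "d t = \<gamma> t" if "t \<in> I" for t
      by (rule flat_unique[OF D(3) \<gamma>(1) I(3) _ t0(1) _ that]) (use D \<gamma> in auto)
    then have "d = ?\<gamma>" using D(2) by (auto simp: extensional_def fun_eq_iff)
    then show "\<delta> = (I, ?\<gamma>)" using d D(1) by simp
  qed
qed

end

theorem theorem4p3:
  fixes G :: "'g monoid" and DG :: "'g diffeological_space"
    and W :: "'w::real_vector topology"
    and X :: "'x diffeological_space" and E :: "'e diffeological_space"
    and act :: "'g \<Rightarrow> 'e \<Rightarrow> 'e" and \<pi> :: "'e \<Rightarrow> 'x"
  assumes "regular_diffeological_Lie_group G DG W"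
    and "diffeology X" and "Hausdorff_space (D_topology X)" and "smoothly_paracompact X"
    and "principal_bundle G DG act E X \<pi>" and "weakly_D_numerable E X \<pi>"
  shows "\<exists>\<theta>. diffeological_connection G act E \<pi> \<theta> \<and>
    (\<forall>c\<in>points (Paths_loc X). \<forall>t\<^sub>0\<in>fst c. \<forall>y\<in>points E. \<pi> y = snd c t\<^sub>0 \<longrightarrow>
       (\<exists>!\<gamma>. horizontal_lift E \<pi> \<theta> c t\<^sub>0 y \<gamma>))"
proof -
  have dg: "diffeological_group G DG"
    using assms(1) by (simp add: regular_diffeological_Lie_group_def diffeological_Lie_group_def)
  obtain Exp where Exp:
    "smooth (smooth_maps unit_interval (tangent_at DG \<one>\<^bsub>G\<^esub>)) (smooth_maps unit_interval DG) Exp"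
    "\<And>\<xi> g. \<xi> \<in> points (smooth_maps unit_interval (tangent_at DG \<one>\<^bsub>G\<^esub>)) \<Longrightarrow>
       g \<in> points (smooth_maps unit_interval DG) \<Longrightarrow> log_derivative_solution G DG \<xi> g \<longleftrightarrow> g = Exp \<xi>"
    using assms(1) unfolding regular_diffeological_Lie_group_def Let_def by blast
  have "\<exists>U :: nat \<Rightarrow> 'x set. (\<Union>i. U i) = points X \<and>
      (\<forall>i. openin (D_topology X) (U i) \<and> trivial_over E X \<pi> (U i))"
    using assms(6) unfolding weakly_D_numerable_def by (elim exE conjE) (intro exI conjI)
  then obtain U :: "nat \<Rightarrow> 'x set" where U: "(\<Union>i. U i) = points X"
    "\<And>i. openin (D_topology X) (U i)" "\<And>i. trivial_over E X \<pi> (U i)"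
    by blast
  \<comment> \<open>The partition is indexed by the sets of the cover rather than by natural
    numbers, so a set that recurs in the sequence counts once.\<close>
  obtain \<rho> where \<rho>: "subordinate_partition X (range U) \<rho>"
  proof -
    have "(\<forall>V\<in>range U. openin (D_topology X) V) \<and> \<Union> (range U) = points X" using U(1,2) by blast
    then have "\<exists>\<rho>. subordinate_partition X (range U) \<rho>"
      using assms(4)[unfolded smoothly_paracompact_def, THEN conjunct2, rule_format] by blast
    then show ?thesis using that by (elim exE)
  qed
  have E: "diffeology E" and surj: "\<pi> ` points E = points X"
    using assms(5) by (simp_all add: principal_bundle_def diffeological_fibre_bundle_def)
  have "\<exists>s. smooth (subset_diffeology X V) E s \<and> (\<forall>x\<in>V. \<pi> (s x) = x)" if "V \<in> range U" for V
  proof (rule trivial_over_section[OF E assms(2) surj])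
    show "V \<subseteq> points X" "trivial_over E X \<pi> V" using that U(1,3) by auto
  qed
  then obtain sec where sec: "\<And>V. V \<in> range U \<Longrightarrow> smooth (subset_diffeology X V) E (sec V) \<and> (\<forall>x\<in>V. \<pi> (sec V x) = x)"
    by metis
  interpret partitioned G DG Exp act E X \<pi> "range U" sec \<rho>
    apply unfold_locales
    subgoal by (rule dg)
    subgoal by (rule Exp(1))
    subgoal by (rule Exp(2))
    subgoal by (rule assms(5))
    subgoal using U(2) by blast
    subgoal using sec by blast
    subgoal using sec by blast
    subgoal by (rule \<rho>)
    done
  show ?thesis using diffeological_connection_theta unique_horizontal_lift by blast
qed

end
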